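(* Let $L=\mathbb{Q}(\sqrt m,\sqrt n)$ be a biquadratic extension of $\mathbb{Q}$ with $m,n$ square-free integers, let $d=\gcd(m,n)$ and $k=\frac{mn}{d^2}$, and let $H_1,H_2,H_3$ be its non-classical Hopf-Galois structures, corresponding to $\sqrt m,\sqrt n,\sqrt k$ respectively. In each equation below the sign $\pm$ means that at least one of the two equations is solvable. 1. If $m\equiv1\pmod 4$ and $n\equiv1\pmod 4$: $\mathcal{O}_L$ is $\mathfrak{A}_{H_1}$-free if and only if there exist $x,y\in\mathbb{Z}$ with $x^2+my^2=\pm2d$; $\mathcal{O}_L$ is $\mathfrak{A}_{H_2}$-free if and only if there exist $x,y\in\mathbb{Z}$ with $x^2+ny^2=\pm2d$; $\mathcal{O}_L$ is $\mathfrak{A}_{H_3}$-free if and only if there exist $x,y\in\mathbb{Z}$ with $x^2+ky^2=\pm2\frac nd$. 2. If $m\equiv1\pmod 4$ and $n\not\equiv1\pmod 4$: $\mathcal{O}_L$ is $\mathfrak{A}_{H_1}$-free if and only if there exist $x,y\in\mathbb{Z}$ with $x^2+my^2=\pm2d$; $\mathcal{O}_L$ is not $\mathfrak{A}_{H_2}$-free and not $\mathfrak{A}_{H_3}$-free. 3. If $m\equiv3\pmod 4$ and $n\equiv2\pmod 4$: $\mathcal{O}_L$ is $\mathfrak{A}_{H_1}$-free if and only if there exist $x,y\in\mathbb{Z}$ with $x^2+my^2=\pm4d$; $\mathcal{O}_L$ is $\mathfrak{A}_{H_2}$-free if and only if there exist $x,y\in\mathbb{Z}$ with $x^2+ny^2=\pm2d$;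 $\mathcal{O}_L$ is $\mathfrak{A}_{H_3}$-free if and only if there exist $x,y\in\mathbb{Z}$ with $x^2+ky^2=\pm2\frac nd$.
   Context: $L=\mathbb{Q}(\sqrt m,\sqrt n)$ has degree $4$ over $\mathbb{Q}$ with Galois group $C_2\times C_2$; its quadratic subfields are $\mathbb{Q}(\sqrt m),\mathbb{Q}(\sqrt n),\mathbb{Q}(\sqrt k)$, with $\sqrt k=\sqrt m\sqrt n/d$ and $d=\gcd(m,n)>0$. A Hopf-Galois structure on $L/\mathbb{Q}$ is a finite-dimensional cocommutative $\mathbb{Q}$-Hopf algebra $H$ with an action making $L$ a left $H$-module algebra such that $L\otimes_{\mathbb{Q}} H\to\mathrm{End}_{\mathbb{Q}}(L)$, $x\otimes h\mapsto(y\mapsto x(h\cdot y))$ is bijective. Besides the classical one $\mathbb{Q}[\mathrm{Gal}(L/\mathbb{Q})]$, there are exactly three, one for each $\zeta\in\{\sqrt m,\sqrt n,\sqrt k\}$ (the structure "given by" or "corresponding to" $\zeta$). Explicitly, let $\tau$ generate $\mathrm{Gal}(L/\mathbb{Q}(\zeta))$ and let $\sigma\in\mathrm{Gal}(L/\mathbb{Q})\setminus\langle\tau\rangle$; since the action is faithful, the structure corresponding to $\zeta$ is identified, as an algebra acting on $L$, with the subalgebra of $\mathrm{End}_{\mathbb{Q}}(L)$ having $\mathbb{Q}$-basis $\mathrm{id},\ \tau,\ \sigma+\sigma\tau,\ \zeta(\sigma-\sigma\tau)$. The associated order is $\mathfrak{A}_H=\{h\in H: h\cdot\mathcal{O}_L\subseteq\mathcal{O}_L\}$;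 "$\mathcal{O}_L$ is $\mathfrak{A}_H$-free" means free (of rank one) as $\mathfrak{A}_H$-module. *)

theory Defs
  imports
    Complex_Main
    "HOL-Number_Theory.Cong"
    "HOL-Computational_Algebra.Squarefree"
    "HOL-Algebra.Bij"
    "HOL-Algebra.Elementary_Groups"
    "HOL-Algebra.Generated_Fields"
    "HOL-Algebra.Algebraic_Closure_Type"
begin

text \<open>
  Number fields are subfields of the complex numbers. Maps \<open>F \<rightarrow> F\<close> are represented by functions that
  are extensional on \<open>F\<close>, so that they are equal as soon as they agree on \<open>F\<close>.
\<close>

text \<open>The subfield of the complex numbers generated by \<open>S\<close>, that is, \<open>\<rat>(S)\<close>.\<close>

definition rat_adjoin :: "complex set \<Rightarrow> complex set" where
  "rat_adjoin S = generate_field (ring_of_type_algebra :: complex ring) S"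

definition ring_of_integers :: "complex set \<Rightarrow> complex set" where
  "ring_of_integers F = {x \<in> F. algebraic_int x}"

text \<open>
  The underlying set of \<open>Gal(F/K)\<close>, for \<open>K \<subseteq> F\<close>; its group structure is that of a subgroup of
  \<open>BijGroup F\<close>, where the product is composition.
\<close>

definition galois_group :: "complex set \<Rightarrow> complex set \<Rightarrow> (complex \<Rightarrow> complex) set" where
  "galois_group F K = {f \<in> Bij F.
     (\<forall>x\<in>F. \<forall>y\<in>F. f (x + y) = f x + f y \<and> f (x * y) = f x * f y) \<and> (\<forall>x\<in>K. f x = x)}"

definition biquadratic :: "complex set \<Rightarrow> bool" where
  "biquadratic F \<longleftrightarrow>
     vector_space.dim (\<lambda>(q::rat) (x::complex). of_rat q * x) F = 4 \<and>
     (BijGroup F)\<lparr>carrier := galois_group F \<rat>\<rparr> \<cong> integer_mod_group 2 \<times>\<times> integer_mod_group 2"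

text \<open>
  The non-classical Hopf-Galois structure on \<open>L/\<rat>\<close> given by \<open>\<zeta>\<close>, for \<open>L\<close> biquadratic and \<open>\<rat>(\<zeta>)\<close> a
  quadratic subfield, as an algebra of endomorphisms of \<open>L\<close>: with \<open>\<tau>\<close> a generator of \<open>Gal(L/\<rat>(\<zeta>))\<close>
  and \<open>\<sigma>\<close> an element of \<open>Gal(L/\<rat>)\<close> outside \<open>\<langle>\<tau>\<rangle>\<close>, it is the \<open>\<rat>\<close>-span of
  \<open>id, \<tau>, \<sigma> + \<sigma>\<tau>, \<zeta>(\<sigma> - \<sigma>\<tau>)\<close>.
  There is only one such \<open>\<tau>\<close>, and the span does not depend on \<open>\<sigma>\<close>: the only other choice is \<open>\<sigma>\<tau>\<close>,
  which changes the sign of the last basis element. Hence the existential quantifier over \<open>\<tau>\<close> and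
  \<open>\<sigma>\<close> selects a single span.
\<close>

definition hopf_galois_algebra :: "complex set \<Rightarrow> complex \<Rightarrow> (complex \<Rightarrow> complex) set" where
  "hopf_galois_algebra L \<zeta> = {h. \<exists>\<tau> \<sigma>.
     generate (BijGroup L) {\<tau>} = galois_group L (rat_adjoin {\<zeta>}) \<and>
     \<sigma> \<in> galois_group L \<rat> - generate (BijGroup L) {\<tau>} \<and>
     (\<exists>a\<in>\<rat>. \<exists>b\<in>\<rat>. \<exists>c\<in>\<rat>. \<exists>e\<in>\<rat>.
        h = (\<lambda>x\<in>L. a * x + b * \<tau> x + c * (\<sigma> x + \<sigma> (\<tau> x)) + e * (\<zeta> * (\<sigma> x - \<sigma> (\<tau> x)))))}"

definition associated_order ::
    "complex set \<Rightarrow> (complex \<Rightarrow> complex) set \<Rightarrow> (complex \<Rightarrow> complex) set" where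
  "associated_order L H = {h \<in> H. \<forall>x \<in> ring_of_integers L. h x \<in> ring_of_integers L}"

text \<open>
  For a ring \<open>A\<close> of endomorphisms acting on \<open>M\<close> by evaluation: \<open>M\<close> is free of rank one over \<open>A\<close>, that
  is, some \<open>\<beta> \<in> M\<close> is a basis, every element of \<open>M\<close> being \<open>h \<beta>\<close> for exactly one \<open>h \<in> A\<close>.
\<close>

definition free_of_rank_one :: "(complex \<Rightarrow> complex) set \<Rightarrow> complex set \<Rightarrow> bool" where
  "free_of_rank_one A M \<longleftrightarrow> (\<exists>\<beta>\<in>M. bij_betw (\<lambda>h. h \<beta>) A M)"

text \<open>\<open>x\<^sup>2 + a y\<^sup>2 = \<plusminus>c\<close> is solvable in integers for at least one choice of the sign.\<close>

definition solvable_pm :: "int \<Rightarrow> int \<Rightarrow> bool" where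
  "solvable_pm a c \<longleftrightarrow> (\<exists>x y. x\<^sup>2 + a * y\<^sup>2 = c) \<or> (\<exists>x y. x\<^sup>2 + a * y\<^sup>2 = - c)"

end

theory Submission
  imports Defs "Jordan_Normal_Form.Char_Poly"
begin

text \<open>
  Write \<open>m = a b\<close>, \<open>n = a c\<close> with \<open>a = d\<close>, and let \<open>r, s, t\<close> be square roots of \<open>a b, a c, b c\<close> with
  \<open>r s = a t\<close>, \<open>r t = b s\<close>, \<open>s t = c r\<close>. This description is symmetric under permuting \<open>r, s, t\<close> (and
  \<open>a, b, c\<close> accordingly) and under \<open>(a, b, c, t) \<mapsto> (- a, - b, - c, - t)\<close>, so it is enough to treat the
  structure given by \<open>r\<close>. In coordinates with respect to \<open>1, r, s, t\<close> its algebra acts on \<open>1\<close> and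
  \<open>r\<close> by independent scalars and on the plane spanned by \<open>s, t\<close> by \<open>C + E J\<close>, where \<open>J s = a t\<close> and
  \<open>J t = - b s\<close>. If \<open>\<beta>\<close> generates \<open>O_L\<close>, then the elements of the associated order that send \<open>\<beta>\<close> into
  that plane vanish on \<open>1\<close> and \<open>r\<close>, and comparing two-by-two determinants there shows that the value of
  \<open>a x\<^sup>2 + b y\<^sup>2\<close> at the plane coordinates of \<open>\<beta>\<close> divides \<open>2\<close> (or \<open>4\<close>), while the parity conditions
  defining \<open>O_L\<close> force the opposite divisibility. Conversely a solution of \<open>a x\<^sup>2 + b y\<^sup>2 = \<plusminus>2\<close> (or
  \<open>\<plusminus>4\<close>) yields a generator by Cramer's rule. Multiplying by \<open>a\<close> turns the equation into
  \<open>x\<^sup>2 + a b y\<^sup>2 = \<plusminus>2 a\<close>, since \<open>a\<close> is square-free.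
\<close>

subsection \<open>Cyclic lattices\<close>

text \<open>The plus sign in the equations comes from \<open>J\<close>: on the plane
  \<open>J^2 = - a b\<close>, and \<open>a x^2 + b y^2\<close> is the determinant of
  \<open>v = (x, y)\<close> and \<open>J v\<close>. So \<open>(C, E) \<mapsto> (C + E J) v\<close>
  scales areas by this number, and freeness compares the index of the admissible pairs
  \<open>(C, E)\<close> with that of the plane part of \<open>O_L\<close>. The obstacle is that
  \<open>O_L\<close> is in general not the sum of its parts on \<open>1, r\<close> and on
  \<open>s, t\<close>: congruences tie the scalars \<open>A\<close>, \<open>B\<close> on
  \<open>1\<close>, \<open>r\<close> to \<open>C\<close> and \<open>E\<close>. Once the image of
  \<open>\<beta>\<close> lies in the plane, \<open>A = B = 0\<close>, and the pairs
  \<open>(C, E)\<close> surviving these congruences determine the constant. The constant 4 arises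
  when \<open>- a b\<close> is 1 mod 4, because \<open>(1 + J) / 2\<close> then preserves the plane
  part. Where freeness always fails, the congruences tie \<open>B\<close> to \<open>C\<close> and
  \<open>C\<close> to \<open>A\<close>: sending \<open>\<beta>\<close> to an element with
  \<open>B = 0\<close> makes \<open>A\<close> even, although the first coordinate requires
  \<open>A\<close> to divide 1.\<close>

type_synonym quad = "rat \<times> rat \<times> rat \<times> rat"

text \<open>On the plane, \<open>J\<close> is multiplication by \<open>r\<close> after the
  automorphism fixing \<open>s\<close> and negating \<open>t\<close>. This is the origin of the
  single minus sign: \<open>r s = a t\<close>, but \<open>r (- t) = - b s\<close>.\<close>

fun act :: "int \<Rightarrow> int \<Rightarrow> quad \<Rightarrow> quad \<Rightarrow> quad" where
  "act a b (A, B, C, E) (x1, x2, x3, x4) =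
     (A * x1, B * x2, C * x3 - of_int b * E * x4, C * x4 + of_int a * E * x3)"

lemma act_eqD:
  assumes "act a b (A, B, C, E) (x1, x2, x3, x4) = (y1, y2, y3, y4)"
  shows "A * x1 = y1" "B * x2 = y2" "C * x3 - of_int b * E * x4 = y3" "C * x4 + of_int a * E * x3 = y4"
  using assms by simp_all

lemma act_eq_nonzero:
  assumes "act a b q (x1, x2, x3, x4) = (y1, y2, y3, y4)"
  shows "y1 \<noteq> 0 \<Longrightarrow> x1 \<noteq> 0" "y2 \<noteq> 0 \<Longrightarrow> x2 \<noteq> 0"
  using act_eqD[of a b "fst q" "fst (snd q)" "fst (snd (snd q))" "snd (snd (snd q))" x1 x2 x3 x4] assms
  by (metis mult_zero_right prod.collapse)+

text \<open>Only existence of \<open>q\<close> is demanded. Uniqueness, which freeness also needs,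
  comes for nothing once the four unit vectors lie in \<open>M\<close>; see
  \<open>act_injective\<close>.\<close>

definition cyclic :: "int \<Rightarrow> int \<Rightarrow> quad set \<Rightarrow> bool" where
  "cyclic a b M \<longleftrightarrow>
     (\<exists>x\<in>M. \<forall>y\<in>M. \<exists>q. (\<forall>z\<in>M. act a b q z \<in> M) \<and> act a b q x = y)"

definition represents_pm :: "int \<Rightarrow> int \<Rightarrow> int \<Rightarrow> bool" where
  "represents_pm a b N \<longleftrightarrow> (\<exists>x y. \<bar>a * x\<^sup>2 + b * y\<^sup>2\<bar> = N)"

text \<open>Multiplicativity of determinants: the two images are combinations, with coefficients
  \<open>(C, E)\<close> and \<open>(C', E')\<close>, of \<open>v = (x, y)\<close> and
  \<open>J v = (- b y, a x)\<close>, whose own determinant is \<open>a x^2 + b y^2\<close>.\<close>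

lemma plane_determinant:
  fixes a b :: "'a::comm_ring_1"
  assumes "C * x - b * E * y = u" "C * y + a * E * x = v"
    and "C' * x - b * E' * y = u'" "C' * y + a * E' * x = v'"
  shows "(C * E' - C' * E) * (a * x\<^sup>2 + b * y\<^sup>2) = u * v' - u' * v"
  unfolding assms[symmetric] by (simp add: algebra_simps power2_eq_square)

text \<open>Cramer's rule for the columns \<open>v\<close> and \<open>J v\<close>. Denominators are
  cleared so that it can be applied to integers.\<close>

lemma plane_solve:
  fixes a b :: "'a::idom"
  assumes "N = a * x\<^sup>2 + b * y\<^sup>2" "N \<noteq> 0"
    and C: "N * C = a * x * u + b * y * v" and E: "N * E = x * v - y * u"
  shows "C * x - b * E * y = u" and "C * y + a * E * x = v"
proof -
  have "N * (C * x - b * E * y) = (N * C) * x - b * (N * E) * y"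
    by (simp add: algebra_simps)
  also have "\<dots> = (a * x\<^sup>2 + b * y\<^sup>2) * u"
    unfolding C E by (simp add: algebra_simps power2_eq_square)
  also have "\<dots> = N * u" by (simp only: assms(1))
  finally show "C * x - b * E * y = u" using assms(2) by simp
  have "N * (C * y + a * E * x) = (N * C) * y + a * (N * E) * x"
    by (simp add: algebra_simps)
  also have "\<dots> = (a * x\<^sup>2 + b * y\<^sup>2) * v"
    unfolding C E by (simp add: algebra_simps power2_eq_square)
  also have "\<dots> = N * v" by (simp only: assms(1))
  finally show "C * y + a * E * x = v" using assms(2) by simp
qed

text \<open>By Bezout. Images of lattice vectors expose \<open>E\<close> only through
  \<open>a E\<close> and \<open>b E\<close>, so this is the way to reach \<open>E\<close>
  itself.\<close>

lemma coprime_Ints: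
  fixes E :: rat
  assumes "coprime a b" "of_int a * E \<in> \<int>" "of_int b * E \<in> \<int>"
  shows "E \<in> \<int>"
proof -
  obtain u v where "u * a + v * b = (1::int)"
    using assms(1) by (metis bezout_int coprime_iff_gcd_eq_1)
  then have "E = of_int u * (of_int a * E) + of_int v * (of_int b * E)"
    by (metis (no_types, lifting) distrib_right mult.assoc mult_1 of_int_1 of_int_add of_int_mult)
  also have "\<dots> \<in> \<int>" by (rule Ints_add; rule Ints_mult) (use assms in simp_all)
  finally show ?thesis .
qed

text \<open>
  The rings of integers in the congruence cases 1, 2, 3 of the theorem, in coordinates with respect to
  \<open>1, r, s, t\<close>. In cases 2 and 3 the suffix \<open>r\<close> refers to the structure given by \<open>\<surd>m\<close>, and \<open>s\<close> to
  the other two, after moving the square root that gives the structure to the second coordinate.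
\<close>

definition lattice1 :: "quad set" where
  "lattice1 = {(of_int x1 / 4, of_int x2 / 4, of_int x3 / 4, of_int x4 / 4) | x1 x2 x3 x4.
     even (x1 - x2) \<and> even (x1 - x3) \<and> even (x1 - x4) \<and> 4 dvd x1 + x2 + x3 + x4}"

definition lattice2r :: "quad set" where
  "lattice2r = {(of_int x1 / 2, of_int x2 / 2, of_int x3 / 2, of_int x4 / 2) | x1 x2 x3 x4.
     even (x1 - x2) \<and> even (x3 - x4)}"

definition lattice2s :: "quad set" where
  "lattice2s = {(of_int x1 / 2, of_int x2 / 2, of_int x3 / 2, of_int x4 / 2) | x1 x2 x3 x4.
     even (x1 - x3) \<and> even (x2 - x4)}"

definition lattice3r :: "quad set" where
  "lattice3r = {(of_int x1, of_int x2, of_int x3 / 2, of_int x4 / 2) | x1 x2 x3 x4.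
     even (x3 - x4)}"

definition lattice3s :: "quad set" where
  "lattice3s = {(of_int x1, of_int x2 / 2, of_int x3, of_int x4 / 2) | x1 x2 x3 x4.
     even (x2 - x4)}"

lemma lattice1_iff:
  "(of_int x1 / 4, of_int x2 / 4, of_int x3 / 4, of_int x4 / 4) \<in> lattice1 \<longleftrightarrow>
     even (x1 - x2) \<and> even (x1 - x3) \<and> even (x1 - x4) \<and> 4 dvd x1 + x2 + x3 + x4"
  unfolding lattice1_def by auto

lemma lattice2r_iff:
  "(of_int x1 / 2, of_int x2 / 2, of_int x3 / 2, of_int x4 / 2) \<in> lattice2r \<longleftrightarrow>
     even (x1 - x2) \<and> even (x3 - x4)"
  unfolding lattice2r_def by auto

lemma lattice2s_iff:
  "(of_int x1 / 2, of_int x2 / 2, of_int x3 / 2, of_int x4 / 2) \<in> lattice2s \<longleftrightarrow>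
     even (x1 - x3) \<and> even (x2 - x4)"
  unfolding lattice2s_def by auto

lemma lattice3r_iff:
  "(of_int x1, of_int x2, of_int x3 / 2, of_int x4 / 2) \<in> lattice3r \<longleftrightarrow> even (x3 - x4)"
  unfolding lattice3r_def by auto

lemma lattice3s_iff:
  "(of_int x1, of_int x2 / 2, of_int x3, of_int x4 / 2) \<in> lattice3s \<longleftrightarrow> even (x2 - x4)"
  unfolding lattice3s_def by auto

text \<open>The element \<open>q\<close> reaching \<open>(0, 1/2, 0, 1/2)\<close> shows that the
  generator has a nonzero second coordinate, so the \<open>q'\<close> reaching
  \<open>(1/2, 0, 1/2, 0)\<close> has \<open>B = 0\<close>. The images of these same two vectors
  under \<open>q'\<close> give \<open>B \<equiv> C\<close> and \<open>A \<equiv> C\<close> mod 2,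
  hence \<open>A\<close> is even, against \<open>A x1 = 1\<close>.\<close>

lemma not_cyclic_lattice2s:
  assumes "coprime a b"
  shows "\<not> cyclic a b lattice2s"
proof
  assume "cyclic a b lattice2s"
  then obtain x where x: "x \<in> lattice2s" and
    surj: "\<And>y. y \<in> lattice2s \<Longrightarrow> \<exists>q. (\<forall>z\<in>lattice2s. act a b q z \<in> lattice2s) \<and> act a b q x = y"
    unfolding cyclic_def by blast
  obtain x1 x2 x3 x4 where xe: "x = (of_int x1 / 2, of_int x2 / 2, of_int x3 / 2, of_int x4 / 2)"
    using x unfolding lattice2s_def by auto
  have units: "(0, 1/2, 0, 1/2) \<in> lattice2s" "(1/2, 0, 1/2, 0) \<in> lattice2s"
    using lattice2s_iff[of 0 1 0 1] lattice2s_iff[of 1 0 1 0] by auto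
  with surj obtain q q' where q: "act a b q x = (0, 1/2, 0, 1/2)"
    and q': "\<And>z. z \<in> lattice2s \<Longrightarrow> act a b q' z \<in> lattice2s" "act a b q' x = (1/2, 0, 1/2, 0)"
    by metis
  have "x2 \<noteq> 0" using q by (cases q) (auto simp: xe)
  obtain A B C E where qe: "q' = (A, B, C, E)" by (cases q')
  have B: "B = 0" and A: "A * of_int x1 = 1" using q'(2) \<open>x2 \<noteq> 0\<close> by (auto simp: xe qe)
  from q'(1)[OF units(2)] q'(1)[OF units(1)]
  obtain y1 y3 z2 z4 where "A = of_int y1" "C = of_int y3" "even (y1 - y3)"
      "B = of_int z2" "C = of_int z4" "even (z2 - z4)"
    unfolding lattice2s_def by (auto simp: qe)
  moreover from this A have "y1 * x1 = 1"
    by (metis of_int_eq_1_iff of_int_mult)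
  then have "odd y1" by (metis dvd_mult2 odd_one)
  ultimately show False using B by auto
qed

section \<open>Case 1: the stabilizer of the lattice and its cyclic generators\<close>

lemma even_diffE:
  fixes x y :: int
  assumes "even (x - y)"
  obtains k where "y = x + 2 * k"
  using assms by (metis add.commute diff_add_cancel dvd_def minus_diff_eq dvd_minus_iff)

text \<open>The three congruences on \<open>A, B, C, E\<close> are exactly those that
  \<open>lattice1_stabilizer\<close> finds to be necessary. The parity conditions on the image are
  immediate; the condition mod 4 needs all of the hypotheses at once.\<close>

lemma act_lattice1:
  assumes a: "a mod 4 = 1" and b: "b mod 4 = 1"
    and AB: "even (A - B)" and AC: "even (A - C - E)" and ABC: "4 dvd A + B + 2 * C"
    and z: "z \<in> lattice1"
  shows "act a b (of_int A, of_int B, of_int C, of_int E) z \<in> lattice1"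
proof -
  obtain z1 z2 z3 z4 where ze: "z = (of_int z1 / 4, of_int z2 / 4, of_int z3 / 4, of_int z4 / 4)"
    and zc: "even (z1 - z2)" "even (z1 - z3)" "even (z1 - z4)" "4 dvd z1 + z2 + z3 + z4"
    using z unfolding lattice1_def by auto
  obtain p where p: "z2 = z1 + 2 * p" using even_diffE[OF zc(1)] .
  obtain u where u: "z3 = z1 + 2 * u" using even_diffE[OF zc(2)] .
  obtain v where v: "z4 = z1 + 2 * v" using even_diffE[OF zc(3)] .
  have "even (p + u + v)" using zc(4) p u v by presburger
  then obtain w where w: "p + u + v = 2 * w" by (elim evenE)
  have w': "p = 2 * w - u - v" using w by simp
  obtain a' b' where a': "a = 1 + 4 * a'" and b': "b = 1 + 4 * b'"
    using a b by (metis add.commute mult.commute div_mult_mod_eq)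
  have "even ((A - E) - C)" using AC by presburger
  then obtain h where h: "C = A - E + 2 * h" by (elim even_diffE)
  have "even ((B - A) div 2 - E)" and B: "B = A + 2 * ((B - A) div 2)"
    using AB ABC h by presburger+
  then obtain g where "(B - A) div 2 - E = 2 * g" by (elim evenE)
  then have g: "B = A + 2 * E + 4 * g" using B by linarith
  \<comment> \<open>All congruences have been solved by parameters: \<open>p, u, v, w\<close> for
    the vector, \<open>g, h\<close> for the coefficients, \<open>a', b'\<close> for
    \<open>a, b\<close>. Divisibility by 4 is now a polynomial identity.\<close>
  have "4 dvd A * z1 + B * z2 + (C * z3 - b * E * z4) + (C * z4 + a * E * z3)"
  proof
    show "A * z1 + B * z2 + (C * z3 - b * E * z4) + (C * z4 + a * E * z3) =
      4 * (z1 * (A + g + h) + A * w + E * p + 2 * g * p + h * u + h * v - E * v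
            + a' * E * z3 - b' * E * z4)"
      unfolding g h a' b' p u v w' by (simp add: algebra_simps)
  qed
  moreover have "odd a" "odd b" using a b by presburger+
  then have "even (A * z1 - B * z2)" "even (A * z1 - (C * z3 - b * E * z4))"
    "even (A * z1 - (C * z4 + a * E * z3))"
    using AB AC zc(1-3) by auto
  ultimately show ?thesis
    unfolding ze using lattice1_iff[of "A * z1" "B * z2" "C * z3 - b * E * z4" "C * z4 + a * E * z3"]
    by (simp add: diff_divide_distrib add_divide_distrib)
qed

text \<open>Five test vectors are enough. In turn they show that \<open>A\<close> is integral; that
  \<open>B\<close> is; that \<open>C\<close> and \<open>a E\<close> are, with a parity condition;
  that \<open>b E\<close> is, whence \<open>E\<close> by coprimality; and finally the condition mod
  4, where \<open>a \<equiv> b\<close> mod 4 removes \<open>E\<close> from the sum.\<close>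

lemma lattice1_stabilizer:
  assumes a: "a mod 4 = 1" and b: "b mod 4 = 1" and "coprime a b"
    and q: "\<And>z. z \<in> lattice1 \<Longrightarrow> act a b q z \<in> lattice1"
  obtains A B C E where "q = (of_int A, of_int B, of_int C, of_int E)"
    "even (A - B)" "even (A - C - E)" "4 dvd A + B + 2 * C"
proof -
  obtain A B C E where qe: "q = (A, B, C, E)" by (cases q)
  have "(1, 0, 0, 0) \<in> lattice1" "(1/2, 1/2, 0, 0) \<in> lattice1" "(1/2, 0, 1/2, 0) \<in> lattice1"
    "(1/2, 0, 0, 1/2) \<in> lattice1" "(1/4, 1/4, 1/4, 1/4) \<in> lattice1"
    using lattice1_iff[of 4 0 0 0] lattice1_iff[of 2 2 0 0] lattice1_iff[of 2 0 2 0]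
      lattice1_iff[of 2 0 0 2] lattice1_iff[of 1 1 1 1] by auto
  note mem = this[THEN q]
  obtain A' where A': "A = of_int A'"
    using mem(1) unfolding lattice1_def qe by (auto elim!: dvdE)
  obtain B' where B': "B = of_int B'"
    using mem(2) unfolding lattice1_def qe by (auto elim!: dvdE)
  obtain C' e where C': "C = of_int C'" and e: "of_int a * E = of_int e" "even (A' + C' + e)"
  proof -
    obtain y1 y3 y4 where A1: "A / 2 = of_int y1 / 4" "C / 2 = of_int y3 / 4"
      "of_int a * E / 2 = of_int y4 / 4"
      and y: "even y1" "even y3" "even y4" "4 dvd y1 + y3 + y4"
      using mem(3) unfolding lattice1_def qe by auto
    have "y1 = 2 * A'" using A1 A' by linarith
    with y have "4 dvd 2 * A' + y3 + y4" "even y3" "even y4" by auto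
    then have "even (A' + y3 div 2 + y4 div 2)" by presburger
    moreover have "C = of_int (y3 div 2)" "of_int a * E = of_int (y4 div 2)"
      using \<open>even y3\<close> \<open>even y4\<close> \<open>C / 2 = _\<close> \<open>of_int a * E / 2 = _\<close> by (auto elim!: evenE simp: mult.commute)
    ultimately show ?thesis using that by blast
  qed
  have "of_int b * E \<in> \<int>" using mem(4) unfolding lattice1_def qe
    by (auto elim!: dvdE) (metis Ints_minus Ints_of_int minus_minus mult.commute)
  then have "E \<in> \<int>" using coprime_Ints[of a b E] \<open>coprime a b\<close> e(1) by simp
  then obtain E' where E': "E = of_int E'" by (elim Ints_cases)
  have "e = a * E'" using e(1) E' by (metis of_int_eq_iff of_int_mult)
  moreover have "odd a" using a by presburger
  ultimately have AC: "even (A' - C' - E')" using e(2) by auto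
  have "even (A' - B') \<and> 4 dvd A' + B' + (C' - b * E') + (C' + a * E')"
  proof -
    obtain y1 y2 y3 y4 where "A / 4 = of_int y1 / 4" "B / 4 = of_int y2 / 4"
      "C / 4 - of_int b * E / 4 = of_int y3 / 4" "C / 4 + of_int a * E / 4 = of_int y4 / 4"
      and y: "even (y1 - y2)" "4 dvd y1 + y2 + y3 + y4"
      using mem(5) unfolding lattice1_def qe by auto
    moreover have "rat_of_int (C' - b * E') = 4 * (C / 4 - of_int b * E / 4)"
      "rat_of_int (C' + a * E') = 4 * (C / 4 + of_int a * E / 4)"
      unfolding C' E' by simp_all
    ultimately have "rat_of_int A' = of_int y1" "rat_of_int B' = of_int y2"
      "rat_of_int (C' - b * E') = of_int y3" "rat_of_int (C' + a * E') = of_int y4"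
      unfolding A' B' by simp_all
    then have "A' = y1" "B' = y2" "C' - b * E' = y3" "C' + a * E' = y4"
      unfolding of_int_eq_iff by simp_all
    then show ?thesis using y by simp
  qed
  moreover obtain a' b' where a': "a = 1 + 4 * a'" and b': "b = 1 + 4 * b'"
    using a b by (metis add.commute mult.commute div_mult_mod_eq)
  have "A' + B' + (C' - b * E') + (C' + a * E') = A' + B' + 2 * C' + 4 * (a' * E' - b' * E')"
    unfolding a' b' by (simp add: algebra_simps)
  ultimately have "even (A' - B')" "4 dvd A' + B' + 2 * C'" by (auto simp: dvd_add_left_iff)
  with AC show ?thesis using that[of A' B' C' E'] qe A' B' C' E' by simp
qed

lemma abs_eq_signE:
  fixes n :: int
  assumes "\<bar>n\<bar> = m"
  obtains e where "e = 1 \<or> e = - 1" "n = m * e"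
proof (cases "n < 0")
  case True
  then show ?thesis using that[of "- 1"] assms by simp
next
  case False
  then show ?thesis using that[of 1] assms by simp
qed

text \<open>The parities of \<open>x\<close> and \<open>y\<close> agree because \<open>a\<close> and
  \<open>b\<close> are odd, and two even values would give a multiple of 4. Odd values are what the
  integral generators built from a solution require.\<close>

lemma odd_odd_of_abs_eq_2:
  fixes a b :: int
  assumes ab: "odd a" "odd b" and N: "\<bar>a * x\<^sup>2 + b * y\<^sup>2\<bar> = 2"
  shows "odd x \<and> odd y"
proof -
  have "even (a * x\<^sup>2 + b * y\<^sup>2)" by (metis N dvd_abs_iff dvd_refl)
  then have xy: "even x \<longleftrightarrow> even y" using ab by auto
  have "odd x"
  proof
    assume "even x"
    then obtain x' y' where "x = 2 * x'" "y = 2 * y'" using xy by (auto elim!: evenE)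
    then have "a * x\<^sup>2 + b * y\<^sup>2 = 4 * (a * x'\<^sup>2 + b * y'\<^sup>2)"
      by (simp add: power_mult_distrib)
    then have "4 dvd (2::int)" by (metis N dvd_abs_iff dvd_triv_left)
    then show False by simp
  qed
  with xy show ?thesis by simp
qed

lemma cyclic_lattice1:
  assumes a: "a mod 4 = 1" and b: "b mod 4 = 1" and cop: "coprime a b"
  shows "cyclic a b lattice1 \<longleftrightarrow> represents_pm a b 2"
proof
  have ab: "odd a" "odd b" using a b by presburger+
  assume "cyclic a b lattice1"
  then obtain x where x: "x \<in> lattice1" and
    surj: "\<And>y. y \<in> lattice1 \<Longrightarrow> \<exists>q. (\<forall>z\<in>lattice1. act a b q z \<in> lattice1) \<and> act a b q x = y"
    unfolding cyclic_def by blast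
  obtain x1 x2 x3 x4 where xe: "x = (of_int x1 / 4, of_int x2 / 4, of_int x3 / 4, of_int x4 / 4)"
    and xc: "even (x1 - x2)" "even (x1 - x3)" "even (x1 - x4)"
    using x unfolding lattice1_def by auto
  have "(1, 0, 0, 0) \<in> lattice1" "(0, 1, 0, 0) \<in> lattice1"
    using lattice1_iff[of 4 0 0 0] lattice1_iff[of 0 4 0 0] by auto
  with surj obtain q q' where q: "act a b q x = (1, 0, 0, 0)" "act a b q' x = (0, 1, 0, 0)" by metis
  have nz: "x1 \<noteq> 0" "x2 \<noteq> 0"
    using act_eq_nonzero(1)[OF q(1)[unfolded xe]] act_eq_nonzero(2)[OF q(2)[unfolded xe]] by auto
  have plane: "\<exists>C E. C * x3 - b * E * x4 = u \<and> C * x4 + a * E * x3 = v"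
    if uv: "even (u + v)" for u v
  proof -
    have "4 dvd 2 * u + 2 * v" using uv by presburger
    then have "(0, 0, of_int u / 2, of_int v / 2) \<in> lattice1"
      using lattice1_iff[of 0 0 "2 * u" "2 * v"] by simp
    then obtain q where q: "\<And>z. z \<in> lattice1 \<Longrightarrow> act a b q z \<in> lattice1"
        and qx: "act a b q x = (0, 0, of_int u / 2, of_int v / 2)"
      using surj by blast
    obtain A B C E where qe: "q = (of_int A, of_int B, of_int C, of_int E)"
      "even (A - B)" "even (A - C - E)" "4 dvd A + B + 2 * C"
      using lattice1_stabilizer[OF a b cop q] by blast
    note eqs = act_eqD[OF qx[unfolded qe xe]]
    \<comment> \<open>The image has no component on \<open>1\<close> and \<open>r\<close>, so
      \<open>A\<close> and \<open>B\<close> vanish and the stabilizer congruences make both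
      \<open>C\<close> and \<open>E\<close> even. This halving determines the constant in the
      equation.\<close>
    have AB: "A = 0" "B = 0" using eqs(1,2) nz by simp_all
    then have "even C" "even E" using qe(3,4) by presburger+
    then obtain C' E' where CE: "C = 2 * C'" "E = 2 * E'" by (auto elim!: evenE)
    have "rat_of_int (C' * x3 - b * E' * x4) = of_int u"
       "rat_of_int (C' * x4 + a * E' * x3) = of_int v"
      using eqs(3,4) by (simp_all add: CE field_simps)
    then show ?thesis unfolding of_int_eq_iff by blast
  qed
  \<comment> \<open>The vectors \<open>(1, 1)\<close> and \<open>(0, 2)\<close> are a basis of the
    pairs with even sum; their determinant is the 2 of the equation.\<close>
  obtain C E where 1: "C * x3 - b * E * x4 = 1" "C * x4 + a * E * x3 = 1"
    using plane[of 1 1] by auto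
  obtain C' E' where 2: "C' * x3 - b * E' * x4 = 0" "C' * x4 + a * E' * x3 = 2"
    using plane[of 0 2] by auto
  have "(C * E' - C' * E) * (a * x3\<^sup>2 + b * x4\<^sup>2) = 2"
    using plane_determinant[OF 1 2] by simp
  then have "a * x3\<^sup>2 + b * x4\<^sup>2 dvd 2" by (metis dvd_triv_right)
  \<comment> \<open>Both \<open>x3\<close> and \<open>x4\<close> have the parity of
    \<open>x1\<close>, and \<open>a\<close>, \<open>b\<close> are odd: this is the opposite
    divisibility.\<close>
  moreover have "even (a * x3\<^sup>2 + b * x4\<^sup>2)" using ab xc by auto
  ultimately have "\<bar>a * x3\<^sup>2 + b * x4\<^sup>2\<bar> = 2"
    using zdvd_antisym_abs[of _ 2] by simp
  then show "represents_pm a b 2" unfolding represents_pm_def by blast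
next
  have ab: "odd a" "odd b" using a b by presburger+
  obtain a' b' where a': "a = 1 + 4 * a'" and b': "b = 1 + 4 * b'"
    using a b by (metis add.commute mult.commute div_mult_mod_eq)
  assume "represents_pm a b 2"
  then obtain x y where N: "\<bar>a * x\<^sup>2 + b * y\<^sup>2\<bar> = 2" unfolding represents_pm_def by blast
  have xy: "odd x" "odd y" using odd_odd_of_abs_eq_2[OF ab N] by blast+
  then obtain u v where u: "x = 2 * u + 1" and v: "y = 2 * v + 1"
    by (blast elim: oddE)
  \<comment> \<open>The sign is the one that makes the sum of the four numerators divisible by 4.
    Either sign is its own inverse, so the first scalar can be taken as
    \<open>x1 * z1\<close>.\<close>
  define x1 where "x1 = (if even (u + v) then 1 else - 1 :: int)"
  have x1: "x1 * x1 = 1" "odd x1" unfolding x1_def by simp_all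
  have x1_sum: "4 dvd x1 + 1 + x + y" unfolding x1_def u v by presburger
  define \<beta> :: quad where "\<beta> = (of_int x1 / 4, 1 / 4, of_int x / 4, of_int y / 4)"
  have "\<beta> \<in> lattice1"
    using lattice1_iff[of x1 1 x y] x1 x1_sum xy unfolding \<beta>_def by auto
  moreover have "\<exists>q. (\<forall>z\<in>lattice1. act a b q z \<in> lattice1) \<and> act a b q \<beta> = w"
    if w: "w \<in> lattice1" for w
  proof -
    obtain z1 z2 z3 z4 where we: "w = (of_int z1 / 4, of_int z2 / 4, of_int z3 / 4, of_int z4 / 4)"
      and z: "even (z1 - z2)" "even (z1 - z3)" "even (z1 - z4)" "4 dvd z1 + z2 + z3 + z4"
      using w unfolding lattice1_def by auto
    obtain e where e': "e = 1 \<or> e = - 1" and e: "a * x\<^sup>2 + b * y\<^sup>2 = 2 * e"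
      using abs_eq_signE[OF N] .
    have "even (a * x * z3 + b * y * z4)" "even (x * z4 - y * z3)"
      using ab xy z by auto
    \<comment> \<open>Cramer's numerators, with the factor 2 of the determinant \<open>2 e\<close>
      removed. Since \<open>e\<close> is a sign, dividing by it is multiplying by it.\<close>
    then obtain C0 E0 where C0: "a * x * z3 + b * y * z4 = 2 * C0" and E0: "x * z4 - y * z3 = 2 * E0"
      by (elim evenE) blast
    have "(2 * e) * (e * C0) = a * x * z3 + b * y * z4" "(2 * e) * (e * E0) = x * z4 - y * z3"
      "2 * e \<noteq> 0"
      using e' C0 E0 by auto
    note CE = plane_solve[OF e[symmetric] this(3,1,2)]
    obtain p where p: "z2 = z1 + 2 * p" using even_diffE[OF z(1)] .
    obtain g where g: "z3 = z1 + 2 * g" using even_diffE[OF z(2)] .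
    obtain h where h: "z4 = z1 + 2 * h" using even_diffE[OF z(3)] .
    have "even (p + g + h)" using z(4) p g h by presburger
    then obtain w' where "p + g + h = 2 * w'" by (elim evenE)
    then have p': "p = 2 * w' - g - h" by simp
    obtain k where "x1 + 1 + x + y = 4 * k" using x1_sum by (elim dvdE)
    then have k: "x1 = 4 * k - 1 - x - y" by simp
    have sum: "4 dvd x1 * z1 + z2 + 2 * C0"
    proof
      show "x1 * z1 + z2 + 2 * C0 =
          4 * (k * z1 + w' + g * u + h * v + a' * x * z3 + b' * y * z4)"
        unfolding C0[symmetric] k a' b' u v p g h p' by (simp add: algebra_simps)
    qed
    have "2 * (C0 + E0) = a * x * z3 + b * y * z4 + (x * z4 - y * z3)"
      using C0 E0 by simp
    also have "\<dots> = 2 * (z3 * (u - v) + z4 * (1 + u + v) + 2 * (a' * x * z3 + b' * y * z4))"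
      unfolding a' b' u v by (simp add: algebra_simps)
    finally have "C0 + E0 = z3 * (u - v) + z4 * (1 + u + v) + 2 * (a' * x * z3 + b' * y * z4)"
      by simp
    then have "even (C0 + E0 - z1)" using z(2,3) by (simp only:) auto
    then have par: "even (x1 * z1 - e * C0 - e * E0)" using x1(2) e' by auto
    \<comment> \<open>Replacing \<open>C0\<close> by \<open>- C0\<close> changes the sum by
      \<open>4 C0\<close>, so the sign \<open>e\<close> does not affect the condition mod 4.\<close>
    have "4 dvd x1 * z1 + z2 + 2 * (e * C0)"
    proof (cases "e = 1")
      case False
      have "4 dvd (x1 * z1 + z2 + 2 * C0) - 4 * C0" by (rule dvd_diff[OF sum]) simp
      then show ?thesis using False e' by simp
    qed (use sum in simp)
    moreover have "even (x1 * z1 - z2)" using x1(2) z(1) by auto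
    ultimately have "act a b (of_int (x1 * z1), of_int z2, of_int (e * C0), of_int (e * E0)) v \<in> lattice1"
      if "v \<in> lattice1" for v
      using act_lattice1[OF a b _ par _ that] by blast
    moreover have "act a b (of_int (x1 * z1), of_int z2, of_int (e * C0), of_int (e * E0)) \<beta> = w"
    proof -
      have "of_int (x1 * z1) * of_int x1 = rat_of_int z1"
        using x1(1) by (metis mult.assoc mult.commute mult_1 of_int_mult)
      moreover have "rat_of_int (e * C0) * of_int x - of_int b * of_int (e * E0) * of_int y = of_int z3"
        "rat_of_int (e * C0) * of_int y + of_int a * of_int (e * E0) * of_int x = of_int z4"
        unfolding CE[symmetric] by simp_all
      ultimately show ?thesis
        unfolding \<beta>_def we act.simps
        by (simp del: of_int_mult add: diff_divide_distrib[symmetric] add_divide_distrib[symmetric])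
    qed
    ultimately show ?thesis by blast
  qed
  ultimately show "cyclic a b lattice1" unfolding cyclic_def by blast
qed

section \<open>Products mod 4, and the structure given by sqrt(m) in cases 2 and 3\<close>

lemma odd_of_mod4:
  fixes n :: int
  shows "n mod 4 = 1 \<or> n mod 4 = 3 \<Longrightarrow> odd n"
  by presburger

lemma mult_mod4:
  fixes a b :: int
  shows "a mod 4 = 1 \<Longrightarrow> a * b mod 4 = b mod 4" "a mod 4 = 3 \<Longrightarrow> a * b mod 4 = (- b) mod 4"
proof -
  show "a mod 4 = 1 \<Longrightarrow> a * b mod 4 = b mod 4" by (metis mod_mult_left_eq mult_1)
  assume "a mod 4 = 3"
  then have "a mod 4 = (- 1) mod 4" by simp
  then have "a * b mod 4 = - 1 * b mod 4" by (metis mod_mult_left_eq)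
  then show "a * b mod 4 = (- b) mod 4" by simp
qed

lemma mult_mod4_eq_1_iff:
  fixes a b :: int
  shows "a * b mod 4 = 1 \<longleftrightarrow> a mod 4 = 1 \<and> b mod 4 = 1 \<or> a mod 4 = 3 \<and> b mod 4 = 3"
proof -
  have neg: "(- b) mod 4 = 1 \<longleftrightarrow> b mod 4 = 3" by presburger
  have ev: "even a \<Longrightarrow> a * b mod 4 \<noteq> 1" using odd_of_mod4[of "a * b"] by auto
  have "even a \<or> a mod 4 = 1 \<or> a mod 4 = 3" by presburger
  then consider "even a" | "a mod 4 = 1" | "a mod 4 = 3" by blast
  then show ?thesis
  proof cases
    case 1
    moreover have "a mod 4 \<noteq> 1" "a mod 4 \<noteq> 3" using 1 by presburger+
    ultimately show ?thesis using ev by blast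
  qed (simp_all add: mult_mod4 neg)
qed

lemma mult_mod4_eq_1D:
  fixes a b :: int
  assumes "a * b mod 4 = 1"
  shows "odd a \<and> odd b \<and> (a + b) mod 4 = 2"
  using assms unfolding mult_mod4_eq_1_iff by presburger

lemma mult_mod4_eq_3D:
  fixes a b :: int
  assumes "a * b mod 4 = 3"
  shows "odd a \<and> odd b \<and> 4 dvd a + b"
proof -
  have "- a * b mod 4 = 1" using assms by (simp add: zmod_zminus1_eq_if)
  then show ?thesis unfolding mult_mod4_eq_1_iff by presburger
qed

lemma act_lattice2r:
  assumes "odd a" "odd b" "even (A - B)" "z \<in> lattice2r"
  shows "act a b (of_int A, of_int B, of_int C, of_int E) z \<in> lattice2r"
proof -
  obtain z1 z2 z3 z4 where ze: "z = (of_int z1 / 2, of_int z2 / 2, of_int z3 / 2, of_int z4 / 2)"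
    and z: "even (z1 - z2)" "even (z3 - z4)"
    using assms(4) unfolding lattice2r_def by auto
  have "even (A * z1 - B * z2)" "even ((C * z3 - b * E * z4) - (C * z4 + a * E * z3))"
    using assms(1-3) z by auto
  then show ?thesis
    unfolding ze using lattice2r_iff[of "A * z1" "B * z2" "C * z3 - b * E * z4" "C * z4 + a * E * z3"]
    by (simp add: diff_divide_distrib add_divide_distrib)
qed

text \<open>The hypotheses are coordinates of the images of \<open>(0, 0, 1, 0)\<close> and
  \<open>(0, 0, 1/2, 1/2)\<close>. They make \<open>2 a E\<close> and \<open>2 b E\<close> integral,
  so the denominator of \<open>E\<close> is at most 2. Whether a half really occurs depends on
  \<open>a + b\<close> mod 4 and is decided separately in cases 2 and 3.\<close>

lemma half_lattice_stabilizer: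
  fixes C E :: rat
  assumes "coprime a b"
    and "C * 2 = of_int c" "of_int a * E * 2 = of_int e"
    and "C - of_int b * E = of_int f"
  obtains E' where "2 * E = of_int E'" "e = a * E'" "2 * f = c - b * E'"
proof -
  have "of_int b * (2 * E) = rat_of_int (c - 2 * f)"
    using assms(2,4) by (simp add: algebra_simps)
  then have "of_int b * (2 * E) \<in> \<int>" by (metis Ints_of_int)
  moreover have "of_int a * (2 * E) \<in> \<int>" using assms(3) by (simp add: algebra_simps)
  ultimately have "2 * E \<in> \<int>" using coprime_Ints[OF assms(1)] by blast
  then obtain E' where E': "2 * E = of_int E'" by (elim Ints_cases)
  have "rat_of_int e = of_int (a * E')" "rat_of_int (2 * f) = of_int (c - b * E')"
    using assms(2-4) E'[symmetric] by (simp_all add: algebra_simps)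
  then show ?thesis using that[OF E'] unfolding of_int_eq_iff by blast
qed

text \<open>This lattice does split: its conditions on the coordinates of \<open>1, r\<close> and of
  \<open>s, t\<close> are independent. The plane can therefore be treated without \<open>A\<close>
  and \<open>B\<close>, and no halving of \<open>C\<close> and \<open>E\<close> takes place.\<close>

lemma cyclic_lattice2r:
  assumes ab: "a * b mod 4 = 1" and cop: "coprime a b"
  shows "cyclic a b lattice2r \<longleftrightarrow> represents_pm a b 2"
proof
  have odd: "odd a" "odd b" and ab4: "(a + b) mod 4 = 2"
    using mult_mod4_eq_1D[OF ab] by blast+
  assume "cyclic a b lattice2r"
  then obtain x where x: "x \<in> lattice2r" and
    surj: "\<And>y. y \<in> lattice2r \<Longrightarrow> \<exists>q. (\<forall>z\<in>lattice2r. act a b q z \<in> lattice2r) \<and> act a b q x = y"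
    unfolding cyclic_def by blast
  obtain x1 x2 x3 x4 where xe: "x = (of_int x1 / 2, of_int x2 / 2, of_int x3 / 2, of_int x4 / 2)"
    and xc: "even (x1 - x2)" "even (x3 - x4)"
    using x unfolding lattice2r_def by auto
  have plane: "\<exists>C E. C * x3 - b * E * x4 = u \<and> C * x4 + a * E * x3 = v"
    if uv: "even (u + v)" for u v
  proof -
    have "(0, 0, of_int u / 2, of_int v / 2) \<in> lattice2r"
      using lattice2r_iff[of 0 0 u v] uv by simp
    then obtain q where q: "\<And>z. z \<in> lattice2r \<Longrightarrow> act a b q z \<in> lattice2r"
        and qx: "act a b q x = (0, 0, of_int u / 2, of_int v / 2)"
      using surj by blast
    obtain A B C E where qe: "q = (A, B, C, E)" by (cases q)
    have "(0, 0, 1, 0) \<in> lattice2r" "(0, 0, 1/2, 1/2) \<in> lattice2r"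
      using lattice2r_iff[of 0 0 2 0] lattice2r_iff[of 0 0 1 1] by auto
    note mem = this[THEN q]
    obtain c e where c: "C * 2 = of_int c" "of_int a * E * 2 = of_int e" "even (c - e)"
      using mem(1) unfolding qe lattice2r_def by auto
    obtain f g where fg: "C / 2 - of_int b * E / 2 = of_int f / 2"
        "C / 2 + of_int a * E / 2 = of_int g / 2" "even (f - g)"
      using mem(2) unfolding qe lattice2r_def by auto
    then have f: "C - of_int b * E = of_int f" "C + of_int a * E = of_int g" by linarith+
    obtain E' where E': "2 * E = of_int E'" "e = a * E'" "2 * f = c - b * E'"
      using half_lattice_stabilizer[OF cop c(1,2) f(1)] .
    have "rat_of_int (2 * (g - f)) = of_int ((a + b) * E')"
      using f(1,2) E'(1)[symmetric] by (simp add: algebra_simps)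
    then have "(a + b) * E' = 2 * (g - f)" unfolding of_int_eq_iff by simp
    \<comment> \<open>Here \<open>a + b\<close> is 2 mod 4, an odd multiple of 2. Cancelling the 2
      leaves an odd factor of \<open>E'\<close> and an even right side, which excludes half-integral
      \<open>E\<close>.\<close>
    moreover obtain k where k: "a + b = 2 * (1 + 2 * k)"
    proof -
      have "a + b = 2 * (1 + 2 * ((a + b) div 4))" using ab4 by presburger
      then show ?thesis using that by blast
    qed
    ultimately have "2 * ((1 + 2 * k) * E') = 2 * (g - f)" by (simp only: mult.assoc)
    then have "(1 + 2 * k) * E' = g - f" by (metis mult_cancel_left zero_neq_numeral)
    then have "even ((1 + 2 * k) * E')" using fg(3) by (metis even_diff_iff dvd_diff_commute)
    then have "even E'" by simp
    moreover from this have "even c" using E'(2) c(3) by simp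
    ultimately obtain C1 E1 where "E' = 2 * E1" "c = 2 * C1" by (auto elim!: evenE)
    then have CE: "C = of_int C1" "E = of_int E1" using c(1) E'(1) by simp_all
    note eqs = act_eqD(3,4)[OF qx[unfolded qe xe CE]]
    have "rat_of_int (C1 * x3 - b * E1 * x4) = of_int u"
       "rat_of_int (C1 * x4 + a * E1 * x3) = of_int v"
      using eqs by (simp_all add: field_simps)
    then show ?thesis unfolding of_int_eq_iff by blast
  qed
  obtain C E where 1: "C * x3 - b * E * x4 = 1" "C * x4 + a * E * x3 = 1"
    using plane[of 1 1] by auto
  obtain C' E' where 2: "C' * x3 - b * E' * x4 = 0" "C' * x4 + a * E' * x3 = 2"
    using plane[of 0 2] by auto
  have "(C * E' - C' * E) * (a * x3\<^sup>2 + b * x4\<^sup>2) = 2"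
    using plane_determinant[OF 1 2] by simp
  then have "a * x3\<^sup>2 + b * x4\<^sup>2 dvd 2" by (metis dvd_triv_right)
  moreover have "even (a * x3\<^sup>2 + b * x4\<^sup>2)" using odd xc by auto
  ultimately have "\<bar>a * x3\<^sup>2 + b * x4\<^sup>2\<bar> = 2" using zdvd_antisym_abs[of _ 2] by simp
  then show "represents_pm a b 2" unfolding represents_pm_def by blast
next
  have odd: "odd a" "odd b" using mult_mod4_eq_1D[OF ab] by blast+
  assume "represents_pm a b 2"
  then obtain x y where N: "\<bar>a * x\<^sup>2 + b * y\<^sup>2\<bar> = 2" unfolding represents_pm_def by blast
  then obtain xy: "odd x" "odd y" using odd_odd_of_abs_eq_2[OF odd] by blast
  have "(1 / 2, 1 / 2, of_int x / 2, of_int y / 2) \<in> lattice2r"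
    using lattice2r_iff[of 1 1 x y] xy by simp
  moreover have "\<exists>q. (\<forall>z\<in>lattice2r. act a b q z \<in> lattice2r) \<and>
      act a b q (1 / 2, 1 / 2, of_int x / 2, of_int y / 2) = w"
    if w: "w \<in> lattice2r" for w
  proof -
    obtain z1 z2 z3 z4 where we: "w = (of_int z1 / 2, of_int z2 / 2, of_int z3 / 2, of_int z4 / 2)"
      and z: "even (z1 - z2)" "even (z3 - z4)"
      using w unfolding lattice2r_def by auto
    obtain e where e': "e = 1 \<or> e = - 1" and e: "a * x\<^sup>2 + b * y\<^sup>2 = 2 * e"
      using abs_eq_signE[OF N] .
    have "even (a * x * z3 + b * y * z4)" "even (x * z4 - y * z3)"
      using odd xy z by auto
    then obtain C0 E0 where C0: "a * x * z3 + b * y * z4 = 2 * C0" and E0: "x * z4 - y * z3 = 2 * E0"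
      by (elim evenE) blast
    have "(2 * e) * (e * C0) = a * x * z3 + b * y * z4" "(2 * e) * (e * E0) = x * z4 - y * z3"
      "2 * e \<noteq> 0"
      using e' C0 E0 by auto
    note CE = plane_solve[OF e[symmetric] this(3,1,2)]
    have "rat_of_int (e * C0) * of_int x - of_int b * of_int (e * E0) * of_int y = of_int z3"
      "rat_of_int (e * C0) * of_int y + of_int a * of_int (e * E0) * of_int x = of_int z4"
      unfolding CE[symmetric] by simp_all
    then have "act a b (of_int z1, of_int z2, of_int (e * C0), of_int (e * E0))
        (1 / 2, 1 / 2, of_int x / 2, of_int y / 2) = w"
      unfolding we act.simps
      by (simp del: of_int_mult add: diff_divide_distrib[symmetric] add_divide_distrib[symmetric])
    with act_lattice2r[OF odd z(1)] show ?thesis by blast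
  qed
  ultimately show "cyclic a b lattice2r" unfolding cyclic_def by blast
qed

text \<open>The coefficients describe the order generated by \<open>(1 + J) / 2\<close>, which is
  integral because \<open>J^2 = - a b\<close> is 1 mod 4. That it preserves the plane part rests on
  \<open>4 dvd a + b\<close>.\<close>

lemma act_lattice3r:
  assumes ab: "a * b mod 4 = 3" and CE: "even (C - E)" and z: "z \<in> lattice3r"
  shows "act a b (of_int A, of_int B, of_int C / 2, of_int E / 2) z \<in> lattice3r"
proof -
  have odd: "odd a" "odd b" using mult_mod4_eq_3D[OF ab] by blast+
  have ab4: "4 dvd a + b" using mult_mod4_eq_3D[OF ab] by blast
  obtain z1 z2 z3 z4 where ze: "z = (of_int z1, of_int z2, of_int z3 / 2, of_int z4 / 2)"
    and z34: "even (z3 - z4)"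
    using z unfolding lattice3r_def by auto
  have "even (C * z3 - b * E * z4)" "even (C * z4 + a * E * z3)" using odd CE z34 by auto
  then obtain f g where f: "C * z3 - b * E * z4 = 2 * f" and g: "C * z4 + a * E * z3 = 2 * g"
    by (elim evenE) blast
  obtain j where "a + b = 4 * j" using ab4 by (elim dvdE)
  then have j: "a = 4 * j - b" by simp
  obtain h where h: "E = C + 2 * h" using even_diffE[OF CE] .
  obtain l where l: "z4 = z3 + 2 * l" using even_diffE[OF z34] .
  obtain b' where b': "b = 2 * b' + 1" using odd(2) by (elim oddE)
  have "2 * (f - g) = (C * z3 - b * E * z4) - (C * z4 + a * E * z3)" using f g by simp
  also have "\<dots> = 4 * (- j * E * z3 - C * l * (b' + 1) - b * h * l)"
    unfolding j h l by (simp add: algebra_simps b')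
  finally have "f - g = 2 * (- j * E * z3 - C * l * (b' + 1) - b * h * l)" by simp
  then have "even (f - g)" by (metis dvd_triv_left)
  moreover have "rat_of_int C * of_int z3 - of_int b * of_int E * of_int z4 = 2 * of_int f"
    "rat_of_int C * of_int z4 + of_int a * of_int E * of_int z3 = 2 * of_int g"
    using f g by (metis of_int_diff of_int_add of_int_mult of_int_numeral)+
  ultimately show ?thesis
    unfolding ze using lattice3r_iff[of "A * z1" "B * z2" f g]
    by (simp add: diff_divide_distrib[symmetric] add_divide_distrib[symmetric])
qed

text \<open>The half-integral coefficients are what separates this from case 2: the plane lattice is
  the same, but the order acting on it is larger by index 2, so the determinant of a generator must
  be twice as large.\<close>

lemma cyclic_lattice3r:
  assumes ab: "a * b mod 4 = 3" and cop: "coprime a b"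
  shows "cyclic a b lattice3r \<longleftrightarrow> represents_pm a b 4"
proof
  have odd: "odd a" "odd b" using mult_mod4_eq_3D[OF ab] by blast+
  have ab4: "4 dvd a + b" using mult_mod4_eq_3D[OF ab] by blast
  assume "cyclic a b lattice3r"
  then obtain x where x: "x \<in> lattice3r" and
    surj: "\<And>y. y \<in> lattice3r \<Longrightarrow> \<exists>q. (\<forall>z\<in>lattice3r. act a b q z \<in> lattice3r) \<and> act a b q x = y"
    unfolding cyclic_def by blast
  obtain x1 x2 x3 x4 where xe: "x = (of_int x1, of_int x2, of_int x3 / 2, of_int x4 / 2)"
    and xc: "even (x3 - x4)"
    using x unfolding lattice3r_def by auto
  have plane: "\<exists>C E. C * x3 - b * E * x4 = 2 * u \<and> C * x4 + a * E * x3 = 2 * v \<and> even (C - E)"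
    if uv: "even (u - v)" for u v
  proof -
    have "(0, 0, of_int u / 2, of_int v / 2) \<in> lattice3r"
      using lattice3r_iff[of 0 0 u v] uv by simp
    then obtain q where q: "\<And>z. z \<in> lattice3r \<Longrightarrow> act a b q z \<in> lattice3r"
        and qx: "act a b q x = (0, 0, of_int u / 2, of_int v / 2)"
      using surj by blast
    obtain A B C E where qe: "q = (A, B, C, E)" by (cases q)
    have "(0, 0, 1, 0) \<in> lattice3r" "(0, 0, 1/2, 1/2) \<in> lattice3r"
      using lattice3r_iff[of 0 0 2 0] lattice3r_iff[of 0 0 1 1] by auto
    note mem = this[THEN q]
    obtain c e where c: "C * 2 = of_int c" "of_int a * E * 2 = of_int e" "even (c - e)"
      using mem(1) unfolding qe lattice3r_def by auto
    obtain f where "C / 2 - of_int b * E / 2 = of_int f / 2"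
      using mem(2) unfolding qe lattice3r_def by auto
    then have f: "C - of_int b * E = of_int f" by linarith
    obtain E' where E': "2 * E = of_int E'" "e = a * E'"
      using half_lattice_stabilizer[OF cop c(1,2) f] .
    then have CE: "C = of_int c / 2" "E = of_int E' / 2" using c(1) by simp_all
    note eqs = act_eqD(3,4)[OF qx[unfolded qe xe CE]]
    have "rat_of_int (c * x3 - b * E' * x4) = of_int (2 * u)"
       "rat_of_int (c * x4 + a * E' * x3) = of_int (2 * v)"
      using eqs by (simp_all add: field_simps)
    moreover have "even (c - E')" using c(3) E'(2) odd by simp
    ultimately show ?thesis unfolding of_int_eq_iff by blast
  qed
  obtain C E where 1: "C * x3 - b * E * x4 = 2" "C * x4 + a * E * x3 = 2" and p1: "even (C - E)"
    using plane[of 1 1] by auto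
  obtain C' E' where 2: "C' * x3 - b * E' * x4 = 0" "C' * x4 + a * E' * x3 = 4" and p2: "even (C' - E')"
    using plane[of 0 2] by auto
  \<comment> \<open>The right sides have determinant 8. Since \<open>C \<equiv> E\<close> and
    \<open>C' \<equiv> E'\<close> mod 2, the coefficient determinant takes up one factor 2 and
    leaves 4.\<close>
  have "even (C * E' - C' * E)" using p1 p2 by auto
  then obtain D where "C * E' - C' * E = 2 * D" by (elim evenE)
  then have "D * (a * x3\<^sup>2 + b * x4\<^sup>2) = 4"
    using plane_determinant[OF 1 2] by simp
  then have "a * x3\<^sup>2 + b * x4\<^sup>2 dvd 4" by (metis dvd_triv_right)
  moreover have "4 dvd a * x3\<^sup>2 + b * x4\<^sup>2"
  proof -
    obtain k where k: "x4 = x3 + 2 * k" using even_diffE[OF xc] .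
    have "a * x3\<^sup>2 + b * x4\<^sup>2 = (a + b) * x3\<^sup>2 + 4 * (b * (k * x3 + k\<^sup>2))"
      unfolding k by (simp add: algebra_simps power2_eq_square)
    then show ?thesis using ab4 by simp
  qed
  ultimately have "\<bar>a * x3\<^sup>2 + b * x4\<^sup>2\<bar> = 4" using zdvd_antisym_abs[of _ 4] by simp
  then show "represents_pm a b 4" unfolding represents_pm_def by blast
next
  have odd: "odd a" "odd b" using mult_mod4_eq_3D[OF ab] by blast+
  have ab4: "4 dvd a + b" using mult_mod4_eq_3D[OF ab] by blast
  obtain j where "a + b = 4 * j" using ab4 by (elim dvdE)
  then have j: "a = 4 * j - b" by simp
  assume "represents_pm a b 4"
  then obtain x y where N: "\<bar>a * x\<^sup>2 + b * y\<^sup>2\<bar> = 4" unfolding represents_pm_def by blast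
  have "even (a * x\<^sup>2 + b * y\<^sup>2)" by (metis N dvd_abs_iff even_numeral)
  then have xy: "even (x - y)" using odd by auto
  have "(1, 1, of_int x / 2, of_int y / 2) \<in> lattice3r"
    using lattice3r_iff[of 1 1 x y] xy by simp
  moreover have "\<exists>q. (\<forall>z\<in>lattice3r. act a b q z \<in> lattice3r) \<and>
      act a b q (1, 1, of_int x / 2, of_int y / 2) = w"
    if w: "w \<in> lattice3r" for w
  proof -
    obtain z1 z2 z3 z4 where we: "w = (of_int z1, of_int z2, of_int z3 / 2, of_int z4 / 2)"
      and z: "even (z3 - z4)"
      using w unfolding lattice3r_def by auto
    obtain e where e': "e = 1 \<or> e = - 1" and e: "a * x\<^sup>2 + b * y\<^sup>2 = 4 * e"
      using abs_eq_signE[OF N] .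
    have "even (a * x * z3 + b * y * z4)" "even (x * z4 - y * z3)"
      using odd xy z by auto
    then obtain C0 E0 where C0: "a * x * z3 + b * y * z4 = 2 * C0" and E0: "x * z4 - y * z3 = 2 * E0"
      by (elim evenE) blast
    obtain k where k: "y = x + 2 * k" using even_diffE[OF xy] .
    obtain l where l: "z4 = z3 + 2 * l" using even_diffE[OF z] .
    obtain b' where b': "b = 2 * b' + 1" using odd(2) by (elim oddE)
    \<comment> \<open>The coefficients will be \<open>C0 / 2\<close> and \<open>E0 / 2\<close> up to
      sign, so \<open>C0\<close> and \<open>E0\<close> must have the same parity; this is where
      \<open>4 dvd a + b\<close> enters.\<close>
    have "2 * (C0 - E0) = (a * x * z3 + b * y * z4) - (x * z4 - y * z3)" using C0 E0 by simp
    also have "\<dots> = 4 * (j * x * z3 + k * z3 * (b' + 1) + l * x * b' + b * k * l)"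
      unfolding j k l by (simp add: algebra_simps b')
    finally have "C0 - E0 = 2 * (j * x * z3 + k * z3 * (b' + 1) + l * x * b' + b * k * l)" by simp
    then have par: "even (e * C0 - e * E0)" by (metis dvd_mult dvd_triv_left right_diff_distrib)
    \<comment> \<open>The target is doubled because the operator uses half of \<open>e * C0\<close>
      and half of \<open>e * E0\<close>.\<close>
    have "(4 * e) * (e * C0) = a * x * (2 * z3) + b * y * (2 * z4)"
      "(4 * e) * (e * E0) = x * (2 * z4) - y * (2 * z3)" "4 * e \<noteq> 0"
      using e' C0 E0 by auto
    note CE = plane_solve[OF e[symmetric] this(3,1,2)]
    have "rat_of_int (e * C0) * of_int x - of_int b * of_int (e * E0) * of_int y = of_int (2 * z3)"
      "rat_of_int (e * C0) * of_int y + of_int a * of_int (e * E0) * of_int x = of_int (2 * z4)"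
      unfolding CE[symmetric] by simp_all
    then have "act a b (of_int z1, of_int z2, of_int (e * C0) / 2, of_int (e * E0) / 2)
        (1, 1, of_int x / 2, of_int y / 2) = w"
      unfolding we act.simps
      by (simp del: of_int_mult add: diff_divide_distrib[symmetric] add_divide_distrib[symmetric])
    with act_lattice3r[OF ab par] show ?thesis by blast
  qed
  ultimately show "cyclic a b lattice3r" unfolding cyclic_def by blast
qed

section \<open>Case 3: the structures given by the other two square roots\<close>

lemma act_lattice3s:
  assumes "even b" "even (B - C)" "z \<in> lattice3s"
  shows "act a b (of_int A, of_int B, of_int C, of_int E) z \<in> lattice3s"
proof -
  obtain b' where b': "b = 2 * b'" using assms(1) by (elim evenE)
  obtain z1 z2 z3 z4 where ze: "z = (of_int z1, of_int z2 / 2, of_int z3, of_int z4 / 2)"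
    and z: "even (z2 - z4)"
    using assms(3) unfolding lattice3s_def by auto
  have "even (B * z2 - (C * z4 + 2 * a * E * z3))" using assms(2) z by auto
  then show ?thesis
    unfolding ze using lattice3s_iff[of "A * z1" "B * z2" "C * z3 - b' * E * z4" "C * z4 + 2 * a * E * z3"]
    by (simp add: b' diff_divide_distrib add_divide_distrib mult_ac)
qed

text \<open>The image of \<open>(0, 1/2, 0, 1/2)\<close> has third coordinate
  \<open>- b E / 2\<close>, required to be an integer. It is thus \<open>b'\<close>, half of
  \<open>b\<close>, that is paired with \<open>a\<close> in the coprimality argument for
  \<open>E\<close>.\<close>

lemma lattice3s_stabilizer:
  assumes b: "b = 2 * b'" and cop: "coprime a b'"
    and q: "\<And>z. z \<in> lattice3s \<Longrightarrow> act a b q z \<in> lattice3s"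
  obtains A B C E where "q = (A, of_int B, of_int C, of_int E)" "even (B - C)"
proof -
  obtain A B C E where qe: "q = (A, B, C, E)" by (cases q)
  have "(0, 0, 1, 0) \<in> lattice3s" "(0, 1/2, 0, 1/2) \<in> lattice3s"
    using lattice3s_iff[of 0 0 1 0] lattice3s_iff[of 0 1 0 1] by auto
  note mem = this[THEN q]
  obtain c e where c: "C = of_int c" "of_int a * E = of_int e / 2" "even e"
    using mem(1) unfolding qe lattice3s_def by auto
  then have "of_int a * E = of_int (e div 2)" by (auto elim!: evenE)
  moreover obtain f g h where f: "B / 2 = of_int f / 2" "C / 2 = of_int g / 2" "even (f - g)"
    "- (of_int b * E / 2) = of_int h"
    using mem(2) unfolding qe lattice3s_def by auto
  then have "of_int b' * E = of_int (- h)" unfolding b by simp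
  ultimately have "E \<in> \<int>" using coprime_Ints[OF cop, of E] by (metis Ints_of_int)
  then obtain E' where "E = of_int E'" by (elim Ints_cases)
  moreover have "B = of_int f" "C = of_int g" using f by simp_all
  ultimately show ?thesis using that[of A f g E'] f(3) qe by simp
qed

lemma cyclic_lattice3s:
  assumes a: "odd a" and b: "b mod 4 = 2" and cop: "coprime a b"
  shows "cyclic a b lattice3s \<longleftrightarrow> represents_pm a b 2"
proof
  have b': "b = 2 * (b div 2)" using b by presburger
  have cop': "coprime a (b div 2)" using cop b' by (metis coprime_mult_right_iff)
  assume "cyclic a b lattice3s"
  then obtain x where x: "x \<in> lattice3s" and
    surj: "\<And>y. y \<in> lattice3s \<Longrightarrow> \<exists>q. (\<forall>z\<in>lattice3s. act a b q z \<in> lattice3s) \<and> act a b q x = y"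
    unfolding cyclic_def by blast
  obtain x1 x2 x3 x4 where xe: "x = (of_int x1, of_int x2 / 2, of_int x3, of_int x4 / 2)"
    using x unfolding lattice3s_def by auto
  have "(0, 1, 0, 0) \<in> lattice3s" using lattice3s_iff[of 0 2 0 0] by auto
  with surj obtain q where q: "act a b q x = (0, 1, 0, 0)" by metis
  have nz: "x2 \<noteq> 0"
    using act_eq_nonzero(2)[OF q[unfolded xe]] by auto
  have plane: "\<exists>C E. C * (2 * x3) - b * E * x4 = 2 * u \<and> C * x4 + a * E * (2 * x3) = 2 * v \<and> even C"
    for u v
  proof -
    have "(0, 0, of_int u, of_int v) \<in> lattice3s"
      using lattice3s_iff[of 0 0 u "2 * v"] by simp
    then obtain q where q: "\<And>z. z \<in> lattice3s \<Longrightarrow> act a b q z \<in> lattice3s"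
        and qx: "act a b q x = (0, 0, of_int u, of_int v)"
      using surj by blast
    obtain A B C E where qe: "q = (A, of_int B, of_int C, of_int E)" "even (B - C)"
      using lattice3s_stabilizer[OF b' cop' q] by blast
    note eqs = act_eqD[OF qx[unfolded qe(1) xe]]
    have "B = 0" using eqs(2) nz by simp
    then have "even C" using qe(2) by simp
    moreover have "rat_of_int (C * (2 * x3) - b * E * x4) = of_int (2 * u)"
       "rat_of_int (C * x4 + a * E * (2 * x3)) = of_int (2 * v)"
      using eqs(3,4) by (simp_all add: field_simps)
    ultimately show ?thesis unfolding of_int_eq_iff by blast
  qed
  \<comment> \<open>Every integral pair \<open>(u, v)\<close> is available, so unit vectors serve;
    doubled, they have determinant 4. The congruence \<open>B \<equiv> C\<close> with
    \<open>B = 0\<close> makes \<open>C\<close> and \<open>C'\<close> even and removes a factor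
    2.\<close>
  obtain C E where 1: "C * (2 * x3) - b * E * x4 = 2" "C * x4 + a * E * (2 * x3) = 0" and p1: "even C"
    using plane[of 1 0] by auto
  obtain C' E' where 2: "C' * (2 * x3) - b * E' * x4 = 0" "C' * x4 + a * E' * (2 * x3) = 2" and p2: "even C'"
    using plane[of 0 1] by auto
  have "even (C * E' - C' * E)" using p1 p2 by auto
  then obtain D where "C * E' - C' * E = 2 * D" by (elim evenE)
  then have "D * (a * (2 * x3)\<^sup>2 + b * x4\<^sup>2) = 2"
    using plane_determinant[OF 1 2] by simp
  then have "a * (2 * x3)\<^sup>2 + b * x4\<^sup>2 dvd 2" by (metis dvd_triv_right)
  moreover have "even (a * (2 * x3)\<^sup>2 + b * x4\<^sup>2)" by (subst b') simp
  ultimately have "\<bar>a * (2 * x3)\<^sup>2 + b * x4\<^sup>2\<bar> = 2" using zdvd_antisym_abs[of _ 2] by simp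
  then show "represents_pm a b 2" unfolding represents_pm_def by blast
next
  define b' where "b' = b div 2"
  have b': "b = 2 * b'" "odd b'" using b unfolding b'_def by presburger+
  assume "represents_pm a b 2"
  then obtain x' y where N: "\<bar>a * x'\<^sup>2 + b * y\<^sup>2\<bar> = 2" unfolding represents_pm_def by blast
  have "even (a * x'\<^sup>2 + b * y\<^sup>2)" by (metis N dvd_abs_iff dvd_refl)
  \<comment> \<open>The third coordinate of the generator is \<open>x' / 2\<close>, and it must be
    an integer.\<close>
  then have "even x'" using a b' by simp
  then obtain x where x': "x' = 2 * x" by (elim evenE)
  have y: "odd y"
  proof
    assume "even y"
    then obtain y' where "y = 2 * y'" by (elim evenE)
    then have "a * x'\<^sup>2 + b * y\<^sup>2 = 4 * (a * x\<^sup>2 + b * y'\<^sup>2)"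
      using x' by (simp add: power_mult_distrib)
    then have "4 dvd (2::int)" by (metis N dvd_abs_iff dvd_triv_left)
    then show False by simp
  qed
  have "(1, 1 / 2, of_int x, of_int y / 2) \<in> lattice3s"
    using lattice3s_iff[of 1 1 x y] y by simp
  moreover have "\<exists>q. (\<forall>z\<in>lattice3s. act a b q z \<in> lattice3s) \<and>
      act a b q (1, 1 / 2, of_int x, of_int y / 2) = w"
    if w: "w \<in> lattice3s" for w
  proof -
    obtain z1 z2 z3 z4 where we: "w = (of_int z1, of_int z2 / 2, of_int z3, of_int z4 / 2)"
      and z: "even (z2 - z4)"
      using w unfolding lattice3s_def by auto
    obtain e where e': "e = 1 \<or> e = - 1" and e: "a * x'\<^sup>2 + b * y\<^sup>2 = 2 * e"
      using abs_eq_signE[OF N] .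
    \<comment> \<open>Half of Cramer's numerator, using \<open>x' = 2 x\<close> and
      \<open>b = 2 b'\<close>. As \<open>b'\<close> and \<open>y\<close> are odd, \<open>C0\<close>
      has the parity of \<open>z4\<close>, hence of \<open>z2\<close>, as the stabilizer
      demands.\<close>
    define C0 where "C0 = 2 * (a * x * z3) + b' * y * z4"
    define E0 where "E0 = x * z4 - y * z3"
    have "even (C0 - z4)" unfolding C0_def using b' y by auto
    then have par: "even (z2 - e * C0)" using z e' by auto
    have "(2 * e) * (e * C0) = a * x' * (2 * z3) + b * y * z4"
      "(2 * e) * (e * E0) = x' * z4 - y * (2 * z3)" "2 * e \<noteq> 0"
      using e' b'(1) x' by (auto simp: C0_def E0_def algebra_simps)
    note CE = plane_solve[OF e[symmetric] this(3,1,2)]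
    have "rat_of_int (e * C0) * of_int x' - of_int b * of_int (e * E0) * of_int y = of_int (2 * z3)"
      "rat_of_int (e * C0) * of_int y + of_int a * of_int (e * E0) * of_int x' = of_int z4"
      unfolding CE[symmetric] by simp_all
    then have "act a b (of_int z1, of_int z2, of_int (e * C0), of_int (e * E0))
        (1, 1 / 2, of_int x, of_int y / 2) = w"
      unfolding we act.simps x' by (auto simp: field_simps)
    moreover have "even b" using b'(1) by simp
    ultimately show ?thesis using act_lattice3s[OF _ par] by blast
  qed
  ultimately show "cyclic a b lattice3s" unfolding cyclic_def by blast
qed

subsection \<open>Sums and products of algebraic integers\<close>

text \<open>A span without any independence of the generators: the eigenvalue argument below needs a
  matrix for multiplication, not a unique one.\<close>

definition int_span :: "complex set \<Rightarrow> complex set" where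
  "int_span B = {(\<Sum>b\<in>B. of_int (c b) * b) | c. True}"

lemma int_span_zero: "0 \<in> int_span B"
  unfolding int_span_def by (intro CollectI exI[of _ "\<lambda>_. 0"]) simp

lemma int_span_add:
  assumes "u \<in> int_span B" "v \<in> int_span B"
  shows "u + v \<in> int_span B"
proof -
  obtain c d where "u = (\<Sum>b\<in>B. of_int (c b) * b)" "v = (\<Sum>b\<in>B. of_int (d b) * b)"
    using assms unfolding int_span_def by blast
  then have "u + v = (\<Sum>b\<in>B. of_int (c b + d b) * b)"
    by (simp add: sum.distrib distrib_right)
  then show ?thesis
    unfolding int_span_def by (intro CollectI exI[of _ "\<lambda>b. c b + d b"] conjI) simp_all
qed

lemma int_span_scale:
  assumes "u \<in> int_span B"
  shows "of_int k * u \<in> int_span B"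
proof -
  obtain c where "u = (\<Sum>b\<in>B. of_int (c b) * b)"
    using assms unfolding int_span_def by blast
  then have "of_int k * u = (\<Sum>b\<in>B. of_int (k * c b) * b)"
    by (simp add: sum_distrib_left mult.assoc)
  then show ?thesis
    unfolding int_span_def by (intro CollectI exI[of _ "\<lambda>b. k * c b"] conjI) simp_all
qed

lemma int_span_sum: "(\<And>i. i \<in> I \<Longrightarrow> f i \<in> int_span B) \<Longrightarrow> sum f I \<in> int_span B"
  by (induction I rule: infinite_finite_induct) (auto simp: int_span_zero int_span_add)

lemma int_span_base:
  assumes "finite B" "b \<in> B"
  shows "b \<in> int_span B"
proof -
  have "(\<Sum>b'\<in>B. of_int (if b' = b then 1 else 0) * b') = (\<Sum>b'\<in>B. if b' = b then b' else 0)"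
    by (intro sum.cong) auto
  also have "\<dots> = b" using assms by simp
  finally show ?thesis
    unfolding int_span_def by (intro CollectI exI[of _ "\<lambda>b'. if b' = b then 1 else 0"] conjI) simp_all
qed

lemma int_span_mult:
  assumes "\<And>b. b \<in> B \<Longrightarrow> x * b \<in> int_span B" "u \<in> int_span B"
  shows "x * u \<in> int_span B"
proof -
  obtain c where "u = (\<Sum>b\<in>B. of_int (c b) * b)"
    using assms(2) unfolding int_span_def by blast
  then have "x * u = (\<Sum>b\<in>B. of_int (c b) * (x * b))"
    by (simp add: sum_distrib_left mult_ac)
  also have "\<dots> \<in> int_span B" by (intro int_span_sum int_span_scale assms(1))
  finally show ?thesis .
qed

text \<open>The matrix of multiplication by \<open>x\<close> on the generators has \<open>x\<close> as an eigenvalue.\<close>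

lemma algebraic_int_if_int_span_stable:
  assumes B: "finite B" "\<exists>b\<in>B. b \<noteq> 0" and stable: "\<And>b. b \<in> B \<Longrightarrow> x * b \<in> int_span B"
  shows "algebraic_int x"
proof -
  define n where "n = card B"
  obtain f where f: "bij_betw f {0..<n} B"
    using ex_bij_betw_nat_finite[OF B(1)] unfolding n_def by blast
  have "\<exists>c. x * b = (\<Sum>b'\<in>B. of_int (c b') * b')" if "b \<in> B" for b
    using stable[OF that] unfolding int_span_def by blast
  then obtain c where c: "\<And>b. b \<in> B \<Longrightarrow> x * b = (\<Sum>b'\<in>B. of_int (c b b') * b')" by metis
  define M where "M = mat n n (\<lambda>(i, j). c (f i) (f j))"
  define Mc where "Mc = map_mat (of_int :: int \<Rightarrow> complex) M"
  define v where "v = vec n f"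
  have M: "M \<in> carrier_mat n n" unfolding M_def by simp
  then have Mc: "Mc \<in> carrier_mat n n" unfolding Mc_def by simp
  obtain i where i: "i < n" "f i \<noteq> 0"
    using B(2) f by (metis atLeastLessThan_iff bij_betw_iff_bijections)
  have "v \<noteq> 0\<^sub>v n"
  proof
    assume "v = 0\<^sub>v n"
    then have "v $ i = 0" using i by simp
    then show False using i unfolding v_def by simp
  qed
  moreover have "Mc *\<^sub>v v = x \<cdot>\<^sub>v v"
  proof (rule eq_vecI)
    fix i assume "i < dim_vec (x \<cdot>\<^sub>v v)"
    then have i: "i < n" unfolding v_def by simp
    then have "f i \<in> B" using f by (auto simp: bij_betw_def)
    have "(Mc *\<^sub>v v) $ i = (\<Sum>j = 0..<n. of_int (c (f i) (f j)) * f j)"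
      using i unfolding Mc_def M_def v_def by (simp add: scalar_prod_def)
    also have "\<dots> = (\<Sum>b'\<in>B. of_int (c (f i) b') * b')"
      by (rule sum.reindex_bij_betw[OF f])
    also have "\<dots> = (x \<cdot>\<^sub>v v) $ i" using c[OF \<open>f i \<in> B\<close>] i unfolding v_def by simp
    finally show "(Mc *\<^sub>v v) $ i = (x \<cdot>\<^sub>v v) $ i" .
  qed (use Mc in \<open>simp add: v_def\<close>)
  ultimately have "eigenvector Mc v x"
    using Mc unfolding eigenvector_def v_def by simp
  then have "poly (char_poly Mc) x = 0"
    using eigenvalue_root_char_poly[OF Mc] unfolding eigenvalue_def by blast
  moreover have "char_poly Mc = map_poly of_int (char_poly M)"
    unfolding Mc_def by (rule of_int_hom.char_poly_hom[OF M])
  moreover have "lead_coeff (char_poly M) = 1" using degree_monic_char_poly[OF M] by simp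
  ultimately show ?thesis unfolding algebraic_int_altdef_ipoly by metis
qed

lemma algebraic_int_power_reduce:
  fixes x :: complex
  assumes "algebraic_int x"
  obtains n c where "n > 0" "x ^ n = (\<Sum>i<n. of_int (c i) * x ^ i)"
proof -
  obtain p where p: "poly (map_poly of_int p) x = 0" "lead_coeff p = 1"
    using assms unfolding algebraic_int_altdef_ipoly by blast
  define n where "n = degree p"
  have n: "n > 0"
  proof (rule ccontr)
    assume "\<not> n > 0"
    then obtain c where "p = [:c:]" unfolding n_def by (auto elim: degree_eq_zeroE)
    then show False using p by (simp add: map_poly_pCons)
  qed
  have "0 = (\<Sum>i\<le>n. of_int (coeff p i) * x ^ i)"
    using p(1) unfolding poly_altdef n_def by (simp add: degree_map_poly coeff_map_poly)
  also have "\<dots> = (\<Sum>i<n. of_int (coeff p i) * x ^ i) + x ^ n"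
    using p(2) by (simp add: n_def lessThan_Suc_atMost[symmetric])
  finally have "(\<Sum>i<n. of_int (coeff p i) * x ^ i) + x ^ n = 0" by (rule sym)
  then have "x ^ n = - (\<Sum>i<n. of_int (coeff p i) * x ^ i)" by (simp add: add_eq_0_iff)
  then have "x ^ n = (\<Sum>i<n. of_int (- coeff p i) * x ^ i)"
    by (simp only: of_int_minus mult_minus_left sum_negf)
  then show ?thesis by (rule that[OF n])
qed

text \<open>The products \<open>x^i y^j\<close> with exponents below the two degrees span a module
  stable under both numbers, since the monic equations rewrite \<open>x^n\<close> and
  \<open>y^m\<close>. Containing 1, the generating set is not just zero.\<close>

lemma algebraic_int_common_span:
  fixes x y :: complex
  assumes "algebraic_int x" "algebraic_int y"
  obtains B where "finite B" "1 \<in> B" "\<forall>b\<in>B. x * b \<in> int_span B" "\<forall>b\<in>B. y * b \<in> int_span B"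
proof -
  obtain n c where n: "n > 0" "x ^ n = (\<Sum>i<n. of_int (c i) * x ^ i)"
    using algebraic_int_power_reduce[OF assms(1)] .
  obtain m d where m: "m > 0" "y ^ m = (\<Sum>i<m. of_int (d i) * y ^ i)"
    using algebraic_int_power_reduce[OF assms(2)] .
  define B where "B = (\<lambda>(i, j). x ^ i * y ^ j) ` ({..<n} \<times> {..<m})"
  have B: "finite B" unfolding B_def by simp
  have mem: "x ^ i * y ^ j \<in> int_span B" if "i < n" "j < m" for i j
    by (rule int_span_base[OF B]) (use that in \<open>auto simp: B_def\<close>)
  have "1 \<in> B" unfolding B_def using n m by (intro image_eqI[of _ _ "(0, 0)"]) auto
  moreover have "x * b \<in> int_span B" "y * b \<in> int_span B" if b: "b \<in> B" for b
  proof -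
    obtain i j where ij: "i < n" "j < m" "b = x ^ i * y ^ j" using b unfolding B_def by auto
    show "x * b \<in> int_span B"
    proof (cases "Suc i < n")
      case True
      have "x * b = x ^ Suc i * y ^ j" by (simp add: ij)
      then show ?thesis using mem[OF True ij(2)] by (simp only:)
    next
      case False
      then have "Suc i = n" using ij by simp
      then have "x * b = x ^ n * y ^ j" by (auto simp: ij)
      also have "\<dots> = (\<Sum>k<n. of_int (c k) * (x ^ k * y ^ j))"
        unfolding n by (simp add: sum_distrib_right mult.assoc)
      also have "\<dots> \<in> int_span B" using ij by (intro int_span_sum int_span_scale mem) auto
      finally show ?thesis .
    qed
    show "y * b \<in> int_span B"
    proof (cases "Suc j < m")
      case True
      have "y * b = x ^ i * y ^ Suc j" by (simp add: ij)
      then show ?thesis using mem[OF ij(1) True] by (simp only:)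
    next
      case False
      then have "Suc j = m" using ij by simp
      then have "y * b = x ^ i * y ^ m" by (auto simp: ij)
      also have "\<dots> = (\<Sum>k<m. of_int (d k) * (x ^ i * y ^ k))"
        unfolding m by (simp add: sum_distrib_left mult_ac)
      also have "\<dots> \<in> int_span B" using ij by (intro int_span_sum int_span_scale mem) auto
      finally show ?thesis .
    qed
  qed
  ultimately show ?thesis using that[OF B] by simp
qed

lemma algebraic_int_add:
  fixes x y :: complex
  assumes "algebraic_int x" "algebraic_int y"
  shows "algebraic_int (x + y)"
proof -
  obtain B where "finite B" "1 \<in> B" and B: "\<forall>b\<in>B. x * b \<in> int_span B"
      "\<forall>b\<in>B. y * b \<in> int_span B"
    using algebraic_int_common_span[OF assms] .
  show ?thesis
  proof (rule algebraic_int_if_int_span_stable)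
    show "(x + y) * b \<in> int_span B" if "b \<in> B" for b
      unfolding distrib_right by (intro int_span_add B[rule_format] that)
    show "\<exists>b\<in>B. b \<noteq> 0" using \<open>1 \<in> B\<close> by (rule bexI[rotated]) simp
  qed (rule \<open>finite B\<close>)
qed

lemma algebraic_int_mult:
  fixes x y :: complex
  assumes "algebraic_int x" "algebraic_int y"
  shows "algebraic_int (x * y)"
proof -
  obtain B where "finite B" "1 \<in> B" and B: "\<forall>b\<in>B. x * b \<in> int_span B"
      "\<forall>b\<in>B. y * b \<in> int_span B"
    using algebraic_int_common_span[OF assms] .
  show ?thesis
  proof (rule algebraic_int_if_int_span_stable)
    show "x * y * b \<in> int_span B" if "b \<in> B" for b
      unfolding mult.assoc by (rule int_span_mult) (use B that in blast)+
    show "\<exists>b\<in>B. b \<noteq> 0" using \<open>1 \<in> B\<close> by (rule bexI[rotated]) simp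
  qed (rule \<open>finite B\<close>)
qed

subsection \<open>Biquadratic fields\<close>

fun lin :: "complex \<Rightarrow> complex \<Rightarrow> complex \<Rightarrow> quad \<Rightarrow> complex" where
  "lin r s t (x1, x2, x3, x4) = of_rat x1 + of_rat x2 * r + of_rat x3 * s + of_rat x4 * t"

text \<open>Phrased with the operations of the type of complex numbers instead of a ring record. As
  \<open>inverse 0 = 0\<close>, closure under inverses needs no exception.\<close>

definition subfield_set :: "complex set \<Rightarrow> bool" where
  "subfield_set K \<longleftrightarrow> \<rat> \<subseteq> K \<and>
     (\<forall>x\<in>K. \<forall>y\<in>K. x + y \<in> K \<and> x * y \<in> K) \<and> (\<forall>x\<in>K. - x \<in> K \<and> inverse x \<in> K)"

section \<open>Generated subfields of the complex numbers\<close>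

lemma inv_ring_of_type_algebra:
  assumes "(x::complex) \<noteq> 0"
  shows "inv\<^bsub>ring_of_type_algebra\<^esub> x = inverse x"
proof -
  interpret F: field "ring_of_type_algebra :: complex ring" by (rule field_from_type_algebra)
  show ?thesis
    by (rule F.inv_char) (use assms in \<open>simp_all add: ring_of_type_algebra_def\<close>)
qed

lemma a_inv_ring_of_type_algebra: "\<ominus>\<^bsub>ring_of_type_algebra\<^esub> (x::complex) = - x"
proof -
  interpret F: field "ring_of_type_algebra :: complex ring" by (rule field_from_type_algebra)
  show ?thesis
    by (rule F.minus_equality) (simp_all add: ring_of_type_algebra_def)
qed

lemma rat_adjoin_least:
  assumes "subfield_set K" "S \<subseteq> K"
  shows "rat_adjoin S \<subseteq> K"
proof
  fix x assume "x \<in> rat_adjoin S"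
  then have "x \<in> generate_field ring_of_type_algebra S" unfolding rat_adjoin_def .
  then show "x \<in> K"
  proof induction
    case one
    then show ?case using assms(1) by (auto simp: subfield_set_def ring_of_type_algebra_def)
  next
    case (m_inv h)
    then have "h \<noteq> 0" by (simp add: ring_of_type_algebra_def)
    then show ?case
      using m_inv assms(1) by (simp add: inv_ring_of_type_algebra subfield_set_def)
  next
    case (a_inv h)
    then show ?case using assms(1) by (simp add: a_inv_ring_of_type_algebra subfield_set_def)
  qed (use assms in \<open>auto simp: subfield_set_def ring_of_type_algebra_def\<close>)
qed

lemma subset_rat_adjoin: "S \<subseteq> rat_adjoin S"
  unfolding rat_adjoin_def by (auto intro: generate_field.incl)

lemma subfield_set_rat_adjoin: "subfield_set (rat_adjoin S)"
proof -
  let ?K = "rat_adjoin S"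
  have add: "x + y \<in> ?K" and mult: "x * y \<in> ?K" if "x \<in> ?K" "y \<in> ?K" for x y
    using generate_field.eng_add[of x ring_of_type_algebra S y]
      generate_field.eng_mult[of x ring_of_type_algebra S y] that
    unfolding rat_adjoin_def by (simp_all add: ring_of_type_algebra_def)
  have neg: "- x \<in> ?K" if "x \<in> ?K" for x
    using generate_field.a_inv[of x ring_of_type_algebra S] that
    unfolding rat_adjoin_def by (simp add: a_inv_ring_of_type_algebra)
  have one: "1 \<in> ?K"
    using generate_field.one[of ring_of_type_algebra S]
    unfolding rat_adjoin_def by (simp add: ring_of_type_algebra_def)
  have zero: "0 \<in> ?K" using add[OF one neg[OF one]] by simp
  have inv: "inverse x \<in> ?K" if "x \<in> ?K" for x
  proof (cases "x = 0")
    case False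
    then have "x \<noteq> \<zero>\<^bsub>ring_of_type_algebra\<^esub>" by (simp add: ring_of_type_algebra_def)
    then show ?thesis
      using generate_field.m_inv[of x ring_of_type_algebra S] that False
      unfolding rat_adjoin_def by (simp add: inv_ring_of_type_algebra)
  qed (use zero in simp)
  have nat: "of_nat n \<in> ?K" for n
    by (induction n) (simp_all add: zero one add)
  have int: "of_int n \<in> ?K" for n
    by (cases n) (use nat neg in \<open>auto simp del: of_nat_Suc\<close>)
  have "\<rat> \<subseteq> ?K"
  proof
    fix x :: complex assume "x \<in> \<rat>"
    then obtain p q where "x = of_int p / of_int q" by (elim Rats_cases')
    then show "x \<in> ?K" by (simp add: divide_inverse mult int inv)
  qed
  then show ?thesis unfolding subfield_set_def by (simp add: add mult neg inv)
qed

lemma subfield_set_Rats: "subfield_set \<rat>"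
  unfolding subfield_set_def by simp

lemma subfield_setD:
  assumes "subfield_set K"
  shows "x \<in> \<rat> \<Longrightarrow> x \<in> K" "x \<in> K \<Longrightarrow> y \<in> K \<Longrightarrow> x + y \<in> K" "x \<in> K \<Longrightarrow> y \<in> K \<Longrightarrow> x * y \<in> K"
    "x \<in> K \<Longrightarrow> - x \<in> K" "x \<in> K \<Longrightarrow> inverse x \<in> K"
    "x \<in> K \<Longrightarrow> y \<in> K \<Longrightarrow> x - y \<in> K" "x \<in> K \<Longrightarrow> y \<in> K \<Longrightarrow> x / y \<in> K"
proof -
  show "x \<in> \<rat> \<Longrightarrow> x \<in> K" using assms unfolding subfield_set_def by blast
  show add: "x \<in> K \<Longrightarrow> y \<in> K \<Longrightarrow> x + y \<in> K" for x y using assms unfolding subfield_set_def by simp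
  show mult: "x \<in> K \<Longrightarrow> y \<in> K \<Longrightarrow> x * y \<in> K" for x y using assms unfolding subfield_set_def by simp
  show neg: "x \<in> K \<Longrightarrow> - x \<in> K" for x using assms unfolding subfield_set_def by simp
  show inv: "x \<in> K \<Longrightarrow> inverse x \<in> K" for x using assms unfolding subfield_set_def by simp
  show "x \<in> K \<Longrightarrow> y \<in> K \<Longrightarrow> x - y \<in> K" using add[OF _ neg, of x y] by simp
  show "x \<in> K \<Longrightarrow> y \<in> K \<Longrightarrow> x / y \<in> K" using mult[OF _ inv, of x y] by (simp add: divide_inverse)
qed

text \<open>Inverses come from multiplying by the conjugate \<open>x - y s\<close>. It is not
  assumed that \<open>s\<close> lies outside \<open>K\<close>, so the conjugate may vanish; then
  \<open>y = 0\<close> or \<open>s = x / y\<close>, and the element is already in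
  \<open>K\<close>.\<close>

lemma subfield_set_quadratic:
  assumes K: "subfield_set K" and s: "s * s \<in> K"
  shows "subfield_set {x + y * s | x y. x \<in> K \<and> y \<in> K}"
proof -
  define F where "F = {x + y * s | x y. x \<in> K \<and> y \<in> K}"
  note cl = subfield_setD[OF K]
  have 0: "0 \<in> K" by (rule cl(1)) simp
  have mem: "x + y * s \<in> F" if "x \<in> K" "y \<in> K" for x y
    using that unfolding F_def by blast
  have base: "x \<in> F" if "x \<in> K" for x using mem[OF that 0] by simp
  have E: "\<exists>x y. u = x + y * s \<and> x \<in> K \<and> y \<in> K" if "u \<in> F" for u
    using that unfolding F_def by blast
  have inv: "inverse (x + y * s) \<in> F" if xy: "x \<in> K" "y \<in> K" for x y
  proof (cases "x - y * s = 0")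
    case True
    have "x + y * s \<in> K"
    proof (cases "y = 0")
      case False
      then have "s = x / y" using True by (simp add: field_simps)
      then have "s \<in> K" using cl(7)[OF xy] by simp
      show ?thesis by (intro cl(2,3) xy \<open>s \<in> K\<close>)
    qed (use xy in simp)
    then show ?thesis by (intro base cl(5))
  next
    case False
    define N where "N = x * x - y * y * (s * s)"
    have N: "(x + y * s) * (x - y * s) = N" unfolding N_def by (simp add: algebra_simps)
    have "N \<in> K" unfolding N_def by (intro cl(3,6) xy s)
    have "inverse (x + y * s) = (x - y * s) / N"
      unfolding N[symmetric] using False
      by (simp only: nonzero_divide_mult_cancel_right inverse_eq_divide not_False_eq_True)
    also have "\<dots> = x / N + (- y / N) * s" by (simp add: diff_divide_distrib)
    also have "\<dots> \<in> F" by (intro mem cl(4,7) xy \<open>N \<in> K\<close>)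
    finally show ?thesis .
  qed
  have "subfield_set F"
    unfolding subfield_set_def
  proof (intro conjI ballI)
    show "\<rat> \<subseteq> F" using base cl(1) by blast
  next
    fix u v assume "u \<in> F" "v \<in> F"
    then obtain x y x' y' where e: "u = x + y * s" "v = x' + y' * s"
      and m: "x \<in> K" "y \<in> K" "x' \<in> K" "y' \<in> K" using E by metis
    have "u + v = (x + x') + (y + y') * s" unfolding e by (simp add: algebra_simps)
    also have "\<dots> \<in> F" by (intro mem cl(2) m)
    finally show "u + v \<in> F" .
    have "u * v = (x * x' + y * y' * (s * s)) + (x * y' + y * x') * s"
      unfolding e by (simp add: algebra_simps)
    also have "\<dots> \<in> F" by (intro mem cl(2,3) m s)
    finally show "u * v \<in> F" .
  next
    fix u assume "u \<in> F"
    then obtain x y where e: "u = x + y * s" and m: "x \<in> K" "y \<in> K" using E by metis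
    have "- u = (- x) + (- y) * s" unfolding e by simp
    also have "\<dots> \<in> F" by (intro mem cl(4) m)
    finally show "- u \<in> F" .
    show "inverse u \<in> F" unfolding e by (rule inv[OF m])
  qed
  then show ?thesis unfolding F_def .
qed

text \<open>Two quadratic steps, by \<open>r\<close> and then by \<open>s\<close>, give the span of
  \<open>1, r, s, r s\<close>; rescaling the last vector by \<open>a\<close> replaces it with
  \<open>t\<close>.\<close>

lemma rat_adjoin_eq_range_lin:
  assumes r: "r * r \<in> \<rat>" and s: "s * s \<in> \<rat>" and t: "r * s = of_rat a * t" "a \<noteq> 0"
  shows "rat_adjoin {r, s} = range (lin r s t)"
proof -
  define K where "K = {x + y * r | x y. x \<in> \<rat> \<and> y \<in> \<rat>}"
  define L where "L = {x + y * s | x y. x \<in> K \<and> y \<in> K}"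
  have K: "subfield_set K" unfolding K_def by (rule subfield_set_quadratic[OF subfield_set_Rats r])
  then have "s * s \<in> K" using s by (rule subfield_setD(1))
  then have L: "subfield_set L" unfolding L_def by (rule subfield_set_quadratic[OF K])
  have KI: "of_rat x + of_rat y * r \<in> K" for x y
    unfolding K_def by (intro CollectI exI conjI) (rule refl, auto)
  have "r \<in> K" using KI[of 0 1] by simp
  moreover have "0 \<in> K" "1 \<in> K" using KI[of 0 0] KI[of 1 0] by simp_all
  ultimately have "r + 0 * s \<in> L" "0 + 1 * s \<in> L" unfolding L_def by blast+
  then have "{r, s} \<subseteq> L" by simp
  then have "rat_adjoin {r, s} \<subseteq> L" by (rule rat_adjoin_least[OF L])
  moreover have "L \<subseteq> range (lin r s t)"
  proof
    fix x assume "x \<in> L"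
    then obtain x1 x2 x3 x4 where x: "x = (of_rat x1 + of_rat x2 * r) + (of_rat x3 + of_rat x4 * r) * s"
      unfolding L_def K_def by (auto elim!: Rats_cases)
    have "x = of_rat x1 + of_rat x2 * r + of_rat x3 * s + of_rat x4 * (r * s)"
      unfolding x by (simp add: algebra_simps)
    also have "\<dots> = lin r s t (x1, x2, x3, x4 * a)"
      unfolding t by (simp add: of_rat_mult)
    finally show "x \<in> range (lin r s t)" by blast
  qed
  moreover have "range (lin r s t) \<subseteq> rat_adjoin {r, s}"
  proof
    fix x assume "x \<in> range (lin r s t)"
    then obtain x1 x2 x3 x4 where x: "x = lin r s t (x1, x2, x3, x4)" by (metis prod_cases4 rangeE)
    note cl = subfield_setD[OF subfield_set_rat_adjoin[of "{r, s}"]]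
    have rs: "r \<in> rat_adjoin {r, s}" "s \<in> rat_adjoin {r, s}" using subset_rat_adjoin by blast+
    have q: "of_rat y \<in> rat_adjoin {r, s}" for y by (rule cl(1)) simp
    have "t = (r * s) * inverse (of_rat a)" using t by simp
    also have "\<dots> \<in> rat_adjoin {r, s}" by (intro cl(3,5) rs q)
    finally have tK: "t \<in> rat_adjoin {r, s}" .
    show "x \<in> rat_adjoin {r, s}" unfolding x lin.simps by (intro cl(2,3) rs q tK)
  qed
  ultimately show ?thesis by blast
qed

section \<open>Linear independence of \<open>1, r, s, t\<close> from the degree\<close>

interpretation rat_vector_space: vector_space "\<lambda>(q::rat) (x::complex). of_rat q * x"
  by unfold_locales (simp_all add: algebra_simps of_rat_add of_rat_mult)

lemma lin_independent:
  assumes dim: "rat_vector_space.dim (range (lin r s t)) = 4"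
    and 0: "lin r s t x = 0"
  shows "x = (0, 0, 0, 0)"
proof (rule ccontr)
  assume nz: "x \<noteq> (0, 0, 0, 0)"
  obtain x1 x2 x3 x4 where x: "x = (x1, x2, x3, x4)" by (cases x)
  have drop: False if "of_rat y * v + w = 0" "y \<noteq> 0" "w \<in> rat_vector_space.span W"
      "range (lin r s t) \<subseteq> rat_vector_space.span (insert v W)" "finite W" "card W \<le> 3"
    for y v w W
  proof -
    have "v = of_rat (- 1 / y) * w" using that(1,2)
      by (simp add: of_rat_divide of_rat_minus field_simps add_eq_0_iff)
    then have "v \<in> rat_vector_space.span W" using rat_vector_space.span_scale[OF that(3)] by (simp only:)
    then have "range (lin r s t) \<subseteq> rat_vector_space.span W"
      using that(4) by (simp add: rat_vector_space.span_redundant)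
    then have "rat_vector_space.dim (range (lin r s t)) \<le> card W"
      by (rule rat_vector_space.dim_le_card[OF _ that(5)])
    then show False using dim that(6) by simp
  qed
  have span: "range (lin r s t) \<subseteq> rat_vector_space.span {1, r, s, t}"
  proof
    fix y assume "y \<in> range (lin r s t)"
    then obtain y1 y2 y3 y4 where y: "y = lin r s t (y1, y2, y3, y4)" by (metis prod_cases4 rangeE)
    have "of_rat y1 * 1 + of_rat y2 * r + of_rat y3 * s + of_rat y4 * t \<in> rat_vector_space.span {1, r, s, t}"
      by (intro rat_vector_space.span_add rat_vector_space.span_scale rat_vector_space.span_base) auto
    then show "y \<in> rat_vector_space.span {1, r, s, t}" unfolding y by simp
  qed
  have eq: "of_rat x1 * 1 + (of_rat x2 * r + of_rat x3 * s + of_rat x4 * t) = 0"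
    using 0 unfolding x by (simp add: add.assoc)
  have card: "card {u, v, w} \<le> 3" for u v w :: complex by (rule card_insert_le_m1) (auto simp: card_insert_if)
  have mem: "of_rat p * u + of_rat q * v + of_rat z * w \<in> rat_vector_space.span {u, v, w}"
    for p q z u v w
    by (intro rat_vector_space.span_add rat_vector_space.span_scale rat_vector_space.span_base) auto
  have drop': False
    if "y \<noteq> 0" "of_rat y * v + (of_rat p * u + of_rat q * w + of_rat z * w') = 0" "{1, r, s, t} = {v, u, w, w'}"
    for y p q z v u w w'
    using drop[OF that(2,1) mem] span card unfolding that(3) by simp
  consider "x1 \<noteq> 0" | "x2 \<noteq> 0" | "x3 \<noteq> 0" | "x4 \<noteq> 0" using nz unfolding x by auto
  then show False
  proof cases
    case 1
    show False by (rule drop'[OF 1, of 1 x2 r x3 s x4 t]) (use eq in auto)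
  next
    case 2
    show False by (rule drop'[OF 2, of r x1 1 x3 s x4 t]) (use eq in \<open>auto simp: ac_simps\<close>)
  next
    case 3
    show False by (rule drop'[OF 3, of s x1 1 x2 r x4 t]) (use eq in \<open>auto simp: ac_simps\<close>)
  next
    case 4
    show False by (rule drop'[OF 4, of t x1 1 x2 r x3 s]) (use eq in \<open>auto simp: ac_simps\<close>)
  qed
qed

declare lin.simps [simp del]

text \<open>Reaching the first two unit vectors makes the scalar coordinates of \<open>x\<close>
  nonzero; reaching the last two makes the plane determinant \<open>N\<close> divide 1 in the
  rationals, so it is nonzero too. Each coefficient of \<open>q\<close> is then determined by the
  image of \<open>x\<close>.\<close>

lemma act_injective:
  assumes surj: "act a b q1 x = (1, 0, 0, 0)" "act a b q2 x = (0, 1, 0, 0)"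
      "act a b q3 x = (0, 0, 1, 0)" "act a b q4 x = (0, 0, 0, 1)"
    and eq: "act a b q x = act a b q' x"
  shows "q = q'"
proof -
  obtain x1 x2 x3 x4 where x: "x = (x1, x2, x3, x4)" by (cases x)
  obtain A3 B3 C3 E3 where q3: "q3 = (A3, B3, C3, E3)" by (cases q3)
  obtain A4 B4 C4 E4 where q4: "q4 = (A4, B4, C4, E4)" by (cases q4)
  obtain A B C E where q: "q = (A, B, C, E)" by (cases q)
  obtain A' B' C' E' where q': "q' = (A', B', C', E')" by (cases q')
  have "x1 \<noteq> 0" "x2 \<noteq> 0"
    using act_eq_nonzero(1)[OF surj(1)[unfolded x]] act_eq_nonzero(2)[OF surj(2)[unfolded x]] by auto
  moreover define N where "N = of_int a * x3\<^sup>2 + of_int b * x4\<^sup>2"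
  have "(C3 * E4 - C4 * E3) * N = 1"
    using plane_determinant[of C3 x3 "of_int b" E3 x4 1 "of_int a" 0 C4 E4 0 1]
      act_eqD(3,4)[OF surj(3)[unfolded x q3]] act_eqD(3,4)[OF surj(4)[unfolded x q4]]
    unfolding N_def by simp
  then have "N \<noteq> 0" by auto
  have A: "A * x1 = A' * x1" and B: "B * x2 = B' * x2"
    and 3: "C * x3 - of_int b * E * x4 = C' * x3 - of_int b * E' * x4"
    and 4: "C * x4 + of_int a * E * x3 = C' * x4 + of_int a * E' * x3"
    using eq unfolding x q q' by simp_all
  have "(C - C') * N = of_int a * x3 * ((C * x3 - of_int b * E * x4) - (C' * x3 - of_int b * E' * x4))
      + of_int b * x4 * ((C * x4 + of_int a * E * x3) - (C' * x4 + of_int a * E' * x3))"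
    unfolding N_def by (simp add: algebra_simps power2_eq_square)
  then have "(C - C') * N = 0" unfolding 3 4 by simp
  moreover have "(E - E') * N = x3 * ((C * x4 + of_int a * E * x3) - (C' * x4 + of_int a * E' * x3))
      - x4 * ((C * x3 - of_int b * E * x4) - (C' * x3 - of_int b * E' * x4))"
    unfolding N_def by (simp add: algebra_simps power2_eq_square)
  then have "(E - E') * N = 0" unfolding 3 4 by simp
  ultimately show ?thesis using A B \<open>N \<noteq> 0\<close> unfolding q q' by simp
qed

lemma generate_involution:
  assumes "\<tau> \<in> Bij L" "compose L \<tau> \<tau> = (\<lambda>x\<in>L. x)"
  shows "generate (BijGroup L) {\<tau>} = {\<lambda>x\<in>L. x, \<tau>}"
proof -
  interpret G: group "BijGroup L" by (rule group_BijGroup)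
  have one: "\<one>\<^bsub>BijGroup L\<^esub> = (\<lambda>x\<in>L. x)" by (simp add: BijGroup_def)
  have \<tau>: "\<tau> \<in> carrier (BijGroup L)" using assms by (simp add: BijGroup_def)
  have mult: "\<tau> \<otimes>\<^bsub>BijGroup L\<^esub> \<tau> = \<one>\<^bsub>BijGroup L\<^esub>"
    using assms by (simp add: BijGroup_def)
  then have inv: "inv\<^bsub>BijGroup L\<^esub> \<tau> = \<tau>" using \<tau> G.inv_equality by blast
  have "x \<in> {\<one>\<^bsub>BijGroup L\<^esub>, \<tau>}" if "x \<in> generate (BijGroup L) {\<tau>}" for x
    using that
  proof induction
    case (eng h1 h2)
    then show ?case using mult \<tau> by auto
  qed (auto simp: inv)
  moreover have "{\<one>\<^bsub>BijGroup L\<^esub>, \<tau>} \<subseteq> generate (BijGroup L) {\<tau>}"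
    by (auto intro: generate.one generate.incl)
  ultimately show ?thesis unfolding one by blast
qed

lemma algebraic_int_if_square:
  assumes "algebraic_int (x * x)"
  shows "algebraic_int (x :: complex)"
proof (rule algebraic_int_root[OF assms, of "monom 1 2"])
  show "\<forall>i. coeff (monom 1 2 :: complex poly) i \<in> \<int>" by (simp add: coeff_monom)
qed (simp_all add: poly_monom power2_eq_square degree_monom_eq)

fun conj_coords :: "rat \<Rightarrow> rat \<Rightarrow> quad \<Rightarrow> quad" where
  "conj_coords e1 e2 (x1, x2, x3, x4) = (x1, e1 * x2, e2 * x3, e1 * e2 * x4)"

text \<open>The roles of \<open>m\<close> and \<open>n\<close> are forgotten in favour of three
  square roots on an equal footing. The integers \<open>a, b, c\<close> may be negative, which
  leaves room for the sign change in \<open>frame_minus\<close>; \<open>indep\<close> stands for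
  degree 4.\<close>

locale biquadratic_frame =
  fixes a b c :: int and r s t :: complex
  assumes rs: "r * s = of_int a * t" and rt: "r * t = of_int b * s" and st: "s * t = of_int c * r"
    and sqf: "squarefree (a * b)" "squarefree (a * c)" "squarefree (b * c)"
    and indep: "lin r s t x = 0 \<Longrightarrow> x = (0, 0, 0, 0)"
begin

lemma nonzero: "a \<noteq> 0" "b \<noteq> 0" "c \<noteq> 0" "r \<noteq> 0" "s \<noteq> 0" "t \<noteq> 0"
proof -
  show "a \<noteq> 0" "b \<noteq> 0" "c \<noteq> 0" using sqf by auto
  show "r \<noteq> 0" "s \<noteq> 0" "t \<noteq> 0"
    using indep[of "(0, 1, 0, 0)"] indep[of "(0, 0, 1, 0)"] indep[of "(0, 0, 0, 1)"] by (auto simp: lin.simps)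
qed

lemma squares: "r * r = of_int (a * b)" "s * s = of_int (a * c)" "t * t = of_int (b * c)"
proof -
  have "(r * r) * s = r * (r * s)" by (rule mult.assoc)
  also have "\<dots> = of_int a * (r * t)" unfolding rs by (rule mult.left_commute)
  also have "\<dots> = of_int (a * b) * s" unfolding rt by simp
  finally show "r * r = of_int (a * b)" using nonzero by simp
  have "(s * s) * r = s * (r * s)" by (simp add: ac_simps)
  also have "\<dots> = of_int a * (s * t)" unfolding rs by (rule mult.left_commute)
  also have "\<dots> = of_int (a * c) * r" unfolding st by simp
  finally show "s * s = of_int (a * c)" using nonzero by simp
  have "(t * t) * s = t * (s * t)" by (simp add: ac_simps)
  also have "\<dots> = of_int c * (r * t)" unfolding st by (simp add: ac_simps)
  also have "\<dots> = of_int (b * c) * s" unfolding rt by simp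
  finally show "t * t = of_int (b * c)" using nonzero by simp
qed

lemma lin_injective: "lin r s t x = lin r s t y \<Longrightarrow> x = y"
proof -
  assume eq: "lin r s t x = lin r s t y"
  obtain x1 x2 x3 x4 y1 y2 y3 y4 where xy: "x = (x1, x2, x3, x4)" "y = (y1, y2, y3, y4)"
    by (cases x, cases y) auto
  have "lin r s t (x1 - y1, x2 - y2, x3 - y3, x4 - y4) = 0"
    using eq unfolding xy by (simp add: lin.simps of_rat_diff algebra_simps)
  from indep[OF this] show "x = y" unfolding xy by simp
qed

lemma inj_lin: "inj (lin r s t)"
  by (rule injI) (rule lin_injective)

abbreviation "L \<equiv> range (lin r s t)"

definition coords :: "complex \<Rightarrow> quad" where "coords = inv_into UNIV (lin r s t)"

lemma coords_lin [simp]: "coords (lin r s t x) = x"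
  unfolding coords_def by (rule inv_f_f[OF inj_lin])

lemma L_cases: "z \<in> L \<Longrightarrow> (\<And>x1 x2 x3 x4. z = lin r s t (x1, x2, x3, x4) \<Longrightarrow> P) \<Longrightarrow> P"
  by (metis prod_cases4 rangeE)

lemma lin_add: "lin r s t (x1, x2, x3, x4) + lin r s t (y1, y2, y3, y4) =
    lin r s t (x1 + y1, x2 + y2, x3 + y3, x4 + y4)"
  by (simp add: lin.simps of_rat_add algebra_simps)

lemma lin_mult: "lin r s t (x1, x2, x3, x4) * lin r s t (y1, y2, y3, y4) =
    lin r s t
      (x1 * y1 + of_int (a * b) * x2 * y2 + of_int (a * c) * x3 * y3 + of_int (b * c) * x4 * y4,
       x1 * y2 + x2 * y1 + of_int c * (x3 * y4 + x4 * y3),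
       x1 * y3 + x3 * y1 + of_int b * (x2 * y4 + x4 * y2),
       x1 * y4 + x4 * y1 + of_int a * (x2 * y3 + x3 * y2))"
proof -
  have "lin r s t (x1, x2, x3, x4) * lin r s t (y1, y2, y3, y4) =
    of_rat x1 * of_rat y1 + of_rat x2 * of_rat y2 * (r * r) + of_rat x3 * of_rat y3 * (s * s)
    + of_rat x4 * of_rat y4 * (t * t)
    + (of_rat x1 * of_rat y2 + of_rat x2 * of_rat y1) * r
    + (of_rat x3 * of_rat y4 + of_rat x4 * of_rat y3) * (s * t)
    + (of_rat x1 * of_rat y3 + of_rat x3 * of_rat y1) * s
    + (of_rat x2 * of_rat y4 + of_rat x4 * of_rat y2) * (r * t)
    + (of_rat x1 * of_rat y4 + of_rat x4 * of_rat y1) * t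
    + (of_rat x2 * of_rat y3 + of_rat x3 * of_rat y2) * (r * s)"
    by (simp add: lin.simps algebra_simps)
  then show ?thesis unfolding squares rs rt st
    by (simp add: lin.simps of_rat_add of_rat_mult algebra_simps)
qed

lemma lin_diff: "lin r s t (x1, x2, x3, x4) - lin r s t (y1, y2, y3, y4) =
    lin r s t (x1 - y1, x2 - y2, x3 - y3, x4 - y4)"
  by (simp add: lin.simps of_rat_diff algebra_simps)

lemma lin_scale: "of_rat q * lin r s t (x1, x2, x3, x4) = lin r s t (q * x1, q * x2, q * x3, q * x4)"
  by (simp add: lin.simps of_rat_mult algebra_simps)

lemma lin_mult_r: "r * lin r s t (x1, x2, x3, x4) =
    lin r s t (of_int (a * b) * x2, x1, of_int b * x4, of_int a * x3)"
  using lin_mult[of 0 1 0 0 x1 x2 x3 x4] by (simp add: lin.simps)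

lemma subfield_L: "subfield_set L"
proof -
  have "rat_adjoin {r, s} = L"
    by (rule rat_adjoin_eq_range_lin[where a = "of_int a"]) (use squares rs nonzero in auto)
  then show ?thesis using subfield_set_rat_adjoin[of "{r, s}"] by simp
qed

lemma of_rat_lin: "of_rat q = lin r s t (q, 0, 0, 0)" by (simp add: lin.simps)

section \<open>The Galois group in coordinates\<close>

definition conj_map :: "rat \<Rightarrow> rat \<Rightarrow> complex \<Rightarrow> complex" where
  "conj_map e1 e2 = (\<lambda>z\<in>L. lin r s t (conj_coords e1 e2 (coords z)))"

lemma conj_map_lin [simp]: "conj_map e1 e2 (lin r s t x) = lin r s t (conj_coords e1 e2 x)"
  unfolding conj_map_def by simp

lemma conj_map_id: "conj_map 1 1 = (\<lambda>z\<in>L. z)"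
  unfolding conj_map_def
proof (rule restrict_ext)
  fix z assume "z \<in> L"
  then show "lin r s t (conj_coords 1 1 (coords z)) = z" by (rule L_cases) simp
qed

lemma conj_coords_involutive:
  assumes e: "e1 * e1 = 1" "e2 * e2 = 1"
  shows "conj_coords e1 e2 (conj_coords e1 e2 x) = x"
proof -
  have "e1 * (e1 * w) = w" "e2 * (e2 * w) = w" for w
    using e by (simp_all add: mult.assoc[symmetric])
  moreover have "e1 * e2 * (e1 * e2 * w) = (e1 * e1) * ((e2 * e2) * w)" for w
    by (simp only: ac_simps)
  ultimately show ?thesis by (cases x) (simp add: e)
qed

lemma conj_map_galois:
  assumes e: "e1 * e1 = 1" "e2 * e2 = 1"
  shows "conj_map e1 e2 \<in> galois_group L \<rat>"
proof -
  have "bij_betw (conj_map e1 e2) L L"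
  proof (rule bij_betw_byWitness[where f' = "conj_map e1 e2"])
    show "\<forall>z\<in>L. conj_map e1 e2 (conj_map e1 e2 z) = z"
      using conj_coords_involutive[OF e] by auto
  qed (use conj_coords_involutive[OF e] in auto)
  then have "conj_map e1 e2 \<in> Bij L" unfolding Bij_def conj_map_def by simp
  moreover have "conj_map e1 e2 (x + y) = conj_map e1 e2 x + conj_map e1 e2 y \<and>
      conj_map e1 e2 (x * y) = conj_map e1 e2 x * conj_map e1 e2 y" if xy: "x \<in> L" "y \<in> L" for x y
  proof -
    obtain x1 x2 x3 x4 where x: "x = lin r s t (x1, x2, x3, x4)" using xy(1) by (rule L_cases)
    obtain y1 y2 y3 y4 where y: "y = lin r s t (y1, y2, y3, y4)" using xy(2) by (rule L_cases)
    have e': "e1 * (e1 * w) = w" "e2 * (e2 * w) = w" for w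
      using e by (simp_all add: mult.assoc[symmetric])
    have "conj_map e1 e2 (x + y) = conj_map e1 e2 x + conj_map e1 e2 y"
      unfolding x y lin_add conj_map_lin conj_coords.simps by (simp add: distrib_left)
    moreover have "conj_map e1 e2 (x * y) = conj_map e1 e2 x * conj_map e1 e2 y"
      unfolding x y lin_mult conj_map_lin conj_coords.simps
      by (rule arg_cong[of _ _ "lin r s t"]) (simp add: algebra_simps e')
    ultimately show ?thesis ..
  qed
  moreover have "conj_map e1 e2 x = x" if "x \<in> \<rat>" for x
    using that by (auto elim!: Rats_cases simp: of_rat_lin)
  ultimately show ?thesis unfolding galois_group_def by blast
qed

text \<open>An automorphism preserves the rational squares of \<open>r\<close> and \<open>s\<close>,
  so it sends each to itself or its negative; \<open>r s = a t\<close> then fixes the image of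
  \<open>t\<close>.\<close>

lemma galois_cases:
  assumes f: "f \<in> galois_group L \<rat>"
  obtains e1 e2 where "e1 = 1 \<or> e1 = - 1" "e2 = 1 \<or> e2 = - 1" "f = conj_map e1 e2"
proof -
  have ext: "f \<in> extensional L" using f unfolding galois_group_def Bij_def by blast
  have add: "f (x + y) = f x + f y" and mult: "f (x * y) = f x * f y" if "x \<in> L" "y \<in> L" for x y
    using f that unfolding galois_group_def by blast+
  have rat: "f (of_rat q) = of_rat q" for q using f unfolding galois_group_def by simp
  have int: "f (of_int q) = of_int q" for q using rat[of "of_int q"] by simp
  have ratL: "of_rat q \<in> L" for q unfolding of_rat_lin by blast
  have intL: "of_int q \<in> L" for q using ratL[of "of_int q"] by simp
  have "lin r s t (0, 1, 0, 0) \<in> L" "lin r s t (0, 0, 1, 0) \<in> L" "lin r s t (0, 0, 0, 1) \<in> L"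
    by blast+
  then have L: "r \<in> L" "s \<in> L" "t \<in> L" by (simp_all add: lin.simps)
  have "f r * f r = r * r" using mult[OF L(1) L(1)] squares(1) int by metis
  then have "f r = r \<or> f r = - r" by (simp add: square_eq_iff)
  then obtain e1 where e1: "e1 = 1 \<or> e1 = - 1" "f r = of_rat e1 * r"
    by (metis minus_mult_left mult_1 of_rat_1 of_rat_minus)
  have "f s * f s = s * s" using mult[OF L(2) L(2)] squares(2) int by metis
  then have "f s = s \<or> f s = - s" by (simp add: square_eq_iff)
  then obtain e2 where e2: "e2 = 1 \<or> e2 = - 1" "f s = of_rat e2 * s"
    by (metis minus_mult_left mult_1 of_rat_1 of_rat_minus)
  have "of_int a * f t = f r * f s" using mult[OF L(1,2)] mult[OF intL[of a] L(3)] rs int by metis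
  also have "\<dots> = of_int a * (of_rat (e1 * e2) * t)"
    unfolding e1 e2 of_rat_mult using rs by (simp add: algebra_simps)
  finally have ft: "f t = of_rat (e1 * e2) * t" using nonzero by simp
  have "f z = conj_map e1 e2 z" for z
  proof (cases "z \<in> L")
    case True
    then obtain x1 x2 x3 x4 where z: "z = lin r s t (x1, x2, x3, x4)" by (rule L_cases)
    note cl = subfield_setD(2,3)[OF subfield_L]
    note m = cl(2)[OF ratL L(1), of x2] cl(2)[OF ratL L(2), of x3] cl(2)[OF ratL L(3), of x4]
    have "f z = f (of_rat x1 + of_rat x2 * r + of_rat x3 * s) + f (of_rat x4 * t)"
      unfolding z lin.simps by (rule add[OF cl(1)[OF cl(1)[OF ratL m(1)] m(2)] m(3)])
    also have "f (of_rat x1 + of_rat x2 * r + of_rat x3 * s) = f (of_rat x1 + of_rat x2 * r) + f (of_rat x3 * s)"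
      by (rule add[OF cl(1)[OF ratL m(1)] m(2)])
    also have "f (of_rat x1 + of_rat x2 * r) = of_rat x1 + f (of_rat x2 * r)"
      using add[OF ratL m(1), of x1] rat by simp
    also have "f (of_rat x2 * r) = of_rat x2 * f r" using mult[OF ratL L(1), of x2] rat by simp
    also have "f (of_rat x3 * s) = of_rat x3 * f s" using mult[OF ratL L(2), of x3] rat by simp
    also have "f (of_rat x4 * t) = of_rat x4 * f t" using mult[OF ratL L(3), of x4] rat by simp
    finally have "f z = of_rat x1 + of_rat x2 * f r + of_rat x3 * f s + of_rat x4 * f t" .
    also have "\<dots> = lin r s t (conj_coords e1 e2 (x1, x2, x3, x4))"
      unfolding e1(2) e2(2) ft by (simp only: conj_coords.simps lin.simps of_rat_mult mult_ac)
    finally show ?thesis unfolding z conj_map_lin .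
  next
    case False
    then show ?thesis using ext unfolding conj_map_def by (simp add: extensional_def)
  qed
  then have "f = conj_map e1 e2" by blast
  with that e1 e2 show ?thesis by blast
qed

lemma conj_map_eq_iff:
  "conj_map e1 e2 = conj_map e1' e2' \<longleftrightarrow> e1 = e1' \<and> e2 = e2'"
proof
  assume eq: "conj_map e1 e2 = conj_map e1' e2'"
  have "lin r s t (conj_coords e1 e2 (0, 1, 1, 0)) = lin r s t (conj_coords e1' e2' (0, 1, 1, 0))"
    using fun_cong[OF eq, of "lin r s t (0, 1, 1, 0)"] by (simp only: conj_map_lin)
  from lin_injective[OF this] show "e1 = e1' \<and> e2 = e2'" by simp
qed simp

text \<open>For the inclusion from right to left, the fixed points of \<open>conj_map 1 e\<close>
  form a subfield containing \<open>r\<close>, hence contain everything generated by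
  \<open>r\<close>.\<close>

lemma galois_group_over_r: "galois_group L (rat_adjoin {r}) = {conj_map 1 1, conj_map 1 (- 1)}"
proof -
  have r: "r = lin r s t (0, 1, 0, 0)" by (simp add: lin.simps)
  have fix_r: "conj_map e1 e2 r = of_rat e1 * r" for e1 e2
    using conj_map_lin[of e1 e2 "(0, 1, 0, 0)", folded r] by (simp add: lin.simps)
  have "galois_group L (rat_adjoin {r}) \<subseteq> {conj_map 1 1, conj_map 1 (- 1)}"
  proof
    fix f assume f: "f \<in> galois_group L (rat_adjoin {r})"
    have "\<rat> \<subseteq> rat_adjoin {r}" "r \<in> rat_adjoin {r}"
      using subfield_set_rat_adjoin[of "{r}"] subset_rat_adjoin[of "{r}"]
      unfolding subfield_set_def by simp_all
    with f have "f \<in> galois_group L \<rat>" and fr: "f r = r" unfolding galois_group_def by blast+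
    then obtain e1 e2 where e: "e1 = 1 \<or> e1 = - 1" "e2 = 1 \<or> e2 = - 1" "f = conj_map e1 e2"
      using galois_cases by blast
    have "of_rat e1 * r = r" using fr unfolding e(3) fix_r .
    then have "e1 = 1" using nonzero by simp
    then show "f \<in> {conj_map 1 1, conj_map 1 (- 1)}" using e by auto
  qed
  moreover have "conj_map 1 e \<in> galois_group L (rat_adjoin {r})" if e: "e * e = 1" for e
  proof -
    let ?f = "conj_map 1 e"
    have f: "?f \<in> galois_group L \<rat>" using conj_map_galois[of 1 e] e by simp
    then have hom: "?f (x + y) = ?f x + ?f y" "?f (x * y) = ?f x * ?f y" if "x \<in> L" "y \<in> L" for x y
      using that unfolding galois_group_def by blast+
    have rat: "?f x = x" if "x \<in> \<rat>" for x using f that unfolding galois_group_def by blast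
    note cl = subfield_setD[OF subfield_L]
    have "subfield_set {x \<in> L. ?f x = x}"
      unfolding subfield_set_def
    proof (intro conjI ballI)
      show "\<rat> \<subseteq> {x \<in> L. ?f x = x}" using rat cl(1) by blast
    next
      fix x y assume "x \<in> {x \<in> L. ?f x = x}" "y \<in> {x \<in> L. ?f x = x}"
      then have xy: "x \<in> L" "y \<in> L" "?f x = x" "?f y = y" by blast+
      show "x + y \<in> {x \<in> L. ?f x = x}" using hom(1)[OF xy(1,2)] cl(2)[OF xy(1,2)] xy(3,4) by simp
      show "x * y \<in> {x \<in> L. ?f x = x}" using hom(2)[OF xy(1,2)] cl(3)[OF xy(1,2)] xy(3,4) by simp
    next
      fix x assume "x \<in> {x \<in> L. ?f x = x}"
      then have x: "x \<in> L" "?f x = x" by blast+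
      have "- 1 \<in> L" by (rule cl(1)) simp
      then have "?f (- 1 * x) = - 1 * x" using hom(2)[of "- 1" x] x rat[of "- 1"] by simp
      then show "- x \<in> {x \<in> L. ?f x = x}" using cl(4)[OF x(1)] by simp
      have "?f (inverse x) = inverse x"
      proof (cases "x = 0")
        case True
        then show ?thesis using rat[of 0] by simp
      next
        case False
        have "x * ?f (inverse x) = ?f (x * inverse x)" using hom(2)[OF x(1) cl(5)[OF x(1)]] x(2) by simp
        also have "\<dots> = 1" using False rat[of 1] by simp
        finally show ?thesis using inverse_unique by metis
      qed
      then show "inverse x \<in> {x \<in> L. ?f x = x}" using cl(5)[OF x(1)] by simp
    qed
    moreover have "r \<in> {x \<in> L. ?f x = x}" using fix_r[of 1 e] r by auto
    ultimately have "rat_adjoin {r} \<subseteq> {x \<in> L. ?f x = x}" by (intro rat_adjoin_least) auto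
    then show ?thesis using f unfolding galois_group_def by blast
  qed
  then have "{conj_map 1 1, conj_map 1 (- 1)} \<subseteq> galois_group L (rat_adjoin {r})" by simp
  ultimately show ?thesis by (rule equalityI)
qed

lemma generate_conj_map:
  assumes "e1 * e1 = 1" "e2 * e2 = 1"
  shows "generate (BijGroup L) {conj_map e1 e2} = {conj_map 1 1, conj_map e1 e2}"
proof -
  have "conj_map e1 e2 \<in> Bij L"
    using conj_map_galois[OF assms] unfolding galois_group_def by blast
  moreover have "compose L (conj_map e1 e2) (conj_map e1 e2) = (\<lambda>z\<in>L. z)"
    unfolding compose_def
  proof (rule restrict_ext)
    fix z assume "z \<in> L"
    then show "conj_map e1 e2 (conj_map e1 e2 z) = z"
      by (rule L_cases) (simp only: conj_map_lin conj_coords_involutive[OF assms])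
  qed
  ultimately show ?thesis using generate_involution conj_map_id by metis
qed

section \<open>The Hopf-Galois algebra in coordinates, and freeness\<close>

definition hopf_map :: "quad \<Rightarrow> complex \<Rightarrow> complex" where
  "hopf_map q = (\<lambda>z\<in>L. lin r s t (act a b q (coords z)))"

lemma hopf_map_lin [simp]: "hopf_map q (lin r s t x) = lin r s t (act a b q x)"
  unfolding hopf_map_def by simp

text \<open>On \<open>1, r\<close> and the plane, \<open>\<tau>\<close> is 1, 1 and -1, while
  \<open>\<sigma> + \<sigma>\<tau>\<close> is 2, -2 and 0. The last basis element kills
  \<open>1\<close> and \<open>r\<close>, and on the plane it is \<open>2 e J\<close>, with
  \<open>e\<close> the sign by which \<open>\<sigma>\<close> acts on \<open>s\<close>.\<close>

lemma hopf_basis_action: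
  assumes e: "e * e = 1"
  shows "(\<lambda>x\<in>L. of_rat A * x + of_rat B * conj_map 1 (- 1) x
      + of_rat C * (conj_map (- 1) e x + conj_map (- 1) e (conj_map 1 (- 1) x))
      + of_rat E * (r * (conj_map (- 1) e x - conj_map (- 1) e (conj_map 1 (- 1) x)))) =
    hopf_map (A + B + 2 * C, A + B - 2 * C, A - B, 2 * e * E)"
  unfolding hopf_map_def
proof (rule restrict_ext)
  fix z assume "z \<in> L"
  then obtain x1 x2 x3 x4 where z: "z = lin r s t (x1, x2, x3, x4)" by (rule L_cases)
  show "of_rat A * z + of_rat B * conj_map 1 (- 1) z
      + of_rat C * (conj_map (- 1) e z + conj_map (- 1) e (conj_map 1 (- 1) z))
      + of_rat E * (r * (conj_map (- 1) e z - conj_map (- 1) e (conj_map 1 (- 1) z))) =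
    lin r s t (act a b (A + B + 2 * C, A + B - 2 * C, A - B, 2 * e * E) (coords z))"
    unfolding z conj_map_lin conj_coords.simps coords_lin act.simps lin_add lin_diff lin_scale lin_mult_r
    by (rule arg_cong[of _ _ "lin r s t"]) (simp add: algebra_simps)
qed

text \<open>The identity generates too small a group, so \<open>\<tau>\<close> is forced. Then
  \<open>\<sigma>\<close> has to negate \<open>r\<close>, and its remaining sign \<open>e\<close> is
  absorbed by the last coefficient.\<close>

lemma hopf_galois_algebra_eq: "hopf_galois_algebra L r = range hopf_map"
proof
  show "hopf_galois_algebra L r \<subseteq> range hopf_map"
  proof
    fix h assume "h \<in> hopf_galois_algebra L r"
    then obtain \<tau> \<sigma> A B C E where gen: "generate (BijGroup L) {\<tau>} = galois_group L (rat_adjoin {r})"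
      and \<sigma>: "\<sigma> \<in> galois_group L \<rat> - generate (BijGroup L) {\<tau>}"
      and rat: "A \<in> \<rat>" "B \<in> \<rat>" "C \<in> \<rat>" "E \<in> \<rat>"
      and h: "h = (\<lambda>x\<in>L. A * x + B * \<tau> x + C * (\<sigma> x + \<sigma> (\<tau> x)) + E * (r * (\<sigma> x - \<sigma> (\<tau> x))))"
      unfolding hopf_galois_algebra_def by blast
    note gen' = gen[unfolded galois_group_over_r]
    have "\<tau> \<in> {conj_map 1 1, conj_map 1 (- 1)}"
      unfolding gen'[symmetric] by (rule generate.incl) simp
    moreover have "\<tau> \<noteq> conj_map 1 1"
    proof
      assume "\<tau> = conj_map 1 1"
      then have "generate (BijGroup L) {\<tau>} = {conj_map 1 1}" using generate_conj_map[of 1 1] by simp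
      then have "conj_map 1 (- 1) = conj_map 1 1" unfolding gen' by blast
      then show False unfolding conj_map_eq_iff by simp
    qed
    ultimately have \<tau>: "\<tau> = conj_map 1 (- 1)" by blast
    obtain e1 e where e: "e1 = 1 \<or> e1 = - 1" "e = 1 \<or> e = - 1" "\<sigma> = conj_map e1 e"
      using galois_cases \<sigma> by blast
    have "e1 \<noteq> 1" using \<sigma> e unfolding gen' by auto
    then have \<sigma>': "\<sigma> = conj_map (- 1) e" "e * e = 1" using e by auto
    obtain A' B' C' E' where "A = of_rat A'" "B = of_rat B'" "C = of_rat C'" "E = of_rat E'"
      using rat by (metis Rats_cases)
    then show "h \<in> range hopf_map"
      unfolding h \<tau> \<sigma>'(1) using hopf_basis_action[OF \<sigma>'(2)] by blast
  qed
  show "range hopf_map \<subseteq> hopf_galois_algebra L r"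
  proof
    fix h assume "h \<in> range hopf_map"
    then obtain p q u v where h: "h = hopf_map (p, q, u, v)" by (metis prod_cases4 rangeE)
    have gen: "generate (BijGroup L) {conj_map 1 (- 1)} = galois_group L (rat_adjoin {r})"
      using generate_conj_map[of 1 "- 1"] galois_group_over_r by simp
    moreover have "conj_map (- 1) 1 \<in> galois_group L \<rat> - generate (BijGroup L) {conj_map 1 (- 1)}"
      using conj_map_galois[of "- 1" 1] unfolding gen galois_group_over_r by (simp add: conj_map_eq_iff)
    \<comment> \<open>The coefficients solve \<open>A + B + 2 C = p\<close>,
      \<open>A + B - 2 C = q\<close>, \<open>A - B = u\<close>, \<open>2 E = v\<close>.\<close>
    moreover have "hopf_map (p, q, u, v) = (\<lambda>x\<in>L. of_rat ((p + q) / 4 + u / 2) * x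
        + of_rat ((p + q) / 4 - u / 2) * conj_map 1 (- 1) x
        + of_rat ((p - q) / 4) * (conj_map (- 1) 1 x + conj_map (- 1) 1 (conj_map 1 (- 1) x))
        + of_rat (v / 2) * (r * (conj_map (- 1) 1 x - conj_map (- 1) 1 (conj_map 1 (- 1) x))))"
      by (subst hopf_basis_action) (simp_all add: field_simps)
    ultimately show "h \<in> hopf_galois_algebra L r"
      unfolding hopf_galois_algebra_def h using Rats_of_rat by blast
  qed
qed

definition integral_coords :: "quad set" where
  "integral_coords = {x. algebraic_int (lin r s t x)}"

lemma algebraic_int_generators: "algebraic_int r" "algebraic_int s" "algebraic_int t"
proof -
  have "algebraic_int (of_int n :: complex)" for n by (rule int_imp_algebraic_int) simp
  then have "algebraic_int (r * r)" "algebraic_int (s * s)" "algebraic_int (t * t)"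
    unfolding squares by blast+
  then show "algebraic_int r" "algebraic_int s" "algebraic_int t"
    by (blast intro: algebraic_int_if_square)+
qed

lemma unit_integral_coords:
  "(1, 0, 0, 0) \<in> integral_coords" "(0, 1, 0, 0) \<in> integral_coords"
  "(0, 0, 1, 0) \<in> integral_coords" "(0, 0, 0, 1) \<in> integral_coords"
  using algebraic_int_generators unfolding integral_coords_def by (simp_all add: lin.simps)

lemma ring_of_integers_L: "ring_of_integers L = lin r s t ` integral_coords"
  unfolding ring_of_integers_def integral_coords_def by blast

lemma associated_order_eq:
  "associated_order L (hopf_galois_algebra L r) =
     hopf_map ` {q. \<forall>x\<in>integral_coords. act a b q x \<in> integral_coords}"
proof -
  have "(\<forall>z\<in>lin r s t ` integral_coords. hopf_map q z \<in> lin r s t ` integral_coords) \<longleftrightarrow>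
      (\<forall>x\<in>integral_coords. act a b q x \<in> integral_coords)" for q
    by (simp only: ball_simps(9) hopf_map_lin inj_image_mem_iff[OF inj_lin])
  then show ?thesis
    unfolding associated_order_def hopf_galois_algebra_eq ring_of_integers_L by blast
qed

text \<open>Surjectivity of evaluation at a generator is cyclicity read through \<open>lin\<close>.
  Injectivity is automatic because \<open>1, r, s, t\<close> are integral and so lie in the orbit of
  the generator.\<close>

lemma free_iff_cyclic:
  "free_of_rank_one (associated_order L (hopf_galois_algebra L r)) (ring_of_integers L) \<longleftrightarrow>
     cyclic a b integral_coords"
proof
  assume "free_of_rank_one (associated_order L (hopf_galois_algebra L r)) (ring_of_integers L)"
  then obtain x where x: "x \<in> integral_coords" and
    bij: "bij_betw (\<lambda>h. h (lin r s t x)) (associated_order L (hopf_galois_algebra L r)) (ring_of_integers L)"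
    unfolding free_of_rank_one_def ring_of_integers_L by blast
  have "\<exists>q. (\<forall>z\<in>integral_coords. act a b q z \<in> integral_coords) \<and> act a b q x = y"
    if y: "y \<in> integral_coords" for y
  proof -
    have "lin r s t y \<in> (\<lambda>h. h (lin r s t x)) ` associated_order L (hopf_galois_algebra L r)"
      using bij_betw_imp_surj_on[OF bij] y ring_of_integers_L by blast
    then obtain q where "\<forall>z\<in>integral_coords. act a b q z \<in> integral_coords"
      "lin r s t y = hopf_map q (lin r s t x)"
      unfolding associated_order_eq by blast
    moreover from this have "y = act a b q x" by (intro lin_injective) simp
    ultimately show ?thesis by blast
  qed
  with x show "cyclic a b integral_coords" unfolding cyclic_def by blast
next
  assume "cyclic a b integral_coords"
  then obtain x where x: "x \<in> integral_coords" and
    surj: "\<And>y. y \<in> integral_coords \<Longrightarrow>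
      \<exists>q. (\<forall>z\<in>integral_coords. act a b q z \<in> integral_coords) \<and> act a b q x = y"
    unfolding cyclic_def by blast
  obtain q1 where q1: "act a b q1 x = (1, 0, 0, 0)" using surj[OF unit_integral_coords(1)] by blast
  obtain q2 where q2: "act a b q2 x = (0, 1, 0, 0)" using surj[OF unit_integral_coords(2)] by blast
  obtain q3 where q3: "act a b q3 x = (0, 0, 1, 0)" using surj[OF unit_integral_coords(3)] by blast
  obtain q4 where q4: "act a b q4 x = (0, 0, 0, 1)" using surj[OF unit_integral_coords(4)] by blast
  note inj = act_injective[OF q1 q2 q3 q4]
  have "bij_betw (\<lambda>h. h (lin r s t x)) (associated_order L (hopf_galois_algebra L r)) (ring_of_integers L)"
    unfolding bij_betw_def
  proof
    show "inj_on (\<lambda>h. h (lin r s t x)) (associated_order L (hopf_galois_algebra L r))"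
    proof (rule inj_onI)
      fix h h' assume "h \<in> associated_order L (hopf_galois_algebra L r)"
        "h' \<in> associated_order L (hopf_galois_algebra L r)" and eq: "h (lin r s t x) = h' (lin r s t x)"
      then obtain q q' where h: "h = hopf_map q" "h' = hopf_map q'" unfolding associated_order_eq by blast
      from eq have "act a b q x = act a b q' x" unfolding h hopf_map_lin by (rule lin_injective)
      then show "h = h'" using inj h by blast
    qed
    show "(\<lambda>h. h (lin r s t x)) ` associated_order L (hopf_galois_algebra L r) = ring_of_integers L"
    proof
      show "(\<lambda>h. h (lin r s t x)) ` associated_order L (hopf_galois_algebra L r) \<subseteq> ring_of_integers L"
        unfolding associated_order_eq ring_of_integers_L using x by auto
      show "ring_of_integers L \<subseteq> (\<lambda>h. h (lin r s t x)) ` associated_order L (hopf_galois_algebra L r)"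
      proof
        fix z assume "z \<in> ring_of_integers L"
        then obtain y where y: "z = lin r s t y" "y \<in> integral_coords" unfolding ring_of_integers_L by blast
        obtain q where "\<forall>z\<in>integral_coords. act a b q z \<in> integral_coords" "act a b q x = y"
          using surj[OF y(2)] by blast
        then have "hopf_map q \<in> associated_order L (hopf_galois_algebra L r)" "hopf_map q (lin r s t x) = z"
          unfolding associated_order_eq using y by auto
        then show "z \<in> (\<lambda>h. h (lin r s t x)) ` associated_order L (hopf_galois_algebra L r)" by blast
      qed
    qed
  qed
  then show "free_of_rank_one (associated_order L (hopf_galois_algebra L r)) (ring_of_integers L)"
    unfolding free_of_rank_one_def ring_of_integers_L using x by blast
qed

end

subsection \<open>Rings of integers of biquadratic fields\<close>

lemma square_mod4: "(x::int)\<^sup>2 mod 4 = (if even x then 0 else 1)"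
proof -
  have "x mod 4 = 0 \<or> x mod 4 = 1 \<or> x mod 4 = 2 \<or> x mod 4 = 3" by presburger
  moreover have "even x \<longleftrightarrow> x mod 4 = 0 \<or> x mod 4 = 2" by presburger
  ultimately show ?thesis using power_mod[of x 4 2] by auto
qed

lemma dvd4_norm_parity:
  fixes u v D :: int
  assumes "4 dvd u\<^sup>2 - D * v\<^sup>2"
  shows "D mod 4 = 1 \<Longrightarrow> even (u - v)"
    and "D mod 4 = 2 \<or> D mod 4 = 3 \<Longrightarrow> even u \<and> even v"
    and "D mod 4 \<noteq> 0 \<Longrightarrow> even u \<Longrightarrow> even v"
proof -
  have "u\<^sup>2 mod 4 = (D mod 4) * (v\<^sup>2 mod 4) mod 4"
    using assms by (metis mod_eq_dvd_iff mod_mult_eq)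
  then have *: "(if even u then 0 else 1) = (D mod 4) * (if even v then 0 else 1) mod 4"
    unfolding square_mod4 .
  show "D mod 4 = 1 \<Longrightarrow> even (u - v)" using * by (auto split: if_splits)
  show "D mod 4 = 2 \<or> D mod 4 = 3 \<Longrightarrow> even u \<and> even v" using * by (auto split: if_splits)
  show "D mod 4 \<noteq> 0 \<Longrightarrow> even u \<Longrightarrow> even v" using * by (auto split: if_splits)
qed

lemma squarefree_mod4:
  assumes "squarefree (D :: int)"
  shows "D mod 4 \<noteq> 0"
proof
  assume "D mod 4 = 0"
  then have "2\<^sup>2 dvd D" by (simp add: dvd_eq_mod_eq_0)
  then have "(2::int) dvd 1" using squarefreeD[OF assms] by blast
  then show False by simp
qed

text \<open>The square of the reduced denominator of \<open>w\<close> would divide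
  \<open>D\<close>.\<close>

lemma squarefree_mult_square_Ints:
  fixes w :: rat
  assumes sqf: "squarefree D" and int: "of_int D * w\<^sup>2 \<in> \<int>"
  shows "w \<in> \<int>"
proof -
  obtain p q where w: "w = of_int p / of_int q" "q > 0" "coprime p q"
    by (metis quotient_of_coprime quotient_of_denom_pos quotient_of_div surj_pair)
  obtain n where n: "of_int D * w\<^sup>2 = of_int n" using int by (elim Ints_cases)
  have "rat_of_int (D * p\<^sup>2) = of_int (n * q\<^sup>2)"
    using n w(2) unfolding w(1) by (simp add: field_simps)
  then have "D * p\<^sup>2 = n * q\<^sup>2" unfolding of_int_eq_iff .
  then have "q\<^sup>2 dvd D * p\<^sup>2" by simp
  moreover have "coprime (q\<^sup>2) (p\<^sup>2)" using w(3) by (simp add: coprime_commute)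
  ultimately have "q\<^sup>2 dvd D" by (simp add: coprime_dvd_mult_left_iff)
  then have "q dvd 1" using squarefreeD[OF sqf] by blast
  then have "q = 1" using w(2) by simp
  then show ?thesis unfolding w(1) by simp
qed

lemma algebraic_int_of_rat:
  assumes "algebraic_int (of_rat q :: complex)"
  shows "q \<in> \<int>"
proof -
  have "of_rat q \<in> (\<int> :: complex set)" by (rule rational_algebraic_int_is_int[OF assms]) simp
  then obtain n where "(of_rat q :: complex) = of_int n" by (elim Ints_cases)
  then have "(of_rat q :: complex) = of_rat (of_int n)" by simp
  then have "q = of_int n" unfolding of_rat_eq_iff .
  then show ?thesis by simp
qed

lemma algebraic_int_of_int: "algebraic_int (of_int n :: complex)"
  by (rule int_imp_algebraic_int) simp

text \<open>The sum of the two conjugates makes \<open>2 u\<close> an integer and their product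
  makes the norm one; together these make \<open>D (2 v)^2\<close> integral, and \<open>D\<close> is
  square-free.\<close>

lemma quadratic_integer:
  fixes w :: complex
  assumes alg: "algebraic_int (of_rat u + of_rat v * w)" "algebraic_int (of_rat u - of_rat v * w)"
    and w: "w * w = of_int D" and sqf: "squarefree D"
  obtains U V where "u = of_int U / 2" "v = of_int V / 2" "4 dvd U\<^sup>2 - D * V\<^sup>2"
proof -
  have "(of_rat u + of_rat v * w) + (of_rat u - of_rat v * w) = of_rat (2 * u)"
    by (simp add: of_rat_mult)
  then have "algebraic_int (of_rat (2 * u) :: complex)" using algebraic_int_add[OF alg] by metis
  then obtain U where U: "2 * u = of_int U" using algebraic_int_of_rat by (metis Ints_cases)
  have "(of_rat u + of_rat v * w) * (of_rat u - of_rat v * w) =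
      of_rat u * of_rat u - of_rat v * of_rat v * (w * w)" by (simp add: algebra_simps)
  also have "\<dots> = of_rat (u\<^sup>2 - of_int D * v\<^sup>2)"
    unfolding w by (simp add: of_rat_diff of_rat_mult power2_eq_square)
  finally have "algebraic_int (of_rat (u\<^sup>2 - of_int D * v\<^sup>2) :: complex)"
    using algebraic_int_mult[OF alg] by metis
  then obtain N where N: "u\<^sup>2 - of_int D * v\<^sup>2 = of_int N" using algebraic_int_of_rat by (metis Ints_cases)
  have "of_int D * (2 * v)\<^sup>2 = (2 * u)\<^sup>2 - 4 * (u\<^sup>2 - of_int D * v\<^sup>2)"
    by (simp add: algebra_simps power_mult_distrib)
  also have "\<dots> = of_int (U\<^sup>2 - 4 * N)" unfolding U N by simp
  finally have "2 * v \<in> \<int>" using squarefree_mult_square_Ints[OF sqf] by (metis Ints_of_int)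
  then obtain V where V: "2 * v = of_int V" by (elim Ints_cases)
  have "rat_of_int (U\<^sup>2 - D * V\<^sup>2) = of_int (4 * N)"
    using N unfolding of_int_diff of_int_mult of_int_power U[symmetric] V[symmetric]
    by (simp add: algebra_simps power_mult_distrib)
  then have "U\<^sup>2 - D * V\<^sup>2 = 4 * N" unfolding of_int_eq_iff .
  then have "4 dvd U\<^sup>2 - D * V\<^sup>2" by simp
  moreover have "u = of_int U / 2" "v = of_int V / 2" using U V by simp_all
  ultimately show ?thesis using that by blast
qed

lemma algebraic_int_half:
  assumes "w * w = of_int D" "D mod 4 = 1"
  shows "algebraic_int ((1 + w) / 2 :: complex)"
proof -
  define k where "k = D div 4"
  have D: "D = 4 * k + 1" using assms(2) unfolding k_def by presburger
  \<comment> \<open>With \<open>D = 4 k + 1\<close> the number is a root of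
    \<open>X^2 - X - k\<close>.\<close>
  have "((1 + w) / 2) * ((1 + w) / 2) - (1 + w) / 2 = of_int k"
    using assms(1) unfolding D by (simp add: field_simps)
  then have "poly [:- of_int k, - 1, 1:] ((1 + w) / 2) = 0" by (simp add: algebra_simps)
  moreover have "\<forall>i. coeff [:- of_int k, - 1, 1:] i \<in> (\<int> :: complex set)"
    by (simp add: coeff_pCons split: nat.splits)
  ultimately show ?thesis by (intro algebraic_int.intros[of "[:- of_int k, - 1, 1:]"]) simp_all
qed

context biquadratic_frame
begin

text \<open>The witness \<open>z\<close> holds the coordinates of the polynomial's value, so that
  one Horner step can be carried out in \<open>L\<close> and conjugated at the same time.\<close>

lemma poly_conj_coords:
  "\<exists>z. poly (map_poly of_int p) (lin r s t x) = lin r s t z \<and>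
       poly (map_poly of_int p) (lin r s t (conj_coords e1 e2 x)) = lin r s t (conj_coords e1 e2 z)"
  if e: "e1 * e1 = 1" "e2 * e2 = 1"
proof (induction p)
  case 0
  have "lin r s t (0, 0, 0, 0) = 0" by (simp add: lin.simps)
  then show ?case by (intro exI[of _ "(0, 0, 0, 0)"]) simp
next
  case (pCons k p)
  then obtain z where z: "poly (map_poly of_int p) (lin r s t x) = lin r s t z"
     "poly (map_poly of_int p) (lin r s t (conj_coords e1 e2 x)) = lin r s t (conj_coords e1 e2 z)" by blast
  have hom: "conj_map e1 e2 (u + v) = conj_map e1 e2 u + conj_map e1 e2 v"
     "conj_map e1 e2 (u * v) = conj_map e1 e2 u * conj_map e1 e2 v" if "u \<in> L" "v \<in> L" for u v
    using conj_map_galois[OF e] that unfolding galois_group_def by blast+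
  note cl = subfield_setD[OF subfield_L]
  have k: "of_int k \<in> L" by (rule cl(1)) simp
  have xz: "lin r s t x \<in> L" "lin r s t z \<in> L" by blast+
  have kc: "conj_map e1 e2 (of_int k) = of_int k"
    using conj_map_galois[OF e] unfolding galois_group_def by simp
  obtain y where y: "of_int k + lin r s t x * lin r s t z = lin r s t y"
    using cl(2)[OF k cl(3)[OF xz]] by blast
  have "lin r s t (conj_coords e1 e2 y) = conj_map e1 e2 (lin r s t y)" by simp
  also have "\<dots> = of_int k + lin r s t (conj_coords e1 e2 x) * lin r s t (conj_coords e1 e2 z)"
    unfolding y[symmetric] hom(1)[OF k cl(3)[OF xz]] hom(2)[OF xz] kc conj_map_lin ..
  finally have cy: "lin r s t (conj_coords e1 e2 y) = \<dots>" .
  have p: "map_poly of_int (pCons k p) = pCons (of_int k) (map_poly of_int p :: complex poly)"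
    by (rule map_poly_pCons) (use pCons.hyps in blast)
  show ?case unfolding p using y z cy by (intro exI[of _ y]) simp
qed

lemma algebraic_int_conj_coords:
  assumes e: "e1 * e1 = 1" "e2 * e2 = 1" and x: "algebraic_int (lin r s t x)"
  shows "algebraic_int (lin r s t (conj_coords e1 e2 x))"
proof -
  obtain p where p: "poly (map_poly of_int p) (lin r s t x) = 0" "lead_coeff p = 1"
    using x unfolding algebraic_int_altdef_ipoly by blast
  obtain z where z: "poly (map_poly of_int p) (lin r s t x) = lin r s t z"
     "poly (map_poly of_int p) (lin r s t (conj_coords e1 e2 x)) = lin r s t (conj_coords e1 e2 z)"
    using poly_conj_coords[OF e] by blast
  have "lin r s t z = 0" using z p by simp
  then have "z = (0, 0, 0, 0)" by (rule indep)
  then have "lin r s t (conj_coords e1 e2 z) = 0" by (simp add: lin.simps)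
  then show ?thesis unfolding algebraic_int_altdef_ipoly using z p by metis
qed

text \<open>Adding a conjugate to the integer gives its trace to one of the three quadratic
  subfields, such as \<open>2 x1 + 2 x2 r\<close>. This trace is a quadratic integer with halves,
  hence the denominators 4; the three numerators obtained for \<open>x1\<close> coincide.\<close>

lemma quarter_coords:
  assumes x: "x \<in> integral_coords"
  obtains X1 X2 X3 X4 where
    "x = (of_int X1 / 4, of_int X2 / 4, of_int X3 / 4, of_int X4 / 4)"
    "4 dvd X1\<^sup>2 - (a * b) * X2\<^sup>2" "4 dvd X1\<^sup>2 - (a * c) * X3\<^sup>2" "4 dvd X1\<^sup>2 - (b * c) * X4\<^sup>2"
proof -
  obtain x1 x2 x3 x4 where xe: "x = (x1, x2, x3, x4)" by (cases x)
  have alg: "algebraic_int (lin r s t (x1, e1 * x2, e2 * x3, e1 * e2 * x4))"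
    if "e1 * e1 = 1" "e2 * e2 = 1" for e1 e2
    using algebraic_int_conj_coords[OF that, of x] x unfolding integral_coords_def xe by simp
  note A = alg[of 1 1, simplified] alg[of 1 "- 1", simplified]
    alg[of "- 1" 1, simplified] alg[of "- 1" "- 1", simplified]
  have "algebraic_int (of_rat (2 * x1) + of_rat (2 * x2) * r)"
    using algebraic_int_add[OF A(1,2)] by (simp add: lin.simps of_rat_mult of_rat_minus algebra_simps)
  moreover have "algebraic_int (of_rat (2 * x1) - of_rat (2 * x2) * r)"
    using algebraic_int_add[OF A(3,4)] by (simp add: lin.simps of_rat_mult of_rat_minus algebra_simps)
  ultimately obtain X1 X2 where 1: "2 * x1 = of_int X1 / 2" "2 * x2 = of_int X2 / 2"
      "4 dvd X1\<^sup>2 - (a * b) * X2\<^sup>2"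
    using quadratic_integer[OF _ _ squares(1) sqf(1)] by blast
  have "algebraic_int (of_rat (2 * x1) + of_rat (2 * x3) * s)"
    using algebraic_int_add[OF A(1,3)] by (simp add: lin.simps of_rat_mult of_rat_minus algebra_simps)
  moreover have "algebraic_int (of_rat (2 * x1) - of_rat (2 * x3) * s)"
    using algebraic_int_add[OF A(2,4)] by (simp add: lin.simps of_rat_mult of_rat_minus algebra_simps)
  ultimately obtain X1' X3 where 2: "2 * x1 = of_int X1' / 2" "2 * x3 = of_int X3 / 2"
      "4 dvd X1'\<^sup>2 - (a * c) * X3\<^sup>2"
    using quadratic_integer[OF _ _ squares(2) sqf(2)] by blast
  have "algebraic_int (of_rat (2 * x1) + of_rat (2 * x4) * t)"
    using algebraic_int_add[OF A(1,4)] by (simp add: lin.simps of_rat_mult of_rat_minus algebra_simps)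
  moreover have "algebraic_int (of_rat (2 * x1) - of_rat (2 * x4) * t)"
    using algebraic_int_add[OF A(2,3)] by (simp add: lin.simps of_rat_mult of_rat_minus algebra_simps)
  ultimately obtain X1'' X4 where 3: "2 * x1 = of_int X1'' / 2" "2 * x4 = of_int X4 / 2"
      "4 dvd X1''\<^sup>2 - (b * c) * X4\<^sup>2"
    using quadratic_integer[OF _ _ squares(3) sqf(3)] by blast
  have "X1' = X1" "X1'' = X1" using 1(1) 2(1) 3(1) by simp_all
  moreover have "x = (of_int X1 / 4, of_int X2 / 4, of_int X3 / 4, of_int X4 / 4)"
    unfolding xe using 1(1,2) 2(2) 3(2) by simp
  ultimately show ?thesis using that 1(3) 2(3) 3(3) by blast
qed

section \<open>The lattice of integral coordinates in the three cases\<close>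

lemma integral_coords_add:
  assumes "(x1, x2, x3, x4) \<in> integral_coords" "(y1, y2, y3, y4) \<in> integral_coords"
  shows "(x1 + y1, x2 + y2, x3 + y3, x4 + y4) \<in> integral_coords"
  using algebraic_int_add assms unfolding integral_coords_def mem_Collect_eq lin_add[symmetric] by blast

lemma integral_coords_mult:
  assumes "(x1, x2, x3, x4) \<in> integral_coords" "(y1, y2, y3, y4) \<in> integral_coords"
  shows "(x1 * y1 + of_int (a * b) * x2 * y2 + of_int (a * c) * x3 * y3 + of_int (b * c) * x4 * y4,
       x1 * y2 + x2 * y1 + of_int c * (x3 * y4 + x4 * y3),
       x1 * y3 + x3 * y1 + of_int b * (x2 * y4 + x4 * y2),
       x1 * y4 + x4 * y1 + of_int a * (x2 * y3 + x3 * y2)) \<in> integral_coords"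
proof -
  have "algebraic_int (lin r s t (x1, x2, x3, x4) * lin r s t (y1, y2, y3, y4))"
    using assms unfolding integral_coords_def mem_Collect_eq by (rule algebraic_int_mult)
  then show ?thesis unfolding lin_mult integral_coords_def mem_Collect_eq .
qed

lemma integral_coords_scale:
  assumes "(x1, x2, x3, x4) \<in> integral_coords"
  shows "(of_int k * x1, of_int k * x2, of_int k * x3, of_int k * x4) \<in> integral_coords"
  using algebraic_int_mult[OF algebraic_int_of_int[of k]] assms lin_scale[of "of_int k" x1 x2 x3 x4]
  unfolding integral_coords_def by (metis mem_Collect_eq of_rat_of_int_eq)

lemma integral_coords_conj_coords:
  assumes "e1 * e1 = 1" "e2 * e2 = 1" "x \<in> integral_coords"
  shows "conj_coords e1 e2 x \<in> integral_coords"
  using algebraic_int_conj_coords[OF assms(1,2)] assms(3) unfolding integral_coords_def by simp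

lemma integral_coords_eqI: "x \<in> integral_coords \<Longrightarrow> x = y \<Longrightarrow> y \<in> integral_coords"
  by simp

lemma integral_coords_combination:
  assumes "(x1, x2, x3, x4) \<in> integral_coords" "(y1, y2, y3, y4) \<in> integral_coords"
    and "(z1, z2, z3, z4) \<in> integral_coords"
  shows "(of_int k + of_int l * x1 + of_int m * y1 + of_int n * z1,
      of_int l * x2 + of_int m * y2 + of_int n * z2,
      of_int l * x3 + of_int m * y3 + of_int n * z3,
      of_int l * x4 + of_int m * y4 + of_int n * z4) \<in> integral_coords"
proof -
  have "(of_int k * 1, of_int k * 0, of_int k * 0, of_int k * 0) \<in> integral_coords"
    by (rule integral_coords_scale[OF unit_integral_coords(1)])
  from integral_coords_add[OF integral_coords_add[OF integral_coords_add[OF this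
      integral_coords_scale[OF assms(1), of l]] integral_coords_scale[OF assms(2), of m]]
      integral_coords_scale[OF assms(3), of n]]
  show ?thesis by simp
qed

lemma rational_integral_coords: "(q, 0, 0, 0) \<in> integral_coords \<Longrightarrow> q \<in> \<int>"
  using algebraic_int_of_rat unfolding integral_coords_def mem_Collect_eq of_rat_lin[symmetric] by blast

lemma half_r_integral:
  assumes "a * b mod 4 = 1"
  shows "(1 / 2, 1 / 2, 0, 0) \<in> integral_coords"
  using algebraic_int_half[OF squares(1) assms]
  unfolding integral_coords_def by (simp add: lin.simps of_rat_divide add_divide_distrib)

lemma half_s_integral:
  assumes "a * c mod 4 = 1"
  shows "(1 / 2, 0, 1 / 2, 0) \<in> integral_coords"
  using algebraic_int_half[OF squares(2) assms]
  unfolding integral_coords_def by (simp add: lin.simps of_rat_divide add_divide_distrib)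

text \<open>An integral basis is \<open>1\<close>, \<open>(1 + r) / 2\<close>,
  \<open>(1 + s) / 2\<close> and \<open>w = (1 + r + s + t) / 4\<close>. The last is the product of
  the two halves, \<open>(1 + r + s + a t) / 4\<close>, corrected by a multiple of \<open>t\<close>
  since \<open>a \<equiv> 1\<close> mod 4.\<close>

lemma integral_coords_lattice1:
  assumes "a mod 4 = 1" "b mod 4 = 1" "c mod 4 = 1"
  shows "integral_coords = lattice1"
proof -
  have ab: "a * b mod 4 = 1" "a * c mod 4 = 1" "b * c mod 4 = 1"
    using assms by (simp_all add: mult_mod4)
  note hr = half_r_integral[OF ab(1)] and hs = half_s_integral[OF ab(2)]
  have w: "(1 / 4, 1 / 4, 1 / 4, 1 / 4) \<in> integral_coords"
  proof -
    obtain k where k: "a = 1 + 4 * k" using assms(1) by (metis add.commute mult.commute div_mult_mod_eq)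
    have p: "(1 / 4, 1 / 4, 1 / 4, of_int a / 4) \<in> integral_coords"
      by (rule integral_coords_eqI[OF integral_coords_mult[OF hr hs]], simp only: prod.inject, intro conjI) simp_all
    show ?thesis
      by (rule integral_coords_eqI[OF integral_coords_add[OF p
              integral_coords_scale[OF unit_integral_coords(4), of "- k"]]])
        (simp only: prod.inject, intro conjI; simp add: k add_divide_distrib)
  qed
  show ?thesis
  proof
    show "integral_coords \<subseteq> lattice1"
    proof
      fix x assume x: "x \<in> integral_coords"
      then obtain X1 X2 X3 X4 where xe: "x = (of_int X1 / 4, of_int X2 / 4, of_int X3 / 4, of_int X4 / 4)"
        and d: "4 dvd X1\<^sup>2 - (a * b) * X2\<^sup>2" "4 dvd X1\<^sup>2 - (a * c) * X3\<^sup>2" "4 dvd X1\<^sup>2 - (b * c) * X4\<^sup>2"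
        by (rule quarter_coords)
      have par: "even (X1 - X2)" "even (X1 - X3)" "even (X1 - X4)"
        using dvd4_norm_parity(1)[OF d(1) ab(1)] dvd4_norm_parity(1)[OF d(2) ab(2)]
          dvd4_norm_parity(1)[OF d(3) ab(3)] by blast+
      then have "even (X4 - X2)" "even (X4 - X3)" by presburger+
      then obtain p q where p: "X2 = X4 + 2 * p" and q: "X3 = X4 + 2 * q"
        using even_diffE[of X4 X2] even_diffE[of X4 X3] by metis
      \<comment> \<open>Subtracting \<open>X4\<close> times \<open>w\<close> and then
        \<open>p\<close>, \<open>q\<close> times the two halves leaves a rational number; its
        integrality is the condition mod 4.\<close>
      have "(of_int (X1 - 2 * p - 2 * q - X4) / 4, 0, 0, 0) \<in> integral_coords"
        by (rule integral_coords_eqI[OF integral_coords_add[OF x[unfolded xe]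
              integral_coords_combination[OF w hr hs, of 0 "- X4" "- p" "- q"]]])
          (simp only: prod.inject, intro conjI; simp add: p q field_simps)
      then have "rat_of_int (X1 - 2 * p - 2 * q - X4) / 4 \<in> \<int>" by (rule rational_integral_coords)
      then obtain n where "rat_of_int (X1 - 2 * p - 2 * q - X4) / 4 = of_int n" by (elim Ints_cases)
      then have "rat_of_int (X1 - 2 * p - 2 * q - X4) = of_int (4 * n)" by simp
      then have "X1 - 2 * p - 2 * q - X4 = 4 * n" unfolding of_int_eq_iff .
      then have "4 dvd X1 + X2 + X3 + X4" unfolding p q by presburger
      then show "x \<in> lattice1" unfolding xe lattice1_iff using par by blast
    qed
    show "lattice1 \<subseteq> integral_coords"
    proof
      fix x assume "x \<in> lattice1"
      then obtain X1 X2 X3 X4 where xe: "x = (of_int X1 / 4, of_int X2 / 4, of_int X3 / 4, of_int X4 / 4)"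
        and d: "even (X1 - X2)" "even (X1 - X3)" "even (X1 - X4)" "4 dvd X1 + X2 + X3 + X4"
        unfolding lattice1_def by blast
      then have "even (X4 - X2)" "even (X4 - X3)" by presburger+
      then obtain p q where p: "X2 = X4 + 2 * p" and q: "X3 = X4 + 2 * q"
        using even_diffE[of X4 X2] even_diffE[of X4 X3] by metis
      have "4 dvd X1 - 2 * p - 2 * q - X4" using d(3,4) unfolding p q by presburger
      then obtain n where "X1 - 2 * p - 2 * q - X4 = 4 * n" by (elim dvdE)
      then have n: "X1 = 4 * n + 2 * p + 2 * q + X4" by simp
      show "x \<in> integral_coords"
        unfolding xe p q n
        by (rule integral_coords_eqI[OF integral_coords_combination[OF w hr hs, of n X4 p q]])
          (simp only: prod.inject, intro conjI; simp add: add_divide_distrib)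
    qed
  qed
qed

lemma half_s_coords:
  assumes "(of_int p / 2, 0, of_int q / 2, 0) \<in> integral_coords"
    and ac: "a * c mod 4 = 2 \<or> a * c mod 4 = 3"
  shows "even p \<and> even q"
proof -
  have alg: "algebraic_int (lin r s t (of_int p / 2, 0, of_int q / 2, 0))"
    using assms(1) unfolding integral_coords_def by simp
  then have "algebraic_int (lin r s t (conj_coords 1 (- 1) (of_int p / 2, 0, of_int q / 2, 0)))"
    by (intro algebraic_int_conj_coords) simp_all
  with alg have "algebraic_int (of_rat (of_int p / 2) + of_rat (of_int q / 2) * s)"
    "algebraic_int (of_rat (of_int p / 2) - of_rat (of_int q / 2) * s)"
    by (simp_all add: lin.simps of_rat_minus)
  then obtain u v where "rat_of_int p / 2 = of_int u / 2" "rat_of_int q / 2 = of_int v / 2"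
      "4 dvd u\<^sup>2 - (a * c) * v\<^sup>2"
    using quadratic_integer[OF _ _ squares(2) sqf(2)] by blast
  then have "4 dvd p\<^sup>2 - (a * c) * q\<^sup>2" by simp
  then show ?thesis using dvd4_norm_parity(2) ac by blast
qed

text \<open>Multiplying \<open>(1 + r) / 2\<close> by \<open>s\<close> gives
  \<open>(s + a t) / 2\<close>, and \<open>a\<close> is odd, so \<open>(s + t) / 2\<close> is
  integral. Modulo this and \<open>(1 + r) / 2\<close> an integer reduces to the subfield generated
  by \<open>s\<close>, where no halves survive.\<close>

lemma integral_coords_lattice2r:
  assumes ab: "a * b mod 4 = 1" and ac: "a * c mod 4 \<noteq> 1"
  shows "integral_coords = lattice2r"
proof -
  note hr = half_r_integral[OF ab]
  have ac': "a * c mod 4 = 2 \<or> a * c mod 4 = 3" using ac squarefree_mod4[OF sqf(2)] by presburger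
  have w: "(0, 0, 1 / 2, 1 / 2) \<in> integral_coords"
  proof -
    have "odd a" using mult_mod4_eq_1D[OF ab] by blast
    then obtain k where k: "a = 1 + 2 * k" by (metis add.commute oddE)
    have p: "(0, 0, 1 / 2, of_int a / 2) \<in> integral_coords"
      by (rule integral_coords_eqI[OF integral_coords_mult[OF hr unit_integral_coords(3)]]) simp
    show ?thesis
      by (rule integral_coords_eqI[OF integral_coords_add[OF p
              integral_coords_scale[OF unit_integral_coords(4), of "- k"]]])
        (simp only: prod.inject, intro conjI; simp add: k add_divide_distrib)
  qed
  show ?thesis
  proof
    show "integral_coords \<subseteq> lattice2r"
    proof
      fix x assume x: "x \<in> integral_coords"
      then obtain X1 X2 X3 X4 where xe: "x = (of_int X1 / 4, of_int X2 / 4, of_int X3 / 4, of_int X4 / 4)"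
        and d: "4 dvd X1\<^sup>2 - (a * b) * X2\<^sup>2" "4 dvd X1\<^sup>2 - (a * c) * X3\<^sup>2" "4 dvd X1\<^sup>2 - (b * c) * X4\<^sup>2"
        by (rule quarter_coords)
      have "even X1" "even X3" using dvd4_norm_parity(2)[OF d(2) ac'] by blast+
      moreover from this have "even X2" using dvd4_norm_parity(1)[OF d(1) ab] by simp
      moreover have "even X4" using dvd4_norm_parity(3)[OF d(3) squarefree_mod4[OF sqf(3)]] \<open>even X1\<close> by blast
      ultimately obtain Y1 Y2 Y3 Y4 where "X1 = 2 * Y1" "X2 = 2 * Y2" "X3 = 2 * Y3" "X4 = 2 * Y4"
        by (elim evenE)
      then have xe': "x = (of_int Y1 / 2, of_int Y2 / 2, of_int Y3 / 2, of_int Y4 / 2)"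
        unfolding xe by simp
      have "(of_int (Y1 - Y2) / 2, 0, of_int (Y3 - Y4) / 2, 0) \<in> integral_coords"
        by (rule integral_coords_eqI[OF integral_coords_add[OF x[unfolded xe']
              integral_coords_combination[OF w hr hr, of 0 "- Y4" "- Y2" 0]]])
          (simp only: prod.inject, intro conjI; simp add: field_simps)
      then have "even (Y1 - Y2) \<and> even (Y3 - Y4)" using half_s_coords[OF _ ac'] by blast
      then show "x \<in> lattice2r" unfolding xe' lattice2r_iff .
    qed
    show "lattice2r \<subseteq> integral_coords"
    proof
      fix x assume "x \<in> lattice2r"
      then obtain X1 X2 X3 X4 where xe: "x = (of_int X1 / 2, of_int X2 / 2, of_int X3 / 2, of_int X4 / 2)"
        and d: "even (X1 - X2)" "even (X3 - X4)"
        unfolding lattice2r_def by blast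
      have "even (X2 - X1)" "even (X4 - X3)" using d by presburger+
      then obtain p q where p: "X1 = X2 + 2 * p" and q: "X3 = X4 + 2 * q"
        using even_diffE[of X2 X1] even_diffE[of X4 X3] by metis
      show "x \<in> integral_coords"
        unfolding xe p q
        by (rule integral_coords_eqI[OF
              integral_coords_combination[OF w hr unit_integral_coords(3), of p X4 X2 q]])
          (simp only: prod.inject, intro conjI; simp add: add_divide_distrib)
    qed
  qed
qed

text \<open>The norm to the subfield generated by \<open>r\<close> is
  \<open>D / 4 + (p q / 2) r\<close>. As \<open>a b\<close> is 3 mod 4, both coefficients are
  integers: \<open>p q\<close> is even and \<open>p^2 + 3 q^2 - 2 u^2\<close> is divisible by 4,
  which leaves only even values.\<close>

lemma half_rs_coords:
  assumes x: "(of_int p / 2, of_int q / 2, of_int u / 2, 0) \<in> integral_coords"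
    and ab: "a * b mod 4 = 3" and ac: "a * c mod 4 = 2"
  shows "even p \<and> even q \<and> even u"
proof -
  define D where "D = p\<^sup>2 + a * b * q\<^sup>2 - a * c * u\<^sup>2"
  define n where "n = p * q"
  have "conj_coords 1 (- 1) (of_int p / 2, of_int q / 2, of_int u / 2, 0) \<in> integral_coords"
    by (rule integral_coords_conj_coords[OF _ _ x]) simp_all
  then have x': "(of_int p / 2, of_int q / 2, - (of_int u / 2), 0) \<in> integral_coords" by simp
  have z: "(of_int D / 4, of_int n / 2, 0, 0) \<in> integral_coords"
    by (rule integral_coords_eqI[OF integral_coords_mult[OF x x']], simp only: prod.inject, intro conjI;
        simp add: D_def n_def field_simps power2_eq_square)
  have "conj_coords (- 1) 1 (of_int D / 4, of_int n / 2, 0, 0) \<in> integral_coords"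
    by (rule integral_coords_conj_coords[OF _ _ z]) simp_all
  with z have "algebraic_int (of_rat (of_int D / 4) + of_rat (of_int n / 2) * r)"
    "algebraic_int (of_rat (of_int D / 4) - of_rat (of_int n / 2) * r)"
    unfolding integral_coords_def mem_Collect_eq conj_coords.simps lin.simps by (simp_all add: of_rat_minus)
  then obtain v w where "rat_of_int D / 4 = of_int v / 2" "rat_of_int n / 2 = of_int w / 2"
      and d: "4 dvd v\<^sup>2 - (a * b) * w\<^sup>2"
    using quadratic_integer[OF _ _ squares(1) sqf(1)] by blast
  then have "rat_of_int D = of_int (2 * v)" "rat_of_int n = of_int w" by linarith+
  then have D: "D = 2 * v" and w: "n = w" unfolding of_int_eq_iff by blast+
  have "even v" "even w" using dvd4_norm_parity(2)[OF d] ab by blast+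
  then have "4 dvd D" unfolding D by presburger
  then have "D mod 4 = 0" by simp
  moreover have "(p\<^sup>2 mod 4 + (a * b mod 4) * (q\<^sup>2 mod 4) - (a * c mod 4) * (u\<^sup>2 mod 4)) mod 4 = D mod 4"
    unfolding D_def by (intro mod_diff_cong mod_add_cong mod_mult_cong) simp_all
  ultimately have "(p\<^sup>2 mod 4 + (a * b mod 4) * (q\<^sup>2 mod 4) - (a * c mod 4) * (u\<^sup>2 mod 4)) mod 4 = 0"
    by simp
  then show ?thesis
    using \<open>even w\<close> unfolding ab ac square_mod4 w[symmetric] n_def
    by (cases "even p"; cases "even q"; cases "even u") simp_all
qed

text \<open>There is no half of \<open>1 + r\<close> to multiply with, so integrality of
  \<open>w = (s + t) / 2\<close> is seen from its square, \<open>c (a + b) / 4 + (c / 2) r\<close>,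
  using that \<open>c\<close> is even and \<open>4 dvd a + b\<close>.\<close>

lemma integral_coords_lattice3r:
  assumes ab: "a * b mod 4 = 3" and ac: "a * c mod 4 = 2"
  shows "integral_coords = lattice3r"
proof -
  have odd: "odd a" "4 dvd a + b" using mult_mod4_eq_3D[OF ab] by blast+
  have "even (a * c)" using ac by (metis dvd_mod_iff even_numeral dvd_refl)
  then have "even c" using odd by simp
  then obtain c' where c': "c = 2 * c'" by (elim evenE)
  obtain h where h: "a + b = 4 * h" using odd(2) by (elim dvdE)
  have w: "(0, 0, 1 / 2, 1 / 2) \<in> integral_coords"
  proof -
    let ?w = "lin r s t (0, 0, 1 / 2, 1 / 2)"
    have "?w * ?w = lin r s t (of_int (2 * c' * h), of_int c', 0, 0)"
    proof -
      have "a * (2 * c') + b * (2 * c') = (a + b) * (2 * c')" by (simp only: distrib_right)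
      also have "\<dots> = 4 * (2 * c' * h)" unfolding h by simp
      finally have "rat_of_int (a * (2 * c')) + of_int (b * (2 * c')) = 4 * of_int (2 * c' * h)"
        by (metis of_int_add of_int_mult of_int_numeral)
      then have "0 * 0 + rat_of_int (a * b) * 0 * 0 + of_int (a * (2 * c')) * (1 / 2) * (1 / 2)
          + of_int (b * (2 * c')) * (1 / 2) * (1 / 2) = of_int (2 * c' * h)"
        by (simp del: of_int_mult add: add_divide_distrib[symmetric])
      moreover have "0 * 0 + 0 * 0 + rat_of_int (2 * c') * (1 / 2 * (1 / 2) + 1 / 2 * (1 / 2)) = of_int c'"
        by simp
      ultimately show ?thesis unfolding lin_mult c'
        by (intro arg_cong[of _ _ "lin r s t"]) (simp only: prod.inject, simp)
    qed
    moreover have "(of_int (2 * c' * h), of_int c', 0, 0) \<in> integral_coords"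
      by (rule integral_coords_eqI[OF integral_coords_combination[OF unit_integral_coords(2,2,2),
            of "2 * c' * h" c' 0 0]]) simp
    ultimately show ?thesis
      unfolding integral_coords_def mem_Collect_eq by (metis algebraic_int_if_square)
  qed
  show ?thesis
  proof
    show "integral_coords \<subseteq> lattice3r"
    proof
      fix x assume x: "x \<in> integral_coords"
      then obtain X1 X2 X3 X4 where xe: "x = (of_int X1 / 4, of_int X2 / 4, of_int X3 / 4, of_int X4 / 4)"
        and d: "4 dvd X1\<^sup>2 - (a * b) * X2\<^sup>2" "4 dvd X1\<^sup>2 - (a * c) * X3\<^sup>2" "4 dvd X1\<^sup>2 - (b * c) * X4\<^sup>2"
        by (rule quarter_coords)
      have "even X1" "even X3" using dvd4_norm_parity(2)[OF d(2)] ac by blast+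
      moreover have "even X2" using dvd4_norm_parity(2)[OF d(1)] ab by blast
      moreover have "even X4" using dvd4_norm_parity(3)[OF d(3) squarefree_mod4[OF sqf(3)]] \<open>even X1\<close> by blast
      ultimately obtain Y1 Y2 Y3 Y4 where "X1 = 2 * Y1" "X2 = 2 * Y2" "X3 = 2 * Y3" "X4 = 2 * Y4"
        by (elim evenE)
      then have xe': "x = (of_int Y1 / 2, of_int Y2 / 2, of_int Y3 / 2, of_int Y4 / 2)"
        unfolding xe by simp
      have "(of_int Y1 / 2, of_int Y2 / 2, of_int (Y3 - Y4) / 2, 0) \<in> integral_coords"
        by (rule integral_coords_eqI[OF integral_coords_add[OF x[unfolded xe']
              integral_coords_combination[OF w w w, of 0 "- Y4" 0 0]]])
          (simp only: prod.inject, intro conjI; simp add: field_simps)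
      then have ev: "even Y1" "even Y2" "even (Y3 - Y4)" using half_rs_coords[OF _ ab ac] by blast+
      then obtain Z1 Z2 where Z: "Y1 = 2 * Z1" "Y2 = 2 * Z2" by (elim evenE)
      have "x = (of_int Z1, of_int Z2, of_int Y3 / 2, of_int Y4 / 2)" unfolding xe' Z by simp
      then show "x \<in> lattice3r" using ev(3) lattice3r_iff by blast
    qed
    show "lattice3r \<subseteq> integral_coords"
    proof
      fix x assume "x \<in> lattice3r"
      then obtain X1 X2 X3 X4 where xe: "x = (of_int X1, of_int X2, of_int X3 / 2, of_int X4 / 2)"
        and d: "even (X3 - X4)"
        unfolding lattice3r_def by blast
      have "even (X4 - X3)" using d by presburger
      then obtain q where q: "X3 = X4 + 2 * q" using even_diffE[of X4 X3] by metis
      show "x \<in> integral_coords"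
        unfolding xe q
        by (rule integral_coords_eqI[OF
              integral_coords_combination[OF w unit_integral_coords(2,3), of X1 X4 X2 q]])
          (simp only: prod.inject, intro conjI; simp add: add_divide_distrib)
    qed
  qed
qed

end

subsection \<open>The three structures\<close>

lemma represents_pm_commute: "represents_pm a b N \<longleftrightarrow> represents_pm b a N"
  unfolding represents_pm_def by (metis add.commute)

lemma represents_pm_minus: "represents_pm (- a) (- b) N \<longleftrightarrow> represents_pm a b N"
proof -
  have "\<bar>- a * x\<^sup>2 + - b * y\<^sup>2\<bar> = \<bar>a * x\<^sup>2 + b * y\<^sup>2\<bar>" for x y
    using abs_minus_cancel[of "a * x\<^sup>2 + b * y\<^sup>2"] by simp
  then show ?thesis unfolding represents_pm_def by simp
qed

lemma squarefree_mult_imp_coprime: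
  fixes a b :: int
  assumes "squarefree (a * b)"
  shows "coprime a b"
proof (rule coprimeI)
  fix e assume "e dvd a" "e dvd b"
  then have "e\<^sup>2 dvd a * b" unfolding power2_eq_square by (rule mult_dvd_mono)
  then show "e dvd 1" by (rule squarefreeD[OF assms])
qed

lemma squarefree_dvd_square:
  fixes a x :: int
  assumes "squarefree a" "a dvd x\<^sup>2"
  shows "a dvd x"
proof -
  obtain y where y: "x\<^sup>2 = a * y" using assms(2) by (elim dvdE)
  have a: "a \<noteq> 0" using assms(1) by auto
  have "of_int a * (rat_of_int x / of_int a)\<^sup>2 = of_int (x\<^sup>2) / of_int a"
    using a by (simp add: power2_eq_square)
  also have "\<dots> = of_int y" unfolding y using a by simp
  finally have "rat_of_int x / of_int a \<in> \<int>"
    using squarefree_mult_square_Ints[OF assms(1)] by (metis Ints_of_int)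
  then obtain z where "rat_of_int x / of_int a = of_int z" by (elim Ints_cases)
  then have "rat_of_int x = of_int (a * z)" using a by (simp add: field_simps)
  then have "x = a * z" unfolding of_int_eq_iff .
  then show ?thesis by simp
qed

lemma solvable_pm_iff_represents_pm:
  assumes sqf: "squarefree a" and N: "N > 0"
  shows "solvable_pm (a * b) (N * a) \<longleftrightarrow> represents_pm a b N"
proof -
  have a: "a \<noteq> 0" using sqf by auto
  have scale: "(a * x)\<^sup>2 + a * b * y\<^sup>2 = a * (a * x\<^sup>2 + b * y\<^sup>2)" for x y
    by (simp add: algebra_simps power2_eq_square)
  have key: "(\<exists>x y. x\<^sup>2 + a * b * y\<^sup>2 = e * a) \<longleftrightarrow> (\<exists>x y. a * x\<^sup>2 + b * y\<^sup>2 = e)" for e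
  proof
    assume "\<exists>x y. x\<^sup>2 + a * b * y\<^sup>2 = e * a"
    then obtain x y where xy: "x\<^sup>2 + a * b * y\<^sup>2 = e * a" by blast
    then have "x\<^sup>2 = a * (e - b * y\<^sup>2)" by (simp add: algebra_simps)
    then have "a dvd x\<^sup>2" by simp
    then obtain x' where "x = a * x'" using squarefree_dvd_square[OF sqf] by blast
    then have "a * (a * x'\<^sup>2 + b * y\<^sup>2) = a * e" using xy unfolding scale[symmetric] by simp
    then show "\<exists>x y. a * x\<^sup>2 + b * y\<^sup>2 = e" using a by auto
  next
    assume "\<exists>x y. a * x\<^sup>2 + b * y\<^sup>2 = e"
    then obtain x y where "a * x\<^sup>2 + b * y\<^sup>2 = e" by blast
    then have "(a * x)\<^sup>2 + a * b * y\<^sup>2 = e * a" unfolding scale by simp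
    then show "\<exists>x y. x\<^sup>2 + a * b * y\<^sup>2 = e * a" by blast
  qed
  have abs: "\<bar>z\<bar> = N \<longleftrightarrow> z = N \<or> z = - N" for z using N by arith
  have "represents_pm a b N \<longleftrightarrow>
      (\<exists>x y. a * x\<^sup>2 + b * y\<^sup>2 = N) \<or> (\<exists>x y. a * x\<^sup>2 + b * y\<^sup>2 = - N)"
    unfolding represents_pm_def abs by blast
  then show ?thesis unfolding solvable_pm_def using key[of N] key[of "- N"] by simp
qed

text \<open>Depends on the field and on \<open>\<zeta>\<close> alone, not on a basis, so that one
  structure can be read in any frame with the same span.\<close>

definition hopf_free :: "complex set \<Rightarrow> complex \<Rightarrow> bool" where
  "hopf_free L \<zeta> \<longleftrightarrow>
     free_of_rank_one (associated_order L (hopf_galois_algebra L \<zeta>)) (ring_of_integers L)"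

section \<open>Permuting the square roots and changing signs\<close>

lemma range_lin_swap_rs: "range (lin s r t) = range (lin r s t)"
proof -
  have "range (lin s r t) \<subseteq> range (lin r s t)" for r s t
  proof
    fix x assume "x \<in> range (lin s r t)"
    then obtain x1 x2 x3 x4 where "x = lin s r t (x1, x2, x3, x4)" by (metis prod_cases4 rangeE)
    then have "x = lin r s t (x1, x3, x2, x4)" by (simp add: lin.simps)
    then show "x \<in> range (lin r s t)" by blast
  qed
  then show ?thesis by blast
qed

lemma range_lin_rotate: "range (lin t r s) = range (lin r s t)"
proof -
  have 1: "lin t r s (x1, x2, x3, x4) = lin r s t (x1, x3, x4, x2)" for x1 x2 x3 x4
    by (simp add: lin.simps)
  have "range (lin t r s) \<subseteq> range (lin r s t)"
  proof
    fix x assume "x \<in> range (lin t r s)"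
    then obtain x1 x2 x3 x4 where "x = lin t r s (x1, x2, x3, x4)" by (metis prod_cases4 rangeE)
    then show "x \<in> range (lin r s t)" unfolding 1 by blast
  qed
  moreover have "range (lin r s t) \<subseteq> range (lin t r s)"
  proof
    fix x assume "x \<in> range (lin r s t)"
    then obtain x1 x3 x4 x2 where "x = lin r s t (x1, x3, x4, x2)" by (metis prod_cases4 rangeE)
    then show "x \<in> range (lin t r s)" unfolding 1[symmetric] by blast
  qed
  ultimately show ?thesis by blast
qed

lemma range_lin_minus: "range (lin r s (- t)) = range (lin r s t)"
proof -
  have "range (lin r s (- t)) \<subseteq> range (lin r s t)" for t
  proof
    fix x assume "x \<in> range (lin r s (- t))"
    then obtain x1 x2 x3 x4 where "x = lin r s (- t) (x1, x2, x3, x4)" by (metis prod_cases4 rangeE)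
    then have "x = lin r s t (x1, x2, x3, - x4)" by (simp add: lin.simps of_rat_minus)
    then show "x \<in> range (lin r s t)" by blast
  qed
  from this[of t] this[of "- t"] show ?thesis by simp
qed

context biquadratic_frame
begin

lemma hopf_free_iff: "hopf_free L r \<longleftrightarrow> cyclic a b integral_coords"
  unfolding hopf_free_def by (rule free_iff_cyclic)

lemma coprime_ab: "coprime a b" and coprime_ac: "coprime a c" and coprime_bc: "coprime b c"
  using sqf by (blast intro: squarefree_mult_imp_coprime)+

lemma frame_swap: "biquadratic_frame a c b s r t"
proof
  show "s * r = of_int a * t" "s * t = of_int c * r" "r * t = of_int b * s"
    using rs rt st by (simp_all add: mult.commute)
  show "squarefree (a * c)" "squarefree (a * b)" "squarefree (c * b)" using sqf by (simp_all add: mult.commute)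
  fix x assume "lin s r t x = 0"
  moreover obtain x1 x2 x3 x4 where x: "x = (x1, x2, x3, x4)" by (cases x)
  ultimately have "lin r s t (x1, x3, x2, x4) = 0" by (simp add: lin.simps ac_simps)
  from indep[OF this] show "x = (0, 0, 0, 0)" unfolding x by simp
qed

lemma frame_rotate: "biquadratic_frame b c a t r s"
proof
  show "t * r = of_int b * s" "t * s = of_int c * r" "r * s = of_int a * t"
    using rs rt st by (simp_all add: mult.commute)
  show "squarefree (b * c)" "squarefree (b * a)" "squarefree (c * a)" using sqf by (simp_all add: mult.commute)
  fix x assume "lin t r s x = 0"
  moreover obtain x1 x2 x3 x4 where x: "x = (x1, x2, x3, x4)" by (cases x)
  ultimately have "lin r s t (x1, x3, x4, x2) = 0" by (simp add: lin.simps ac_simps)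
  from indep[OF this] show "x = (0, 0, 0, 0)" unfolding x by simp
qed

lemma frame_minus: "biquadratic_frame (- a) (- b) (- c) r s (- t)"
proof
  show "r * s = of_int (- a) * - t" "r * - t = of_int (- b) * s" "s * - t = of_int (- c) * r"
    using rs rt st by simp_all
  show "squarefree (- a * - b)" "squarefree (- a * - c)" "squarefree (- b * - c)" using sqf by simp_all
  fix x assume "lin r s (- t) x = 0"
  moreover obtain x1 x2 x3 x4 where x: "x = (x1, x2, x3, x4)" by (cases x)
  ultimately have "lin r s t (x1, x2, x3, - x4) = 0" by (simp add: lin.simps of_rat_minus)
  from indep[OF this] show "x = (0, 0, 0, 0)" unfolding x by simp
qed

text \<open>The same integers in a permuted basis. Swapping and rotating both turn
  \<open>lattice2r\<close> into \<open>lattice2s\<close> and \<open>lattice3r\<close> into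
  \<open>lattice3s\<close>, so each case has only one further lattice.\<close>

lemma integral_coords_swap:
  "biquadratic_frame.integral_coords s r t = {(x1, x2, x3, x4). (x1, x3, x2, x4) \<in> integral_coords}"
  unfolding biquadratic_frame.integral_coords_def[OF frame_swap] integral_coords_def
  by (auto simp: lin.simps ac_simps)

lemma integral_coords_rotate:
  "biquadratic_frame.integral_coords t r s = {(x1, x2, x3, x4). (x1, x3, x4, x2) \<in> integral_coords}"
  unfolding biquadratic_frame.integral_coords_def[OF frame_rotate] integral_coords_def
  by (auto simp: lin.simps ac_simps)

text \<open>The hypotheses make \<open>a, b, c\<close> either all 1 or all 3 mod 4. The second
  possibility becomes the first in the negated frame, and \<open>represents_pm\<close> does not see
  the sign.\<close>

lemma hopf_free_case1:
  assumes ab: "a * b mod 4 = 1" and ac: "a * c mod 4 = 1"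
  shows "hopf_free L r \<longleftrightarrow> represents_pm a b 2"
proof -
  have "a mod 4 = 1 \<and> b mod 4 = 1 \<and> c mod 4 = 1 \<or> a mod 4 = 3 \<and> b mod 4 = 3 \<and> c mod 4 = 3"
    using ab ac unfolding mult_mod4_eq_1_iff by auto
  then show ?thesis
  proof
    assume 1: "a mod 4 = 1 \<and> b mod 4 = 1 \<and> c mod 4 = 1"
    then have "integral_coords = lattice1" by (intro integral_coords_lattice1) blast+
    then show ?thesis unfolding hopf_free_iff using cyclic_lattice1[of a b] 1 coprime_ab by simp
  next
    assume 3: "a mod 4 = 3 \<and> b mod 4 = 3 \<and> c mod 4 = 3"
    interpret neg: biquadratic_frame "- a" "- b" "- c" r s "- t" by (rule frame_minus)
    have m: "- a mod 4 = 1" "- b mod 4 = 1" "- c mod 4 = 1" using 3 by presburger+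
    have "hopf_free L r \<longleftrightarrow> hopf_free neg.L r" unfolding range_lin_minus ..
    also have "\<dots> \<longleftrightarrow> represents_pm (- a) (- b) 2"
      unfolding neg.hopf_free_iff neg.integral_coords_lattice1[OF m]
      using cyclic_lattice1[OF m(1,2)] coprime_ab by simp
    finally show ?thesis unfolding represents_pm_minus .
  qed
qed

lemma hopf_free_case2:
  assumes ab: "a * b mod 4 = 1" and ac: "a * c mod 4 \<noteq> 1"
  shows "hopf_free L r \<longleftrightarrow> represents_pm a b 2" "\<not> hopf_free L s" "\<not> hopf_free L t"
proof -
  note ic = integral_coords_lattice2r[OF ab ac]
  show "hopf_free L r \<longleftrightarrow> represents_pm a b 2"
    unfolding hopf_free_iff ic by (rule cyclic_lattice2r[OF ab coprime_ab])
  interpret swap: biquadratic_frame a c b s r t by (rule frame_swap)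
  have "swap.integral_coords = lattice2s"
    unfolding integral_coords_swap ic lattice2r_def lattice2s_def by auto
  then have "\<not> hopf_free swap.L s" unfolding swap.hopf_free_iff
    using not_cyclic_lattice2s[OF coprime_ac] by simp
  then show "\<not> hopf_free L s" unfolding range_lin_swap_rs .
  interpret rot: biquadratic_frame b c a t r s by (rule frame_rotate)
  have "rot.integral_coords = lattice2s"
    unfolding integral_coords_rotate ic lattice2r_def lattice2s_def by auto
  then have "\<not> hopf_free rot.L t" unfolding rot.hopf_free_iff
    using not_cyclic_lattice2s[OF coprime_bc] by simp
  then show "\<not> hopf_free L t" unfolding range_lin_rotate .
qed

lemma hopf_free_case3:
  assumes ab: "a * b mod 4 = 3" and ac: "a * c mod 4 = 2"
  shows "hopf_free L r \<longleftrightarrow> represents_pm a b 4" "hopf_free L s \<longleftrightarrow> represents_pm a c 2"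
    "hopf_free L t \<longleftrightarrow> represents_pm b c 2"
proof -
  note ic = integral_coords_lattice3r[OF ab ac]
  have odd: "odd a" "odd b" using mult_mod4_eq_3D[OF ab] by blast+
  have "a mod 4 = 1 \<or> a mod 4 = 3" using odd by presburger
  then have "c mod 4 = 2 \<or> (- c) mod 4 = 2" using ac by (auto simp: mult_mod4)
  \<comment> \<open>The odd factor \<open>a\<close> of \<open>a * c\<close> changes \<open>c\<close>
    mod 4 at most by a sign, and 2 is its own negative.\<close>
  then have c: "c mod 4 = 2" by presburger
  show "hopf_free L r \<longleftrightarrow> represents_pm a b 4"
    unfolding hopf_free_iff ic by (rule cyclic_lattice3r[OF ab coprime_ab])
  interpret swap: biquadratic_frame a c b s r t by (rule frame_swap)
  have "swap.integral_coords = lattice3s"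
    unfolding integral_coords_swap ic lattice3r_def lattice3s_def by auto
  then have "hopf_free swap.L s \<longleftrightarrow> represents_pm a c 2" unfolding swap.hopf_free_iff
    using cyclic_lattice3s[OF odd(1) c coprime_ac] by simp
  then show "hopf_free L s \<longleftrightarrow> represents_pm a c 2" unfolding range_lin_swap_rs .
  interpret rot: biquadratic_frame b c a t r s by (rule frame_rotate)
  have "rot.integral_coords = lattice3s"
    unfolding integral_coords_rotate ic lattice3r_def lattice3s_def by auto
  then have "hopf_free rot.L t \<longleftrightarrow> represents_pm b c 2" unfolding rot.hopf_free_iff
    using cyclic_lattice3s[OF odd(2) c coprime_bc] by simp
  then show "hopf_free L t \<longleftrightarrow> represents_pm b c 2" unfolding range_lin_rotate .
qed

lemma hopf_free_case1_others:
  assumes ab: "a * b mod 4 = 1" and ac: "a * c mod 4 = 1"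
  shows "hopf_free L s \<longleftrightarrow> represents_pm a c 2" "hopf_free L t \<longleftrightarrow> represents_pm b c 2"
proof -
  interpret swap: biquadratic_frame a c b s r t by (rule frame_swap)
  show "hopf_free L s \<longleftrightarrow> represents_pm a c 2"
    using swap.hopf_free_case1[OF ac ab] unfolding range_lin_swap_rs .
  interpret rot: biquadratic_frame b c a t r s by (rule frame_rotate)
  have "b * c mod 4 = 1" using ab ac unfolding mult_mod4_eq_1_iff by auto
  moreover have "b * a mod 4 = 1" using ab by (simp add: mult.commute)
  ultimately show "hopf_free L t \<longleftrightarrow> represents_pm b c 2"
    using rot.hopf_free_case1 unfolding range_lin_rotate by blast
qed

end

section \<open>The frame attached to \<open>m\<close> and \<open>n\<close>, with
  \<open>a = d\<close>, \<open>b = m / d\<close>, \<open>c = n / d\<close>\<close>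

lemma square_csqrt: "csqrt z * csqrt z = z"
  using power2_csqrt[of z] by (simp add: power2_eq_square)

theorem theorem5p9:
  fixes m n d k :: int
    and L OL :: "complex set"
    and H1 H2 H3 :: "(complex \<Rightarrow> complex) set"
  assumes "squarefree m" and "squarefree n"
    and "L = rat_adjoin {csqrt (of_int m), csqrt (of_int n)}"
    and "biquadratic L"
    and "d = gcd m n"
    and "k = (m * n) div d\<^sup>2"
    and "OL = ring_of_integers L"
    and "H1 = hopf_galois_algebra L (csqrt (of_int m))"
    and "H2 = hopf_galois_algebra L (csqrt (of_int n))"
    and "H3 = hopf_galois_algebra L (csqrt (of_int m) * csqrt (of_int n) / of_int d)"
  shows
    "([m = 1] (mod 4) \<and> [n = 1] (mod 4) \<longrightarrow>
        (free_of_rank_one (associated_order L H1) OL \<longleftrightarrow> solvable_pm m (2 * d)) \<and>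
        (free_of_rank_one (associated_order L H2) OL \<longleftrightarrow> solvable_pm n (2 * d)) \<and>
        (free_of_rank_one (associated_order L H3) OL \<longleftrightarrow> solvable_pm k (2 * (n div d))))
     \<and>
     ([m = 1] (mod 4) \<and> \<not> [n = 1] (mod 4) \<longrightarrow>
        (free_of_rank_one (associated_order L H1) OL \<longleftrightarrow> solvable_pm m (2 * d)) \<and>
        \<not> free_of_rank_one (associated_order L H2) OL \<and>
        \<not> free_of_rank_one (associated_order L H3) OL)
     \<and>
     ([m = 3] (mod 4) \<and> [n = 2] (mod 4) \<longrightarrow>
        (free_of_rank_one (associated_order L H1) OL \<longleftrightarrow> solvable_pm m (4 * d)) \<and>
        (free_of_rank_one (associated_order L H2) OL \<longleftrightarrow> solvable_pm n (2 * d)) \<and>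
        (free_of_rank_one (associated_order L H3) OL \<longleftrightarrow> solvable_pm k (2 * (n div d))))"
proof -
  define r where "r = csqrt (of_int m)"
  define s where "s = csqrt (of_int n)"
  define t where "t = r * s / of_int d"
  define b where "b = m div d"
  define c where "c = n div d"
  have "m \<noteq> 0" using assms(1) by auto
  then have "d \<noteq> 0" unfolding assms(5) by simp
  have m: "m = d * b" and n: "n = d * c" unfolding b_def c_def assms(5) by simp_all
  have rr: "r * r = of_int m" and ss: "s * s = of_int n" unfolding r_def s_def by (rule square_csqrt)+
  have rs: "r * s = of_int d * t" unfolding t_def using \<open>d \<noteq> 0\<close> by simp
  have "r * t = (r * r) * s / of_int d" unfolding t_def by simp
  also have "\<dots> = of_int b * s" unfolding rr m using \<open>d \<noteq> 0\<close> by simp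
  finally have rt: "r * t = of_int b * s" .
  have "s * t = (s * s) * r / of_int d" unfolding t_def by simp
  also have "\<dots> = of_int c * r" unfolding ss n using \<open>d \<noteq> 0\<close> by simp
  finally have st: "s * t = of_int c * r" .
  have L: "L = range (lin r s t)"
    unfolding assms(3) r_def[symmetric] s_def[symmetric]
    by (rule rat_adjoin_eq_range_lin[where a = "of_int d"]) (use rr ss rs \<open>d \<noteq> 0\<close> in auto)
  have "rat_vector_space.dim (range (lin r s t)) = 4"
    using assms(4) unfolding biquadratic_def L by blast
  note indep = lin_independent[OF this]
  have "squarefree b" "squarefree c" using assms(1,2) unfolding m n by (blast dest: squarefree_multD)+
  moreover have "coprime b c"
    using div_gcd_coprime[of m n] \<open>m \<noteq> 0\<close> unfolding b_def c_def assms(5) by simp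
  ultimately have "squarefree (b * c)" by (intro squarefree_mult_coprime)
  then interpret biquadratic_frame d b c r s t
    using rs rt st assms(1,2)[unfolded m n] indep by unfold_locales auto
  have k: "k = c * b" unfolding assms(6) m n power2_eq_square using \<open>d \<noteq> 0\<close> by simp
  have sqf: "squarefree d" using assms(1) unfolding m by (blast dest: squarefree_multD)
  \<comment> \<open>The third equation is scaled by \<open>c = n / d\<close>, so
    \<open>k = c b\<close> corresponds to the form \<open>c x^2 + b y^2\<close>; its variables are
    exchanged to match the rotated frame.\<close>
  have solvable: "N > 0 \<Longrightarrow> solvable_pm m (N * d) \<longleftrightarrow> represents_pm d b N"
    "N > 0 \<Longrightarrow> solvable_pm n (N * d) \<longleftrightarrow> represents_pm d c N"
    "N > 0 \<Longrightarrow> solvable_pm k (N * (n div d)) \<longleftrightarrow> represents_pm b c N" for N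
    unfolding k c_def[symmetric] represents_pm_commute[of b c] unfolding m n
    using solvable_pm_iff_represents_pm[OF sqf] solvable_pm_iff_represents_pm[OF \<open>squarefree c\<close>] by blast+
  have free: "free_of_rank_one (associated_order L H1) OL \<longleftrightarrow> hopf_free (range (lin r s t)) r"
    "free_of_rank_one (associated_order L H2) OL \<longleftrightarrow> hopf_free (range (lin r s t)) s"
    "free_of_rank_one (associated_order L H3) OL \<longleftrightarrow> hopf_free (range (lin r s t)) t"
    unfolding assms(7-10) hopf_free_def r_def[symmetric] s_def[symmetric] t_def[symmetric] L
    by (rule refl)+
  have mod: "[m = 1] (mod 4) \<longleftrightarrow> d * b mod 4 = 1" "[n = 1] (mod 4) \<longleftrightarrow> d * c mod 4 = 1"
    "[m = 3] (mod 4) \<longleftrightarrow> d * b mod 4 = 3" "[n = 2] (mod 4) \<longleftrightarrow> d * c mod 4 = 2"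
    unfolding cong_def m n by simp_all
  show ?thesis
    unfolding free mod
    using hopf_free_case1 hopf_free_case1_others hopf_free_case2 hopf_free_case3
      solvable[of 2] solvable[of 4]
    by (metis zero_less_numeral)
qed

end
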